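(* The following four statements hold. (1) If $m=m(n)$ satisfies $m=o(\ln n)$ as $n\to\infty$, then $$\max_{A \in \mathcal{S}^n}\ \mathbb{P}_{b \sim \mathcal{U}(S^{n-1})} \left[ \frac{\lambda_1(A) - \lambda_1^{(m)}(A,b)}{\lambda_1(A)-\lambda_n(A)} \ge 1-o(1) \right] \ge 1 - o(1/n).$$ (2) If $m=m(n)$ satisfies $m=\Theta(\ln n)$ as $n\to\infty$, then $$\max_{A \in \mathcal{S}^n}\ \mathbb{P}_{b \sim \mathcal{U}(S^{n-1})} \left[ \frac{\lambda_1(A) - \lambda_1^{(m)}(A,b)}{\lambda_1(A)-\lambda_n(A)} \ge \frac{.015 \ln^2 n}{ m^2 \ln^2 \ln n} \right] \ge 1 - o(1/n).$$ (3) If $m=m(n)$ satisfies $m=o\left(n^{1/2}\ln^{-1/2}n\right)$ and $m=\omega(1)$ as $n\to\infty$, then $$\max_{A \in \mathcal{S}^n}\ \mathbb{P}_{b \sim \mathcal{U}(S^{n-1})} \left[ \frac{\lambda_1(A) - \lambda_1^{(m)}(A,b)}{\lambda_1(A)-\lambda_n(A)} \ge \frac{1.08}{m^2} \right] \ge 1 - o(1/n).$$ (4) For all integers $n\ge 100$, $m\ge 10$ and all real $p\ge 1$, $$\max_{A \in \mathcal{S}^n}\ \mathbb{E}_{b \sim \mathcal{U}(S^{n-1})} \left[ \left( \frac{\lambda_1(A) - \lambda_1^{(m)}(A,b)}{\lambda_1(A) -\lambda_n(A)}\right)^p \right]^{1/p} \le .068 \, \frac{ \ln^2 \left(n(m-1)^{8p}\right)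 }{ (m-1)^2}.$$
   Context: $\mathcal{S}^n$ is the set of real symmetric $n\times n$ matrices; the eigenvalues of $A\in\mathcal{S}^n$, with multiplicity, are $\lambda_1(A)\ge\dots\ge\lambda_n(A)$. $\mathcal{U}(S^{n-1})$ is the uniform probability measure on $S^{n-1}=\{x\in\mathbb{R}^n : \|x\|=1\}$. For a positive integer $m$ and a nonzero $b\in\mathbb{R}^n$, the Krylov subspace is $\mathcal{K}_m(A,b)=\mathrm{span}\{b,Ab,\dots,A^{m-1}b\}$, and the largest Ritz value (the approximation of $\lambda_1(A)$ after $m$ iterations of the Lanczos method, in exact arithmetic) is $$\lambda_1^{(m)}(A,b)=\max_{x\in\mathcal{K}_m(A,b),\,x\neq 0}\frac{x^TAx}{x^Tx}.$$ The relative error quotient is taken to be $0$ when $\lambda_1(A)=\lambda_n(A)$. "Max" over $A\in\mathcal{S}^n$ is read as a supremum. Asymptotic notation is as $n\to\infty$, with $m=m(n)$ a positive-integer-valued function of $n$: $f=o(g)$ means $f(n)/g(n)\to 0$; $f=\omega(g)$ means $g=o(f)$; $f=\Theta(g)$ means $f=O(g)$ and $g=O(f)$. In (1)–(3), given the function $m(n)$, the claim is that there is a sequence $\eta_n$ with $n\eta_n\to 0$ (and in (1) also a sequence $\varepsilon_n\to 0$) such that the inequality holds for all sufficiently large $n$ with $o(1/n)$ replaced by $\eta_n$ (and $o(1)$ replaced by $\varepsilon_n$). *)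

theory Defs
  imports
    "HOL-Probability.Probability"
    "Jordan_Normal_Form.Char_Poly"
    "Jordan_Normal_Form.VS_Connect"
begin

hide_const (open) Finite_Cartesian_Product.vec Finite_Cartesian_Product.mat
no_notation inner (infix \<open>\<bullet>\<close> 70)

definition sym_mats :: "nat \<Rightarrow> real mat set" where
  "sym_mats n = {A \<in> carrier_mat n n. A\<^sup>T = A}"

text \<open>The \<open>i\<close>-th largest eigenvalue, counted with multiplicity; \<open>i\<close> runs from \<open>1\<close> to the
  dimension.\<close>

definition eigval :: "real mat \<Rightarrow> nat \<Rightarrow> real" where
  "eigval A i = rev (sorted_list_of_multiset (proots (char_poly A))) ! (i - 1)"

definition krylov :: "nat \<Rightarrow> real mat \<Rightarrow> real vec \<Rightarrow> real vec set" where
  "krylov m A b =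
     LinearCombinations.module.span class_ring (module_vec TYPE(real) (dim_vec b))
       {(A ^\<^sub>m k) *\<^sub>v b | k. k < m}"

text \<open>For \<open>m \<ge> 1\<close> and \<open>b \<noteq> 0\<close> the supremum is attained, since the Rayleigh quotient is
  homogeneous of degree 0 and the unit sphere of the Krylov subspace is compact.\<close>

definition ritz_max :: "nat \<Rightarrow> real mat \<Rightarrow> real vec \<Rightarrow> real" where
  "ritz_max m A b =
     (SUP x \<in> krylov m A b - {0\<^sub>v (dim_vec b)}. (x \<bullet> (A *\<^sub>v x)) / (x \<bullet> x))"

text \<open>When the largest and smallest eigenvalues coincide, the quotient is 0 because
  \<open>x / 0 = 0\<close>.\<close>

definition rel_err :: "nat \<Rightarrow> real mat \<Rightarrow> real vec \<Rightarrow> real" where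
  "rel_err m A b =
     (eigval A 1 - ritz_max m A b) / (eigval A 1 - eigval A (dim_row A))"

text \<open>Lebesgue measure on \<open>carrier_vec n\<close>, transported along \<open>vec n\<close>, which is injective on the
  extensional functions.\<close>

definition lborel_vec :: "nat \<Rightarrow> real vec measure" where
  "lborel_vec n = embed_measure (PiM {..<n} (\<lambda>_. lborel)) (vec n)"

definition unit_ball_vec :: "nat \<Rightarrow> real vec set" where
  "unit_ball_vec n = {x \<in> carrier_vec n. x \<bullet> x \<le> 1}"

definition unit_sphere_vec :: "nat \<Rightarrow> real vec set" where
  "unit_sphere_vec n = {x \<in> carrier_vec n. x \<bullet> x = 1}"

text \<open>The normalised surface measure: a Borel subset \<open>B\<close> of the sphere has the measure of the cone
  \<open>{t x | 0 < t \<le> 1, x \<in> B}\<close> divided by that of the unit ball. In other words, it is the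
  law of \<open>x / \<parallel>x\<parallel>\<close> for \<open>x\<close> uniform in the ball. The origin, which has no direction, is a null set
  for \<open>n \<ge> 1\<close>.\<close>

definition uniform_sphere :: "nat \<Rightarrow> real vec measure" where
  "uniform_sphere n =
     restrict_space
       (distr (uniform_measure (lborel_vec n) (unit_ball_vec n)) (lborel_vec n)
          (\<lambda>x. (1 / sqrt (x \<bullet> x)) \<cdot>\<^sub>v x))
       (unit_sphere_vec n)"

end

theory Submission
  imports Defs "Jordan_Normal_Form.Schur_Decomposition" "HOL-Real_Asymp.Real_Asymp"
begin

text \<open>
  Let \<open>d\<^sub>i\<close> be the eigenvalues of \<open>A\<close> and \<open>c\<^sub>i\<close> the coordinates of \<open>b\<close> in an orthonormal eigenbasis. The
  vectors of the Krylov space are those with coordinates \<open>P(d\<^sub>i) c\<^sub>i\<close>, where \<open>P\<close> is a polynomial of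
  degree less than \<open>m\<close>. Hence the largest Ritz value is at most \<open>\<tau>\<close> exactly if
  \<open>\<Sum> (P(d\<^sub>i) c\<^sub>i)\<^sup>2 (\<tau> - d\<^sub>i) \<ge> 0\<close> for all these \<open>P\<close> (\<open>ritz_max_le_iff\<close>). What remains is the interplay of
  two facts: how fast polynomials of bounded degree can grow, which Chebyshev polynomials answer, and
  how the \<open>c\<^sub>i\<^sup>2\<close> are distributed.

  For the second, uniform points on the sphere are replaced by Gaussian vectors. A radial weight
  integrates over a cone to the volume of the cone inside the unit ball times a factor that does
  not depend on the cone, because it is a mixture of indicators of balls. So cones have the same
  measure for the Gaussian law as for the uniform law on the sphere (\<open>uniform_sphere_eq_gauss\<close>), and
  the \<open>c\<^sub>i\<close> may be treated as independent standard normal variables.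

  Lower bounds. The test matrix is diagonal. It has the simple eigenvalue \<open>1\<close>, and its other
  eigenvalues are spread evenly over the \<open>m\<close> zeros \<open>\<xi>\<^sub>j\<close> of \<open>T\<^sub>m\<close>, shifted to \<open>[0, 1 - \<delta>]\<close>. Lagrange
  interpolation at these nodes shows \<open>|P(1)| \<le> 2 T\<^sub>m(y) \<Sum> |P(\<xi>\<^sub>j)|\<close> with \<open>y = (1 + \<delta>) / (1 - \<delta>)\<close>
  (\<open>abs_poly_le_cheb\<close>), so no admissible polynomial can be large at \<open>1\<close> only. Outside an event of
  probability \<open>o(1/n)\<close> the top coordinate has \<open>c\<^sub>0\<^sup>2 \<le> 8 ln n\<close> and every node carries squared mass of
  order \<open>n/m\<close> (\<open>gauss_good_event\<close>), and then the error is at least \<open>\<gamma> < \<delta>\<close> as soon as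
  \<open>256 \<gamma> m\<^sup>2 ln n z\<^bsup>2m\<^esup> \<le> (\<delta> - \<gamma>) n\<close>, where \<open>z = (1 + sqrt \<delta>) / (1 - sqrt \<delta>)\<close> (\<open>lower_bound\<close>). For
  \<open>\<gamma> = 1.08 / m\<^sup>2\<close> and for \<open>\<gamma>\<close> of order \<open>(ln n / (m ln ln n))\<^sup>2\<close> the choice \<open>\<delta> = 2 \<gamma>\<close> works, since
  \<open>z\<^bsup>2m\<^esup> \<le> exp (8 m sqrt \<delta>)\<close> is bounded in the first case and \<open>n\<^bsup>o(1)\<^esup>\<close> in the second. For
  \<open>m = o(ln n)\<close> one takes \<open>\<gamma> = 1 - \<epsilon>\<close> and \<open>\<delta> = 1 - \<epsilon>/2\<close>, and \<open>z \<le> 8/\<epsilon>\<close> allows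
  \<open>\<epsilon> = exp (- sqrt (ln n / m))\<close>.

  Upper bound. With \<open>k = m - 1\<close>, the polynomial \<open>T\<^sub>k\<close>, transported so that \<open>[-1, 1]\<close> corresponds to the
  spectrum without its top part of relative length \<open>\<gamma>\<close>, bounds the error by
  \<open>\<gamma> + 4 exp (- 4 k sqrt \<gamma>) / c\<^sub>1\<^sup>2\<close> (\<open>rel_err_le_cheb\<close>), where \<open>c\<^sub>1\<close> is the coordinate of the unit vector
  \<open>b\<close> along a top eigenvector. Since \<open>|c\<^sub>1| \<le> s\<close> has probability at most \<open>4 s sqrt n\<close>
  (\<open>sphere_slab\<close>), the \<open>p\<close>-th moment is at most \<open>(\<gamma> + 4 exp (- 4 k sqrt \<gamma>) / s\<^sup>2)\<^sup>p + 4 s sqrt n\<close>. Now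
  let \<open>L = ln (n k\<^bsup>8p\<^esup>)\<close>, \<open>sqrt \<gamma> = L / (4 k)\<close> and \<open>s = k\<^bsup>-2p\<^esup> / (2 sqrt n)\<close>. Then \<open>\<gamma>\<close> is \<open>1/16\<close> times
  \<open>L\<^sup>2 / k\<^sup>2\<close>, and the remaining terms fit into the gap between \<open>1/16\<close> and \<open>0.068\<close>.
\<close>

section \<open>Chebyshev polynomials and interpolation at their zeros\<close>

text \<open>The Chebyshev polynomials \<open>T\<^sub>n\<close> of the first kind.\<close>

fun cheb :: "nat \<Rightarrow> real poly" where
  "cheb 0 = 1"
| "cheb (Suc 0) = [:0, 1:]"
| "cheb (Suc (Suc n)) = [:0, 2:] * cheb (Suc n) - cheb n"

lemma poly_cheb_cos: "poly (cheb n) (cos t) = cos (real n * t)"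
proof (induction n rule: cheb.induct)
  case (3 n)
  have "cos (real (Suc (Suc n)) * t) = 2 * cos t * cos (real (Suc n) * t) - cos (real n * t)"
    using cos_add[of "real (Suc n) * t" t] cos_diff[of "real (Suc n) * t" t]
    by (simp add: algebra_simps)
  then show ?case using 3 by simp
qed auto

text \<open>The Joukowski parametrisation linearises the recursion, just as the cosine does on \<open>[-1, 1]\<close>.
  It gives the growth of \<open>T\<^sub>n\<close> outside that interval.\<close>

lemma poly_cheb_half_sum_inverse:
  fixes z :: real assumes "z \<noteq> 0"
  shows "poly (cheb n) ((z + 1 / z) / 2) = (z ^ n + 1 / z ^ n) / 2"
proof (induction n rule: cheb.induct)
  case (3 n)
  have "poly (cheb (Suc (Suc n))) ((z + 1 / z) / 2)
      = (z + 1 / z) * ((z ^ Suc n + 1 / z ^ Suc n) / 2) - (z ^ n + 1 / z ^ n) / 2"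
    by (simp only: 3[symmetric]) simp
  also have "\<dots> = (z ^ Suc (Suc n) + 1 / z ^ Suc (Suc n)) / 2"
    using assms by (simp add: field_simps)
  finally show ?case .
qed (use assms in auto)

lemma poly_cheb_nonneg:
  assumes "1 \<le> y"
  shows "0 \<le> poly (cheb n) y"
proof -
  define z where "z = y + sqrt (y\<^sup>2 - 1)"
  have zp: "z > 0" using assms unfolding z_def by (intro add_pos_nonneg) auto
  have "z * (y - sqrt (y\<^sup>2 - 1)) = 1"
    using assms by (simp add: z_def algebra_simps power2_eq_square[symmetric])
  then have "1 / z = y - sqrt (y\<^sup>2 - 1)" using zp by (simp add: field_simps)
  then have y: "y = (z + 1 / z) / 2" by (simp add: z_def)
  show ?thesis unfolding y by (subst poly_cheb_half_sum_inverse) (use zp in auto)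
qed

lemma degree_cheb_le: "degree (cheb n) \<le> n"
proof (induction n rule: cheb.induct)
  case (3 n)
  have "degree ([:0, 2:] * cheb (Suc n)) \<le> Suc (Suc n)"
    using degree_mult_le[of "[:0,2:]" "cheb (Suc n)"] 3(1) by simp
  then show ?case using 3 by (auto intro!: degree_diff_le)
qed auto

lemma abs_poly_cheb_le_1: "\<bar>y\<bar> \<le> 1 \<Longrightarrow> \<bar>poly (cheb n) y\<bar> \<le> 1"
  using poly_cheb_cos[of n "arccos y"] cos_arccos[of y] by (simp add: abs_le_iff)

definition cheb_angle :: "nat \<Rightarrow> nat \<Rightarrow> real" where
  "cheb_angle m j = (2 * real j + 1) * pi / (2 * real m)"

text \<open>The zeros of \<open>T\<^sub>m\<close>, in decreasing order for \<open>j = 0, ..., m - 1\<close>.\<close>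

definition cheb_node :: "nat \<Rightarrow> nat \<Rightarrow> real" where
  "cheb_node m j = cos (cheb_angle m j)"

lemma cheb_angle_bounds:
  assumes "j < m"
  shows "pi / (2 * real m) \<le> cheb_angle m j" "cheb_angle m j < pi"
proof -
  have "2 * real j + 1 < 2 * real m" using assms by linarith
  then have "(2 * real j + 1) * pi < 2 * real m * pi" by simp
  then show "cheb_angle m j < pi" 
    using assms unfolding cheb_angle_def by (simp add: field_simps)
  show "pi / (2 * real m) \<le> cheb_angle m j"
    using assms unfolding cheb_angle_def by (auto simp: field_simps)
qed

lemma cheb_angle_pos: "j < m \<Longrightarrow> 0 < cheb_angle m j"
  unfolding cheb_angle_def by (intro divide_pos_pos mult_pos_pos) auto

lemma inj_on_cheb_node: "inj_on (cheb_node m) {..<m}"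
proof (rule inj_onI)
  fix i j assume ij: "i \<in> {..<m}" "j \<in> {..<m}" "cheb_node m i = cheb_node m j"
  have "0 \<le> cheb_angle m k \<and> cheb_angle m k \<le> pi" if "k \<in> {..<m}" for k
    using cheb_angle_pos[of k m] cheb_angle_bounds(2)[of k m] that by simp
  with ij have "cheb_angle m i = cheb_angle m j"
    unfolding cheb_node_def using cos_inj_pi by blast
  with ij show "i = j" unfolding cheb_angle_def by simp
qed

lemma sin_cos_cheb_angle:
  assumes "j < m"
  shows "cos (real m * cheb_angle m j) = 0" "\<bar>sin (real m * cheb_angle m j)\<bar> = 1"
proof -
  have "real m * cheb_angle m j = real j * pi + pi / 2"
    using assms unfolding cheb_angle_def by (simp add: field_simps)
  then show c: "cos (real m * cheb_angle m j) = 0"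
    by (simp add: cos_add sin_npi)
  then show "\<bar>sin (real m * cheb_angle m j)\<bar> = 1"
    using sin_cos_squared_add[of "real m * cheb_angle m j"] by (simp add: power2_eq_1_iff) linarith
qed

lemma poly_cheb_node: "j < m \<Longrightarrow> poly (cheb m) (cheb_node m j) = 0"
  unfolding cheb_node_def poly_cheb_cos by (rule sin_cos_cheb_angle)

text \<open>Differentiate \<open>T\<^sub>m(cos t) = cos (m t)\<close> at a zero, where the sine of \<open>m t\<close> is \<open>1\<close> or \<open>-1\<close>.\<close>

lemma abs_pderiv_cheb_node:
  assumes "j < m"
  shows "\<bar>poly (pderiv (cheb m)) (cheb_node m j)\<bar> * sin (cheb_angle m j) = real m"
proof -
  let ?t = "cheb_angle m j"
  have 1: "((\<lambda>t. poly (cheb m) (cos t)) has_field_derivative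
      poly (pderiv (cheb m)) (cos ?t) * (- sin ?t)) (at ?t)"
    by (rule DERIV_chain2[OF poly_DERIV DERIV_cos])
  have "((\<lambda>t. cos (real m * t)) has_field_derivative - sin (real m * ?t) * real m) (at ?t)"
    by (auto intro!: derivative_eq_intros)
  then have "poly (pderiv (cheb m)) (cos ?t) * sin ?t = sin (real m * ?t) * real m"
    using DERIV_unique[OF 1[unfolded poly_cheb_cos]] by fastforce
  then have "\<bar>poly (pderiv (cheb m)) (cos ?t)\<bar> * \<bar>sin ?t\<bar> = real m"
    using sin_cos_cheb_angle(2)[OF assms] by (metis abs_mult abs_of_nat mult_1)
  moreover have "sin ?t > 0" using cheb_angle_pos cheb_angle_bounds(2) assms by (intro sin_gt_zero)
  ultimately show ?thesis unfolding cheb_node_def by simp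
qed

text \<open>The chord from \<open>0\<close> to \<open>pi / 2\<close> lies below the graph, by concavity.\<close>

lemma two_div_pi_le_sin:
  assumes "0 \<le> x" "x \<le> pi / 2"
  shows "2 / pi * x \<le> sin x"
proof -
  have "concave_on {0..pi} sin"
    by (rule f''_le0_imp_concave[where f' = cos and f'' = "\<lambda>x. - sin x"])
       (auto intro!: derivative_eq_intros sin_ge_zero)
  then have "(1 - 2 / pi * x) * sin 0 + (2 / pi * x) * sin (pi / 2)
      \<le> sin ((1 - 2 / pi * x) *\<^sub>R 0 + (2 / pi * x) *\<^sub>R (pi / 2))"
    by (intro concave_onD) (use assms in \<open>auto simp: field_simps\<close>)
  then show ?thesis by simp
qed

text \<open>The quotient of the sine and \<open>1 - cos\<close> is the cotangent of half the angle, which is largest at the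
  smallest angle \<open>pi / (2m)\<close>.\<close>

lemma sin_div_one_minus_cos_cheb_angle:
  assumes "j < m"
  shows "sin (cheb_angle m j) \<le> 2 * real m * (1 - cheb_node m j)"
proof -
  let ?u = "cheb_angle m j / 2"
  have u: "0 < ?u" "?u < pi / 2"
    using cheb_angle_pos[OF assms] cheb_angle_bounds(2)[OF assms] by auto
  have "1 / (2 * real m) \<le> 2 / pi * ?u"
    using cheb_angle_bounds(1)[OF assms] assms by (simp add: field_simps)
  also have "\<dots> \<le> sin ?u" using u by (intro two_div_pi_le_sin) auto
  finally have s: "1 \<le> 2 * real m * sin ?u" using assms by (simp add: field_simps)
  have "sin (cheb_angle m j) = 2 * sin ?u * cos ?u" using sin_double[of ?u] by simp
  also have "\<dots> \<le> 2 * sin ?u * 1" using u by (intro mult_left_mono) (auto intro!: sin_ge_zero)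
  also have "\<dots> \<le> 2 * sin ?u * (2 * real m * sin ?u)"
    using s u by (intro mult_left_mono) (auto intro!: sin_ge_zero)
  also have "\<dots> = 2 * real m * (1 - cheb_node m j)"
    using cos_double_sin[of ?u] by (simp add: cheb_node_def power2_eq_square)
  finally show ?thesis .
qed

text \<open>The Lagrange basis polynomial of the node \<open>x\<^sub>j = cos \<theta>\<^sub>j\<close> is \<open>T\<^sub>m(y) / (T\<^sub>m'(x\<^sub>j) (y - x\<^sub>j))\<close>. With
  \<open>|T\<^sub>m'(x\<^sub>j)| = m / sin \<theta>\<^sub>j\<close> its modulus at \<open>y > 1\<close> is at most \<open>T\<^sub>m(y) sin \<theta>\<^sub>j / (m (1 - cos \<theta>\<^sub>j)) \<le> 2 T\<^sub>m(y)\<close>,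
  uniformly in \<open>j\<close>.\<close>

lemma abs_poly_le_cheb:
  assumes deg: "degree P < m" and y: "1 < y"
  shows "\<bar>poly P y\<bar> \<le> 2 * poly (cheb m) y * (\<Sum>j<m. \<bar>poly P (cheb_node m j)\<bar>)"
proof -
  let ?x = "cheb_node m" and ?D = "\<lambda>j. poly (pderiv (cheb m)) (cheb_node m j)"
  define q where "q j = cheb m div [:- ?x j, 1:]" for j
  have T: "cheb m = [:- ?x j, 1:] * q j" if "j < m" for j
    using poly_cheb_node[OF that] unfolding q_def poly_eq_0_iff_dvd by (rule dvd_mult_div_cancel[symmetric])
  have D: "?D j \<noteq> 0" if "j < m" for j
    using abs_pderiv_cheb_node[OF that] that by auto
  have qj: "poly (q j) (?x j) = ?D j" if "j < m" for j
    using arg_cong[OF T[OF that], of "\<lambda>p. poly (pderiv p) (?x j)"]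
    by (simp only: pderiv_mult) (simp add: pderiv_pCons)
  have qi: "poly (q j) (?x i) = 0" if "j < m" "i < m" "i \<noteq> j" for i j
  proof -
    have "?x i \<noteq> ?x j" using inj_on_cheb_node[of m] that by (auto simp: inj_on_def)
    moreover have "(?x i - ?x j) * poly (q j) (?x i) = 0"
      using poly_cheb_node[OF that(2)] by (subst (asm) T[OF that(1)]) auto
    ultimately show ?thesis by simp
  qed
  have dq: "degree (q j) < m" if "j < m" for j
  proof (cases "q j = 0")
    case False
    have "degree (cheb m) = 1 + degree (q j)"
      by (subst T[OF that], subst degree_mult_eq) (use False in auto)
    then show ?thesis using degree_cheb_le[of m] by simp
  qed (use that in auto)
  define R where "R = P - (\<Sum>j<m. Polynomial.smult (poly P (?x j) / ?D j) (q j))"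
  have "R = 0"
  proof (rule ccontr)
    assume "R \<noteq> 0"
    have dR: "degree R < m"
      unfolding R_def
      by (rule degree_diff_less[OF deg]) (intro degree_sum_less, use dq deg in auto)
    have "poly R (?x i) = 0" if "i < m" for i
    proof -
      have "(\<Sum>j<m. poly P (?x j) / ?D j * poly (q j) (?x i))
          = (\<Sum>j<m. if j = i then poly P (?x i) else 0)"
      proof (intro sum.cong refl)
        fix j assume "j \<in> {..<m}"
        then show "poly P (?x j) / ?D j * poly (q j) (?x i) = (if j = i then poly P (?x i) else 0)"
          using qi[of j i] qj[OF that] D[OF that] that by auto
      qed
      then show ?thesis using that by (simp add: R_def poly_sum)
    qed
    then have "?x ` {..<m} \<subseteq> {x. poly R x = 0}" by auto
    then have "card (?x ` {..<m}) \<le> card {x. poly R x = 0}"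
      by (intro card_mono poly_roots_finite[OF \<open>R \<noteq> 0\<close>])
    also have "\<dots> \<le> degree R" by (rule card_poly_roots_bound[OF \<open>R \<noteq> 0\<close>])
    finally show False using dR inj_on_cheb_node[of m] by (simp add: card_image)
  qed
  then have P: "P = (\<Sum>j<m. Polynomial.smult (poly P (?x j) / ?D j) (q j))" unfolding R_def by simp
  have "poly P y = (\<Sum>j<m. poly P (?x j) / ?D j * poly (q j) y)"
    using arg_cong[OF P, of "\<lambda>p. poly p y"] unfolding poly_sum poly_smult .
  also have "\<bar>\<dots>\<bar> \<le> (\<Sum>j<m. \<bar>poly P (?x j) / ?D j * poly (q j) y\<bar>)" by (rule sum_abs)
  also have "\<dots> \<le> (\<Sum>j<m. 2 * poly (cheb m) y * \<bar>poly P (?x j)\<bar>)"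
  proof (intro sum_mono)
    fix j assume "j \<in> {..<m}"
    then have j: "j < m" by simp
    have pos: "y - ?x j > 0" using y cos_le_one[of "cheb_angle m j"] unfolding cheb_node_def by linarith
    define s where "s = sin (cheb_angle m j)"
    have s: "s > 0" using cheb_angle_pos cheb_angle_bounds(2) j unfolding s_def by (intro sin_gt_zero)
    have Ty: "poly (cheb m) y = (y - ?x j) * poly (q j) y"
      by (subst T[OF j]) (simp add: algebra_simps)
    have Tpos: "poly (cheb m) y \<ge> 0" using y by (intro poly_cheb_nonneg) simp
    have "\<bar>poly (q j) y / ?D j\<bar> = poly (cheb m) y * s / (real m * (y - ?x j))"
    proof -
      have "\<bar>?D j\<bar> = real m / s" using abs_pderiv_cheb_node[OF j] s by (simp add: s_def field_simps)
      moreover have "0 \<le> poly (q j) y"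
        using Tpos pos unfolding Ty by (simp add: zero_le_mult_iff)
      then have "\<bar>poly (q j) y\<bar> = poly (cheb m) y / (y - ?x j)"
        using Ty pos by simp
      ultimately show ?thesis by (simp add: abs_divide)
    qed
    also have "\<dots> \<le> poly (cheb m) y * 2"
    proof -
      have "s \<le> 2 * real m * (1 - ?x j)"
        unfolding s_def by (rule sin_div_one_minus_cos_cheb_angle[OF j])
      also have "\<dots> \<le> 2 * real m * (y - ?x j)" using y by (intro mult_left_mono) auto
      finally have "s / (real m * (y - ?x j)) \<le> 2" using pos j by (simp add: field_simps)
      from mult_left_mono[OF this Tpos] show ?thesis by simp
    qed
    finally have "\<bar>poly P (?x j)\<bar> * \<bar>poly (q j) y / ?D j\<bar> \<le> \<bar>poly P (?x j)\<bar> * (poly (cheb m) y * 2)"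
      by (intro mult_left_mono) auto
    then show "\<bar>poly P (?x j) / ?D j * poly (q j) y\<bar> \<le> 2 * poly (cheb m) y * \<bar>poly P (?x j)\<bar>"
      by (simp add: abs_mult algebra_simps)
  qed
  finally show ?thesis by (simp add: sum_distrib_left)
qed

section \<open>The spectral theorem for real symmetric matrices\<close>

lemma mult_mat_vec_index_sum:
  assumes "A \<in> carrier_mat n n" "v \<in> carrier_vec n" "i < n"
  shows "(A *\<^sub>v v) $ i = (\<Sum>j<n. A $$ (i, j) * v $ j)"
  using assms by (auto simp: scalar_prod_def atLeast0LessThan)

text \<open>A complex eigenvalue \<open>a\<close> with eigenvector \<open>v\<close> exists. The Hermitian form of \<open>A\<close> at \<open>v\<close> equals
  \<open>a |v|\<^sup>2\<close> and is its own conjugate, so \<open>a\<close> is real.\<close>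

lemma real_symmetric_has_eigenvalue:
  assumes A: "(A :: real mat) \<in> carrier_mat n n" and sym: "A\<^sup>T = A" and n: "n > 0"
  shows "\<exists>e. eigenvalue A e"
proof -
  let ?B = "map_mat complex_of_real A"
  have B: "?B \<in> carrier_mat n n" using A by simp
  have "degree (char_poly ?B) = n" using degree_monic_char_poly[OF B] by simp
  then have "\<not> constant (poly (char_poly ?B))" using n by (simp add: constant_degree)
  then obtain a where a: "poly (char_poly ?B) a = 0"
    using fundamental_theorem_of_algebra by blast
  then have "eigenvalue ?B a" using eigenvalue_root_char_poly[OF B] by simp
  then obtain v where v: "v \<in> carrier_vec n" "v \<noteq> 0\<^sub>v n" "?B *\<^sub>v v = a \<cdot>\<^sub>v v"
    unfolding eigenvalue_def eigenvector_def using A by auto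
  have Aij: "A $$ (i, j) = A $$ (j, i)" if "i < n" "j < n" for i j
    using arg_cong[OF sym, of "\<lambda>M. M $$ (i, j)"] A that by auto
  define s where "s = (\<Sum>i<n. \<Sum>j<n. cnj (v $ i) * complex_of_real (A $$ (i, j)) * v $ j)"
  have row: "(\<Sum>j<n. complex_of_real (A $$ (i, j)) * v $ j) = a * v $ i" if "i < n" for i
    using mult_mat_vec_index_sum[OF B v(1) that] v A that by auto
  have s1: "s = a * (\<Sum>i<n. cnj (v $ i) * v $ i)"
    unfolding s_def sum_distrib_left
  proof (intro sum.cong refl)
    fix i assume "i \<in> {..<n}"
    then show "(\<Sum>j<n. cnj (v $ i) * complex_of_real (A $$ (i, j)) * v $ j) = a * (cnj (v $ i) * v $ i)"
      using row[of i] by (simp add: sum_distrib_left[symmetric] mult.assoc)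
  qed
  have "cnj s = (\<Sum>i<n. \<Sum>j<n. cnj (v $ j) * complex_of_real (A $$ (j, i)) * v $ i)"
    unfolding s_def cnj_sum by (intro sum.cong refl) (use Aij in auto)
  also have "\<dots> = s" unfolding s_def by (rule sum.swap)
  finally have s2: "cnj s = s" .
  define r where "r = (\<Sum>i<n. (cmod (v $ i))\<^sup>2)"
  have r: "(\<Sum>i<n. cnj (v $ i) * v $ i) = complex_of_real r"
    unfolding r_def of_real_sum complex_norm_square by (simp add: mult.commute)
  have "r \<noteq> 0"
  proof
    assume "r = 0"
    then have "\<forall>i<n. v $ i = 0" unfolding r_def by (subst (asm) sum_nonneg_eq_0_iff) auto
    then have "v = 0\<^sub>v n" using v(1) by (intro eq_vecI) auto
    then show False using v(2) by simp
  qed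
  then have "cnj a = a" using s1 s2 r by simp
  then have a_real: "a = complex_of_real (Re a)" by (simp add: complex_eq_iff)
  have "char_poly ?B = map_poly complex_of_real (char_poly A)"
    by (rule of_real_hom.char_poly_hom[OF A])
  then have "poly (char_poly A) (Re a) = 0" using a
    by (subst (asm) a_real) (simp add: of_real_hom.poly_map_poly)
  then show ?thesis using eigenvalue_root_char_poly[OF A] by blast
qed

text \<open>Complete \<open>v\<close> to a basis, apply Gram-Schmidt, which keeps the first vector, and normalise.\<close>

lemma orthogonal_mat_with_first_column:
  fixes v :: "real vec"
  assumes v: "v \<in> carrier_vec n" and v0: "v \<noteq> 0\<^sub>v n"
  shows "\<exists>U c. U \<in> carrier_mat n n \<and> U\<^sup>T * U = 1\<^sub>m n \<and> col U 0 = c \<cdot>\<^sub>v v"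
proof -
  interpret cof_vec_space n "TYPE(real)" .
  define b where "b = basis_completion v"
  define ws where "ws = gram_schmidt n b"
  have n: "n > 0" using v v0 by (cases n) auto
  from basis_completion[OF v v0, folded b_def]
  have dist_b: "distinct b" and indep: "\<not> lin_dep (set b)" and b: "set b \<subseteq> carrier_vec n"
    and hdb: "hd b = v" and len_b: "length b = n" by auto
  from hdb len_b n obtain vs where bv: "b = v # vs" by (cases b, auto)
  from gram_schmidt_result[OF b dist_b indep refl, folded ws_def]
  have ws: "set ws \<subseteq> carrier_vec n" "corthogonal ws" "length ws = n" by (auto simp: len_b)
  from gram_schmidt_hd[OF v, of vs, folded bv] have "hd ws = v" unfolding ws_def .
  then have ws0: "ws ! 0 = v" using ws(3) n by (cases ws) auto
  have wsi: "ws ! i \<in> carrier_vec n" if "i < n" for i using ws that by auto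
  define f where "f w = (1 / sqrt (w \<bullet> w)) \<cdot>\<^sub>v w" for w :: "real vec"
  define U where "U = mat_of_cols n (map f ws)"
  have U: "U \<in> carrier_mat n n" unfolding U_def using ws by auto
  have colU: "col U i = f (ws ! i)" if "i < n" for i
    unfolding U_def using ws(3) that wsi[OF that] by (subst col_mat_of_cols) (auto simp: f_def)
  have "U\<^sup>T * U = 1\<^sub>m n"
  proof (rule eq_matI)
    fix i j assume "i < dim_row (1\<^sub>m n)" "j < dim_col (1\<^sub>m n)"
    then have i: "i < n" and j: "j < n" by auto
    have orth: "(ws ! i \<bullet> ws ! j = 0) = (i \<noteq> j)"
      using corthogonalD[OF ws(2), of i j] i j ws(3) by simp
    have "(U\<^sup>T * U) $$ (i, j) = f (ws ! i) \<bullet> f (ws ! j)"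
      using U i j colU by simp
    also have "\<dots> = (1 / sqrt (ws ! i \<bullet> ws ! i)) * (1 / sqrt (ws ! j \<bullet> ws ! j)) * (ws ! i \<bullet> ws ! j)"
      unfolding f_def using wsi[OF i] wsi[OF j] by simp
    also have "\<dots> = 1\<^sub>m n $$ (i, j)"
    proof (cases "i = j")
      case True
      have "ws ! j \<bullet> ws ! j \<ge> 0" by (simp add: scalar_prod_def sum_nonneg)
      then show ?thesis using True orth i j by (simp add: real_sqrt_mult_self)
    next
      case False
      then show ?thesis using orth i j by simp
    qed
    finally show "(U\<^sup>T * U) $$ (i, j) = 1\<^sub>m n $$ (i, j)" .
  qed (use U in auto)
  then show ?thesis using U colU[OF n] ws0 unfolding f_def by metis
qed

text \<open>Induction on the dimension. In an orthonormal basis that starts with an eigenvector, the first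
  column of the matrix is a multiple of the first unit vector, by symmetry so is the first row, and
  the complementary block is again symmetric.\<close>

theorem real_symmetric_spectral:
  assumes "(A :: real mat) \<in> carrier_mat n n" "A\<^sup>T = A"
  shows "\<exists>U D. U \<in> carrier_mat n n \<and> D \<in> carrier_mat n n \<and> diagonal_mat D
    \<and> U\<^sup>T * U = 1\<^sub>m n \<and> U * U\<^sup>T = 1\<^sub>m n \<and> A = U * D * U\<^sup>T"
  using assms
proof (induction n arbitrary: A)
  case 0
  show ?case
    by (rule exI[of _ A], rule exI[of _ A]) (use 0 in \<open>auto simp: diagonal_mat_def\<close>)
next
  case (Suc n)
  note A = Suc.prems(1) and sym = Suc.prems(2)
  obtain e v where v: "v \<in> carrier_vec (Suc n)" "v \<noteq> 0\<^sub>v (Suc n)" "A *\<^sub>v v = e \<cdot>\<^sub>v v"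
    using real_symmetric_has_eigenvalue[OF A sym] A unfolding eigenvalue_def eigenvector_def by auto
  obtain U c where U: "U \<in> carrier_mat (Suc n) (Suc n)" and UU: "U\<^sup>T * U = 1\<^sub>m (Suc n)"
    and c: "col U 0 = c \<cdot>\<^sub>v v"
    using orthogonal_mat_with_first_column[OF v(1,2)] by blast
  have cU: "col U 0 \<in> carrier_vec (Suc n)" unfolding c using v by simp
  have UT: "U\<^sup>T \<in> carrier_mat (Suc n) (Suc n)" using U by simp
  have UU': "U * U\<^sup>T = 1\<^sub>m (Suc n)" by (rule mat_mult_left_right_inverse[OF UT U UU])
  define B where "B = U\<^sup>T * A * U"
  have B: "B \<in> carrier_mat (Suc n) (Suc n)" unfolding B_def using U A by simp
  have Bsym: "B\<^sup>T = B"
    unfolding B_def using U A sym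
    by (simp add: transpose_mult[of _ "Suc n" "Suc n" _ "Suc n"] assoc_mult_mat[of _ "Suc n" "Suc n" _ "Suc n" _ "Suc n"])
  have colB: "col B 0 = e \<cdot>\<^sub>v unit_vec (Suc n) 0"
  proof -
    have "col B 0 = U\<^sup>T * A *\<^sub>v col U 0"
      unfolding B_def using U A by (intro col_mult2[of _ "Suc n" "Suc n" _ "Suc n"]) auto
    also have "\<dots> = U\<^sup>T *\<^sub>v (A *\<^sub>v col U 0)"
      using U A cU by (intro assoc_mult_mat_vec[of _ "Suc n" "Suc n" _ "Suc n"]) auto
    also have "A *\<^sub>v col U 0 = e \<cdot>\<^sub>v col U 0"
      unfolding c using A v by (simp add: mult_mat_vec smult_smult_assoc mult.commute)
    also have "U\<^sup>T *\<^sub>v (e \<cdot>\<^sub>v col U 0) = e \<cdot>\<^sub>v (U\<^sup>T *\<^sub>v col U 0)"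
      using U cU by (intro mult_mat_vec[of _ "Suc n" "Suc n"]) auto
    also have "U\<^sup>T *\<^sub>v col U 0 = col (U\<^sup>T * U) 0"
      using U by (intro col_mult2[symmetric, of _ "Suc n" "Suc n" _ "Suc n"]) auto
    also have "\<dots> = unit_vec (Suc n) 0" unfolding UU by simp
    finally show ?thesis .
  qed
  have B0: "B $$ (i, 0) = (if i = 0 then e else 0)" if "i < Suc n" for i
    using arg_cong[OF colB, of "\<lambda>w. w $ i"] B that by auto
  have B0': "B $$ (0, i) = (if i = 0 then e else 0)" if "i < Suc n" for i
    using B0[OF that] arg_cong[OF Bsym, of "\<lambda>M. M $$ (i, 0)"] B that by auto
  define A3 where "A3 = mat n n (\<lambda>(i, j). B $$ (Suc i, Suc j))"
  let ?E = "e \<cdot>\<^sub>m 1\<^sub>m 1"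
  have A3: "A3 \<in> carrier_mat n n" unfolding A3_def by simp
  have "A3\<^sup>T = A3"
  proof (rule eq_matI)
    fix i j assume "i < dim_row A3" "j < dim_col A3"
    then have "i < n" "j < n" using A3 by auto
    then show "A3\<^sup>T $$ (i, j) = A3 $$ (i, j)"
      using arg_cong[OF Bsym, of "\<lambda>M. M $$ (Suc i, Suc j)"] B by (auto simp: A3_def)
  qed (use A3 in auto)
  from Suc.IH[OF A3 this] obtain U3 D3 where IH: "U3 \<in> carrier_mat n n" "D3 \<in> carrier_mat n n"
    "diagonal_mat D3" "U3\<^sup>T * U3 = 1\<^sub>m n" "U3 * U3\<^sup>T = 1\<^sub>m n" "A3 = U3 * D3 * U3\<^sup>T" by blast
  have Bblock: "B = four_block_mat ?E (0\<^sub>m 1 n) (0\<^sub>m n 1) A3"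
    by (rule eq_matI) (use B B0 B0' in \<open>auto simp: A3_def\<close>)
  define F where "F = four_block_mat (1\<^sub>m 1) (0\<^sub>m 1 n) (0\<^sub>m n 1) U3"
  define D where "D = four_block_mat ?E (0\<^sub>m 1 n) (0\<^sub>m n 1) D3"
  have F: "F \<in> carrier_mat (Suc n) (Suc n)" and D: "D \<in> carrier_mat (Suc n) (Suc n)"
    unfolding F_def D_def using IH by (auto simp: four_block_mat_def Let_def)
  have FT: "F\<^sup>T = four_block_mat (1\<^sub>m 1) (0\<^sub>m 1 n) (0\<^sub>m n 1) U3\<^sup>T"
    unfolding F_def using IH by (subst transpose_four_block_mat) auto
  have FF: "F\<^sup>T * F = 1\<^sub>m (Suc n)"
    unfolding FT unfolding F_def using IH(1,4)
    by (subst mult_four_block_mat[of _ 1 1 _ n _ n _ _ 1 _ n]) auto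
  have FF': "F * F\<^sup>T = 1\<^sub>m (Suc n)" by (rule mat_mult_left_right_inverse[OF _ F FF]) (use F in simp)
  have BF: "B = F * D * F\<^sup>T"
    unfolding FT unfolding F_def D_def Bblock using IH(1,2)
    by (subst mult_four_block_mat[of _ 1 1 _ n _ n _ _ 1 _ n];
        (subst mult_four_block_mat[of _ 1 1 _ n _ n _ _ 1 _ n])?) (auto simp: IH(6))
  have Ddiag: "diagonal_mat D"
    unfolding D_def diagonal_mat_def using IH(2,3) by (auto simp: diagonal_mat_def)
  note assoc = assoc_mult_mat[of _ "Suc n" "Suc n" _ "Suc n" _ "Suc n"]
  have "A = U * B * U\<^sup>T"
  proof -
    have "U * B * U\<^sup>T = (U * U\<^sup>T) * A * (U * U\<^sup>T)"
      unfolding B_def using U A by (simp add: assoc)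
    then show ?thesis using A by (simp add: UU')
  qed
  also have "\<dots> = (U * F) * D * (U * F)\<^sup>T"
    unfolding BF using U F D by (simp add: assoc transpose_mult[of _ "Suc n" "Suc n" _ "Suc n"])
  finally have AUF: "A = (U * F) * D * (U * F)\<^sup>T" .
  have 1: "(U * F)\<^sup>T * (U * F) = 1\<^sub>m (Suc n)"
  proof -
    have "(U * F)\<^sup>T * (U * F) = F\<^sup>T * ((U\<^sup>T * U) * F)"
      using U F by (simp add: assoc transpose_mult[of _ "Suc n" "Suc n" _ "Suc n"])
    then show ?thesis using F FF by (simp add: UU)
  qed
  have 2: "(U * F) * (U * F)\<^sup>T = 1\<^sub>m (Suc n)"
    by (rule mat_mult_left_right_inverse[OF _ _ 1]) (use U F in auto)
  show ?case
    by (rule exI[of _ "U * F"], rule exI[of _ D]) (use U F D Ddiag AUF 1 2 in auto)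
qed

section \<open>Krylov spaces and Ritz values in an eigenbasis\<close>

lemma proots_linear_factors:
  fixes as :: "'a :: idom list"
  shows "proots (\<Prod>a\<leftarrow>as. [:- a, 1:]) = mset as"
proof (induction as)
  case (Cons a as)
  have "(\<Prod>a\<leftarrow>as. [:- a, 1:]) \<noteq> 0" by (auto simp: prod_list_zero_iff)
  then show ?case using Cons by (simp add: proots_mult del: mult_pCons_left)
qed simp

text \<open>The columns of \<open>U\<close> are an orthonormal eigenbasis; the diagonal of \<open>D\<close> need not be sorted.\<close>

locale orthogonal_diagonalization =
  fixes n :: nat and A U D :: "real mat"
  assumes A: "A \<in> carrier_mat n n"
    and U: "U \<in> carrier_mat n n" and D: "D \<in> carrier_mat n n" and D_diag: "diagonal_mat D"
    and UU: "U\<^sup>T * U = 1\<^sub>m n" and UU': "U * U\<^sup>T = 1\<^sub>m n" and A_eq: "A = U * D * U\<^sup>T"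
    and n_pos: "0 < n"
begin

abbreviation eig :: "nat \<Rightarrow> real" where "eig i \<equiv> D $$ (i, i)"

lemma char_poly_eq: "char_poly A = (\<Prod>a\<leftarrow>map eig [0..<n]. [:- a, 1:])"
proof -
  have "similar_mat_wit A D U U\<^sup>T"
    by (rule similar_mat_witI[OF UU' UU A_eq A D]) (use U in auto)
  then have "char_poly A = char_poly D" by (intro char_poly_similar) (auto simp: similar_mat_def)
  also have "\<dots> = (\<Prod>a\<leftarrow>diag_mat D. [:- a, 1:])"
    by (rule char_poly_upper_triangular[OF D])
      (use D D_diag in \<open>auto simp: diagonal_mat_def\<close>)
  also have "diag_mat D = map eig [0..<n]" using D by (simp add: diag_mat_def)
  finally show ?thesis .
qed

lemma eigval_first: "eigval A 1 = Max (eig ` {..<n})"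
  and eigval_last: "eigval A n = Min (eig ` {..<n})"
proof -
  let ?xs = "sort (map eig [0..<n])"
  have xs: "sorted_list_of_multiset (proots (char_poly A)) = ?xs"
    unfolding char_poly_eq proots_linear_factors by (rule sorted_list_of_multiset_mset)
  have len: "length ?xs = n" by simp
  have set: "set ?xs = eig ` {..<n}" by (auto simp: atLeast0LessThan)
  have srt: "?xs ! i \<le> ?xs ! j" if "i \<le> j" "j < n" for i j
    using sorted_nth_mono[OF sorted_sort, of i j "map eig [0..<n]"] that by simp
  have mem: "?xs ! i \<in> eig ` {..<n}" if "i < n" for i
    using nth_mem[of i ?xs] that len unfolding set by simp
  have ex: "\<exists>i<n. ?xs ! i = x" if "x \<in> eig ` {..<n}" for x
    using that len unfolding set[symmetric] in_set_conv_nth by auto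
  have "eigval A 1 = ?xs ! (n - 1)"
    unfolding eigval_def xs using n_pos len by (simp add: rev_nth)
  moreover have "?xs ! (n - 1) = Max (eig ` {..<n})"
  proof (rule Max_eqI[symmetric])
    show "x \<le> ?xs ! (n - 1)" if x: "x \<in> eig ` {..<n}" for x
    proof -
      obtain i where "i < n" "?xs ! i = x" using ex[OF x] by blast
      then show ?thesis using srt[of i "n - 1"] by simp
    qed
    show "?xs ! (n - 1) \<in> eig ` {..<n}" by (rule mem) (use n_pos in simp)
  qed simp
  ultimately show "eigval A 1 = Max (eig ` {..<n})" by simp
  have "eigval A n = ?xs ! 0"
    unfolding eigval_def xs using n_pos len by (simp add: rev_nth)
  moreover have "?xs ! 0 = Min (eig ` {..<n})"
  proof (rule Min_eqI[symmetric])
    show "?xs ! 0 \<le> x" if x: "x \<in> eig ` {..<n}" for x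
    proof -
      obtain i where "i < n" "?xs ! i = x" using ex[OF x] by blast
      then show ?thesis using srt[of 0 i] by simp
    qed
    show "?xs ! 0 \<in> eig ` {..<n}" by (rule mem) (use n_pos in simp)
  qed simp
  ultimately show "eigval A n = Min (eig ` {..<n})" by simp
qed

definition of_coord :: "(nat \<Rightarrow> real) \<Rightarrow> real vec" where
  "of_coord w = U *\<^sub>v vec n w"

lemma of_coord_carrier: "of_coord w \<in> carrier_vec n"
  unfolding of_coord_def using U by auto

lemma of_coord_inner: "of_coord v \<bullet> of_coord w = (\<Sum>i<n. v i * w i)"
proof -
  have "of_coord v \<bullet> of_coord w = (U\<^sup>T *\<^sub>v (U *\<^sub>v vec n v)) \<bullet> vec n w"
    unfolding of_coord_def using U by (subst transpose_vec_mult_scalar[of _ n n]) auto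
  also have "U\<^sup>T *\<^sub>v (U *\<^sub>v vec n v) = vec n v"
    using U UU by (subst assoc_mult_mat_vec[symmetric, of _ n n _ n]) auto
  finally show ?thesis by (simp add: scalar_prod_def atLeast0LessThan)
qed

lemma A_of_coord: "A *\<^sub>v of_coord w = of_coord (\<lambda>i. eig i * w i)"
proof -
  have "A *\<^sub>v of_coord w = U *\<^sub>v (D *\<^sub>v ((U\<^sup>T * U) *\<^sub>v vec n w))"
    unfolding A_eq of_coord_def using U D by (simp add: assoc_mult_mat_vec[of _ n n _ n])
  also have "\<dots> = U *\<^sub>v (D *\<^sub>v vec n w)" unfolding UU by simp
  also have "D *\<^sub>v vec n w = vec n (\<lambda>i. eig i * w i)"
  proof (rule eq_vecI)
    fix i assume "i < dim_vec (vec n (\<lambda>i. eig i * w i))"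
    then have i: "i < n" by simp
    have "(D *\<^sub>v vec n w) $ i = (\<Sum>j<n. D $$ (i, j) * vec n w $ j)"
      by (rule mult_mat_vec_index_sum[OF D _ i]) simp
    also have "\<dots> = (\<Sum>j<n. if j = i then eig i * w i else 0)"
      by (intro sum.cong) (use D D_diag i in \<open>auto simp: diagonal_mat_def\<close>)
    finally show "(D *\<^sub>v vec n w) $ i = vec n (\<lambda>i. eig i * w i) $ i" using i by simp
  qed (use D in auto)
  finally show ?thesis by (simp add: of_coord_def)
qed

lemma pow_of_coord: "A ^\<^sub>m k *\<^sub>v of_coord w = of_coord (\<lambda>i. eig i ^ k * w i)"
proof (induction k arbitrary: w)
  case 0
  then show ?case using A of_coord_carrier by simp
next
  case (Suc k)
  have "A ^\<^sub>m Suc k *\<^sub>v of_coord w = A ^\<^sub>m k *\<^sub>v (A *\<^sub>v of_coord w)"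
    using A of_coord_carrier by (simp add: assoc_mult_mat_vec[of _ n n _ n])
  then show ?case by (simp add: A_of_coord Suc mult.assoc mult.left_commute)
qed

lemma of_coord_add: "of_coord v + of_coord w = of_coord (\<lambda>i. v i + w i)"
proof -
  have "vec n v + vec n w = vec n (\<lambda>i. v i + w i)" by auto
  then show ?thesis
    unfolding of_coord_def using U mult_add_distrib_mat_vec[of U n n "vec n v" "vec n w"] by simp
qed

lemma of_coord_smult: "c \<cdot>\<^sub>v of_coord v = of_coord (\<lambda>i. c * v i)"
proof -
  have "c \<cdot>\<^sub>v vec n v = vec n (\<lambda>i. c * v i)" by auto
  then show ?thesis
    unfolding of_coord_def using U mult_mat_vec[of U n n "vec n v" c] by simp
qed

lemma of_coord_0: "of_coord (\<lambda>i. 0) = 0\<^sub>v n"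
proof -
  have "0 \<cdot>\<^sub>v of_coord (\<lambda>i. 0) = 0\<^sub>v n" using of_coord_carrier[of "\<lambda>i. 0"] by (intro eq_vecI) auto
  then show ?thesis by (simp add: of_coord_smult)
qed

lemma of_coord_eq_0_iff: "of_coord w = 0\<^sub>v n \<longleftrightarrow> (\<Sum>i<n. w i * w i) = 0"
proof
  assume "of_coord w = 0\<^sub>v n"
  then show "(\<Sum>i<n. w i * w i) = 0" using of_coord_inner[of w w] by simp
next
  assume "(\<Sum>i<n. w i * w i) = 0"
  then have "\<forall>i<n. w i = 0" by (subst (asm) sum_nonneg_eq_0_iff) auto
  then have "vec n w = vec n (\<lambda>i. 0)" by auto
  then show "of_coord w = 0\<^sub>v n" using of_coord_0 by (simp add: of_coord_def)
qed

definition coord :: "real vec \<Rightarrow> nat \<Rightarrow> real" where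
  "coord b i = col U i \<bullet> b"

lemma of_coord_coord:
  assumes "b \<in> carrier_vec n"
  shows "of_coord (coord b) = b"
proof -
  have "vec n (coord b) = U\<^sup>T *\<^sub>v b" 
    using U assms by (intro eq_vecI) (auto simp: coord_def)
  then have "of_coord (coord b) = U *\<^sub>v (U\<^sup>T *\<^sub>v b)" by (simp add: of_coord_def)
  also have "\<dots> = (U * U\<^sup>T) *\<^sub>v b"
    using U assms by (subst assoc_mult_mat_vec[of _ n n _ n]) auto
  finally show ?thesis using UU' assms by simp
qed

text \<open>The powers of \<open>A\<close> act on coordinates as the monomials in the eigenvalues, so the span of the first
  \<open>m\<close> of them corresponds to all polynomials of degree less than \<open>m\<close>.\<close>

lemma krylov_eq:
  assumes b: "b \<in> carrier_vec n" and m: "0 < m"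
  shows "krylov m A b = {of_coord (\<lambda>i. poly P (eig i) * coord b i) | P. degree P < m}"
    (is "_ = ?X")
proof -
  interpret vec_space "TYPE(real)" n .
  let ?S = "{(A ^\<^sub>m k) *\<^sub>v b | k. k < m}"
  have pw: "A ^\<^sub>m k *\<^sub>v b = of_coord (\<lambda>i. eig i ^ k * coord b i)" for k
    using pow_of_coord[of k "coord b"] of_coord_coord[OF b] by simp
  have S: "?S \<subseteq> carrier_vec n" using of_coord_carrier by (auto simp: pw)
  have kry: "krylov m A b = span ?S" unfolding krylov_def using b by simp
  have "submodule class_ring ?X (module_vec TYPE(real) n)"
  proof (rule submodule.intro)
    show "Module.module class_ring (module_vec TYPE(real) n)" by (rule vec_module)
    show "?X \<subseteq> carrier (module_vec TYPE(real) n)" using of_coord_carrier by (auto simp: module_vec_simps)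
    show "v \<oplus>\<^bsub>module_vec TYPE(real) n\<^esub> w \<in> ?X" if vw: "v \<in> ?X" "w \<in> ?X" for v w
    proof -
      obtain P Q where PQ: "degree P < m" "degree Q < m"
        "v = of_coord (\<lambda>i. poly P (eig i) * coord b i)" "w = of_coord (\<lambda>i. poly Q (eig i) * coord b i)"
        using vw by auto
      have "v + w = of_coord (\<lambda>i. poly (P + Q) (eig i) * coord b i)"
        unfolding PQ of_coord_add by (simp add: algebra_simps)
      moreover have "degree (P + Q) < m" using PQ by (intro degree_add_less)
      ultimately show ?thesis unfolding module_vec_simps by blast
    qed
    show "\<zero>\<^bsub>module_vec TYPE(real) n\<^esub> \<in> ?X"
      unfolding module_vec_simps using m of_coord_0 by (auto intro!: exI[of _ 0])
    show "c \<odot>\<^bsub>module_vec TYPE(real) n\<^esub> v \<in> ?X" if v: "v \<in> ?X" for c v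
    proof -
      obtain P where P: "degree P < m" "v = of_coord (\<lambda>i. poly P (eig i) * coord b i)"
        using v by auto
      have "c \<cdot>\<^sub>v v = of_coord (\<lambda>i. poly (Polynomial.smult c P) (eig i) * coord b i)"
        unfolding P of_coord_smult by (simp add: algebra_simps)
      moreover have "degree (Polynomial.smult c P) < m" using P degree_smult_le[of c P] by simp
      ultimately show ?thesis unfolding module_vec_simps by blast
    qed
  qed
  moreover have "?S \<subseteq> ?X"
  proof
    fix x assume "x \<in> ?S"
    then obtain k where "k < m" "x = A ^\<^sub>m k *\<^sub>v b" by auto
    then have "x = of_coord (\<lambda>i. poly (monom 1 k) (eig i) * coord b i)" "degree (monom (1 :: real) k) < m"
      by (auto simp: pw poly_monom degree_monom_eq)
    then show "x \<in> ?X" by blast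
  qed
  ultimately have 1: "span ?S \<subseteq> ?X" by (intro span_is_subset)
  have 2: "?X \<subseteq> span ?S"
  proof
    fix x assume "x \<in> ?X"
    then obtain P where P: "degree P < m" "x = of_coord (\<lambda>i. poly P (eig i) * coord b i)" by auto
    have *: "of_coord (\<lambda>i. (\<Sum>j<k. coeff P j * eig i ^ j) * coord b i) \<in> span ?S" if "k \<le> m" for k
      using that
    proof (induction k)
      case 0
      have "submodule class_ring (span ?S) (module_vec TYPE(real) n)" by (rule span_is_submodule[OF S])
      then have "0\<^sub>v n \<in> span ?S" using submodule.zero_closed by (fastforce simp: module_vec_simps)
      then show ?case using of_coord_0 by simp
    next
      case (Suc k)
      have "A ^\<^sub>m k *\<^sub>v b \<in> ?S" using Suc.prems by (intro CollectI exI[of _ k]) simp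
      then have "A ^\<^sub>m k *\<^sub>v b \<in> span ?S" by (rule subsetD[OF in_own_span[OF S]])
      then have "coeff P k \<cdot>\<^sub>v (A ^\<^sub>m k *\<^sub>v b) \<in> span ?S" by (rule smult_in_span[OF S])
      then have "of_coord (\<lambda>i. (\<Sum>j<k. coeff P j * eig i ^ j) * coord b i)
          + coeff P k \<cdot>\<^sub>v (A ^\<^sub>m k *\<^sub>v b) \<in> span ?S"
        using Suc by (intro span_add1[OF S]) auto
      then show ?case unfolding pw of_coord_smult of_coord_add by (simp add: algebra_simps)
    qed
    have "poly P t = (\<Sum>j<m. coeff P j * t ^ j)" for t
      unfolding poly_altdef using P(1)
      by (intro sum.mono_neutral_left) (auto simp: coeff_eq_0)
    then show "x \<in> span ?S" using *[of m] P(2) by simp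
  qed
  show ?thesis unfolding kry using 1 2 by (rule equalityI)
qed

text \<open>Clearing the denominators of the Rayleigh quotients turns a bound on the supremum into the
  nonnegativity of quadratic forms. Zero vectors, which the supremum excludes, satisfy these
  conditions trivially, so \<open>P\<close> is arbitrary on the right.\<close>

lemma ritz_max_le_iff:
  assumes b: "b \<in> carrier_vec n" "b \<noteq> 0\<^sub>v n" and m: "0 < m"
  shows "ritz_max m A b \<le> \<tau> \<longleftrightarrow>
    (\<forall>P. degree P < m \<longrightarrow> 0 \<le> (\<Sum>i<n. (poly P (eig i) * coord b i)\<^sup>2 * (\<tau> - eig i)))"
proof -
  let ?w = "\<lambda>P i. poly P (eig i) * coord b i"
  let ?K = "krylov m A b - {0\<^sub>v (dim_vec b)}"
  let ?R = "\<lambda>x. (x \<bullet> (A *\<^sub>v x)) / (x \<bullet> x)"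
  have dim: "dim_vec b = n" using b by auto
  have R: "of_coord w \<bullet> (A *\<^sub>v of_coord w) = (\<Sum>i<n. (w i)\<^sup>2 * eig i)"
    "of_coord w \<bullet> of_coord w = (\<Sum>i<n. (w i)\<^sup>2)" for w
    unfolding A_of_coord of_coord_inner by (auto intro!: sum.cong simp: power2_eq_square)
  have diff: "(\<Sum>i<n. (w i)\<^sup>2 * (t - eig i)) = t * (\<Sum>i<n. (w i)\<^sup>2) - (\<Sum>i<n. (w i)\<^sup>2 * eig i)" for t w
    by (simp add: sum_distrib_left algebra_simps sum_subtractf)
  have le: "?R (of_coord w) \<le> t \<longleftrightarrow> 0 \<le> (\<Sum>i<n. (w i)\<^sup>2 * (t - eig i))" if "of_coord w \<noteq> 0\<^sub>v n" for w t
  proof -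
    have "(\<Sum>i<n. (w i)\<^sup>2) \<noteq> 0" using that unfolding of_coord_eq_0_iff by (simp add: power2_eq_square)
    then have "0 < (\<Sum>i<n. (w i)\<^sup>2)" by (simp add: less_le sum_nonneg)
    then show ?thesis unfolding R diff by (simp add: divide_le_eq)
  qed
  have K: "x \<in> ?K \<longleftrightarrow> (\<exists>P. degree P < m \<and> x = of_coord (?w P) \<and> of_coord (?w P) \<noteq> 0\<^sub>v n)" for x
    unfolding krylov_eq[OF b(1) m] dim by auto
  have "b \<in> ?K"
  proof -
    have "of_coord (?w 1) = b" using of_coord_coord[OF b(1)] by simp
    then show ?thesis unfolding K using b(2) m by (intro exI[of _ 1]) simp
  qed
  then have ne: "?K \<noteq> {}" by blast
  have bdd: "bdd_above (?R ` ?K)"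
  proof (rule bdd_aboveI2)
    fix x assume "x \<in> ?K"
    then obtain P where P: "x = of_coord (?w P)" "of_coord (?w P) \<noteq> 0\<^sub>v n" using K[of x] by metis
    show "?R x \<le> Max (eig ` {..<n})"
      unfolding P(1) le[OF P(2)] by (intro sum_nonneg mult_nonneg_nonneg) auto
  qed
  have "ritz_max m A b \<le> \<tau> \<longleftrightarrow> (\<forall>x\<in>?K. ?R x \<le> \<tau>)"
    unfolding ritz_max_def by (rule cSUP_le_iff[OF ne bdd])
  also have "\<dots> \<longleftrightarrow> (\<forall>P. degree P < m \<and> of_coord (?w P) \<noteq> 0\<^sub>v n \<longrightarrow> 0 \<le> (\<Sum>i<n. (?w P i)\<^sup>2 * (\<tau> - eig i)))"
  proof (intro iffI allI impI ballI)
    fix P assume all: "\<forall>x\<in>?K. ?R x \<le> \<tau>" and P: "degree P < m \<and> of_coord (?w P) \<noteq> 0\<^sub>v n"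
    have "of_coord (?w P) \<in> ?K" unfolding K using P by (intro exI[of _ P]) simp
    from bspec[OF all this] show "0 \<le> (\<Sum>i<n. (?w P i)\<^sup>2 * (\<tau> - eig i))"
      by (rule le[OF conjunct2[OF P], THEN iffD1])
  next
    fix x assume all: "\<forall>P. degree P < m \<and> of_coord (?w P) \<noteq> 0\<^sub>v n \<longrightarrow> 0 \<le> (\<Sum>i<n. (?w P i)\<^sup>2 * (\<tau> - eig i))"
      and x: "x \<in> ?K"
    obtain P where P: "degree P < m" "x = of_coord (?w P)" "of_coord (?w P) \<noteq> 0\<^sub>v n"
      using x unfolding K by (elim exE conjE)
    have "0 \<le> (\<Sum>i<n. (?w P i)\<^sup>2 * (\<tau> - eig i))"
      by (rule all[rule_format]) (rule conjI[OF P(1,3)])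
    then show "?R x \<le> \<tau>" unfolding P(2) by (rule le[OF P(3), THEN iffD2])
  qed
  also have "\<dots> \<longleftrightarrow> (\<forall>P. degree P < m \<longrightarrow> 0 \<le> (\<Sum>i<n. (?w P i)\<^sup>2 * (\<tau> - eig i)))"
  proof -
    have z0: "(\<Sum>i<n. (w i)\<^sup>2 * (\<tau> - eig i)) = 0" if "of_coord w = 0\<^sub>v n" for w
    proof -
      have "\<forall>i<n. w i = 0" using that unfolding of_coord_eq_0_iff
        by (subst (asm) sum_nonneg_eq_0_iff) auto
      then show ?thesis by simp
    qed
    then have "0 \<le> (\<Sum>i<n. (?w P i)\<^sup>2 * (\<tau> - eig i))" if "of_coord (?w P) = 0\<^sub>v n" for P
      using z0[OF that] by simp
    then show ?thesis by blast
  qed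
  finally show ?thesis .
qed

lemma coord_norm:
  assumes "b \<in> carrier_vec n"
  shows "(\<Sum>i<n. (coord b i)\<^sup>2) = b \<bullet> b"
  using of_coord_inner[of "coord b" "coord b"] of_coord_coord[OF assms] by (simp add: power2_eq_square)

lemma ritz_max_le_eigval_first:
  assumes b: "b \<in> carrier_vec n" "b \<noteq> 0\<^sub>v n" and m: "0 < m"
  shows "ritz_max m A b \<le> eigval A 1"
  unfolding ritz_max_le_iff[OF assms] eigval_first
  by (auto intro!: sum_nonneg mult_nonneg_nonneg)

text \<open>Apply the criterion to the constant polynomial, that is, to \<open>b\<close> itself.\<close>

lemma eigval_last_le_ritz_max:
  assumes b: "b \<in> carrier_vec n" "b \<noteq> 0\<^sub>v n" and m: "0 < m"
  shows "eigval A n \<le> ritz_max m A b"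
proof (rule ccontr)
  assume neg: "\<not> ?thesis"
  let ?r = "ritz_max m A b"
  have "0 \<le> (\<Sum>i<n. (poly 1 (eig i) * coord b i)\<^sup>2 * (?r - eig i))"
    using ritz_max_le_iff[OF assms, of ?r, THEN iffD1, OF order_refl, rule_format, of 1] m by simp
  also have "\<dots> \<le> (\<Sum>i<n. (coord b i)\<^sup>2 * (?r - eigval A n))"
    unfolding eigval_last by (intro sum_mono) (auto intro!: mult_left_mono)
  also have "\<dots> = (b \<bullet> b) * (?r - eigval A n)"
    using coord_norm[OF b(1)] by (simp add: sum_distrib_right[symmetric])
  finally have "0 \<le> (b \<bullet> b) * (?r - eigval A n)" .
  moreover have "b \<bullet> b > 0"
  proof -
    have "b \<bullet> b \<noteq> 0" using of_coord_eq_0_iff[of "coord b"] of_coord_coord[OF b(1)] b(2) coord_norm[OF b(1)]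
      by (simp add: power2_eq_square)
    moreover have "b \<bullet> b \<ge> 0" using coord_norm[OF b(1)] by (metis sum_nonneg zero_le_power2)
    ultimately show ?thesis by simp
  qed
  ultimately show False using neg by (simp add: zero_le_mult_iff)
qed

lemma rel_err_bounds:
  assumes b: "b \<in> carrier_vec n" "b \<noteq> 0\<^sub>v n" and m: "0 < m"
  shows "0 \<le> rel_err m A b" "rel_err m A b \<le> 1"
proof -
  have dim: "dim_row A = n" using A by simp
  have "eigval A n \<le> eigval A 1" 
    using ritz_max_le_eigval_first[OF assms] eigval_last_le_ritz_max[OF assms] by simp
  then show "0 \<le> rel_err m A b" "rel_err m A b \<le> 1"
    unfolding rel_err_def dim
    using ritz_max_le_eigval_first[OF assms] eigval_last_le_ritz_max[OF assms]
    by (auto simp: divide_le_eq_1)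
qed

end

section \<open>Cones and radial weights for Lebesgue measure\<close>

abbreviation lborel_fun :: "nat \<Rightarrow> (nat \<Rightarrow> real) measure" where
  "lborel_fun n \<equiv> PiM {..<n} (\<lambda>_. lborel)"

definition sqnorm :: "nat \<Rightarrow> (nat \<Rightarrow> real) \<Rightarrow> real" where
  "sqnorm n x = (\<Sum>i<n. (x i)\<^sup>2)"

text \<open>Restriction to \<open>{..<n}\<close> keeps the result extensional, hence in the space of the product measure.\<close>

definition fscale :: "nat \<Rightarrow> real \<Rightarrow> (nat \<Rightarrow> real) \<Rightarrow> nat \<Rightarrow> real" where
  "fscale n r x = (\<lambda>i\<in>{..<n}. r * x i)"

interpretation lborel_prod: product_sigma_finite "\<lambda>_ :: nat. lborel :: real measure"
  by standard

lemma sqnorm_measurable [measurable]: "sqnorm n \<in> borel_measurable (lborel_fun n)"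
  unfolding sqnorm_def by measurable

lemma fscale_measurable [measurable]: "fscale n r \<in> measurable (lborel_fun n) (lborel_fun n)"
  unfolding fscale_def by measurable

lemma sqnorm_nonneg: "0 \<le> sqnorm n x"
  unfolding sqnorm_def by (rule sum_nonneg) simp

lemma sqnorm_fscale: "sqnorm n (fscale n r x) = r\<^sup>2 * sqnorm n x"
  unfolding sqnorm_def fscale_def by (simp add: power_mult_distrib sum_distrib_left)

lemma fscale_space: "fscale n r x \<in> space (lborel_fun n)"
  unfolding fscale_def space_PiM by auto

lemma fscale_fscale: "fscale n r (fscale n s x) = fscale n (r * s) x"
  unfolding fscale_def by (auto simp: fun_eq_iff)

lemma fscale_1: "x \<in> space (lborel_fun n) \<Longrightarrow> fscale n 1 x = x"
  unfolding fscale_def by (auto simp: fun_eq_iff space_PiM PiE_def extensional_def)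

text \<open>Compare both sides on boxes, where one-dimensional scaling applies in each coordinate.\<close>

lemma lborel_fun_scale:
  assumes r: "0 < r"
  shows "lborel_fun n = density (distr (lborel_fun n) (lborel_fun n) (fscale n r)) (\<lambda>_. ennreal (r ^ n))"
proof (rule lborel_prod.PiM_eqI[symmetric])
  fix A :: "nat \<Rightarrow> real set"
  assume A: "\<And>i. i \<in> {..<n} \<Longrightarrow> A i \<in> sets lborel"
  let ?B = "Pi\<^sub>E {..<n} A" and ?A' = "\<lambda>i. {y. r * y \<in> A i}"
  have B[measurable]: "?B \<in> sets (lborel_fun n)" using A by (intro sets_PiM_I_finite) auto
  have A': "?A' i \<in> sets lborel" if "i \<in> {..<n}" for i
  proof -
    have Ai: "A i \<in> sets borel" using A[OF that] by simp
    have "(\<lambda>y. r * y) \<in> borel_measurable borel" by measurable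
    from measurable_sets[OF this Ai] show ?thesis by (simp add: vimage_def)
  qed
  have one: "emeasure lborel (A i) = ennreal r * emeasure lborel (?A' i)" if "i \<in> {..<n}" for i
  proof -
    have [measurable]: "A i \<in> sets borel" using A[OF that] by simp
    have "emeasure lborel (A i) = (\<integral>\<^sup>+x. indicator (A i) x \<partial>lborel)" by simp
    also have "\<dots> = \<bar>r\<bar> * (\<integral>\<^sup>+x. indicator (A i) (0 + r * x) \<partial>lborel)"
      using r by (intro nn_integral_real_affine) auto
    also have "(\<integral>\<^sup>+x. indicator (A i) (0 + r * x) \<partial>lborel) = (\<integral>\<^sup>+x. indicator (?A' i) x \<partial>lborel)"
      by (intro nn_integral_cong) (auto split: split_indicator)
    also have "\<dots> = emeasure lborel (?A' i)" using A'[OF that] by simp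
    finally show ?thesis using r by simp
  qed
  have pre: "fscale n r -` ?B \<inter> space (lborel_fun n) = Pi\<^sub>E {..<n} ?A'"
  proof (rule Set.set_eqI)
    fix x
    show "x \<in> fscale n r -` ?B \<inter> space (lborel_fun n) \<longleftrightarrow> x \<in> Pi\<^sub>E {..<n} ?A'"
      unfolding fscale_def space_PiM vimage_eq Int_iff restrict_PiE_iff
      by (simp add: PiE_iff conj_commute)
  qed
  have "emeasure (density (distr (lborel_fun n) (lborel_fun n) (fscale n r)) (\<lambda>_. ennreal (r ^ n))) ?B
      = ennreal (r ^ n) * emeasure (distr (lborel_fun n) (lborel_fun n) (fscale n r)) ?B"
    by (subst emeasure_density) (auto simp: nn_integral_cmult)
  also have "emeasure (distr (lborel_fun n) (lborel_fun n) (fscale n r)) ?B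
      = emeasure (lborel_fun n) (Pi\<^sub>E {..<n} ?A')"
    by (subst emeasure_distr) (auto simp: pre)
  also have "\<dots> = (\<Prod>i<n. emeasure lborel (?A' i))"
    by (rule lborel_prod.emeasure_PiM) (use A' in auto)
  also have "ennreal (r ^ n) * \<dots> = (\<Prod>i<n. ennreal r * emeasure lborel (?A' i))"
    using r by (simp add: prod.distrib ennreal_power)
  also have "\<dots> = (\<Prod>i<n. emeasure lborel (A i))" by (intro prod.cong) (use one in auto)
  finally show "emeasure (density (distr (lborel_fun n) (lborel_fun n) (fscale n r)) (\<lambda>_. ennreal (r ^ n))) ?B
      = (\<Prod>i<n. emeasure lborel (A i))" .
qed auto

text \<open>The origin has no direction; excluding it makes membership depend on the direction only.\<close>

definition cone :: "nat \<Rightarrow> (nat \<Rightarrow> real) set \<Rightarrow> bool" where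
  "cone n S \<longleftrightarrow> S \<in> sets (lborel_fun n) \<and>
    (\<forall>x\<in>S. 0 < sqnorm n x \<and> (\<forall>r>0. fscale n r x \<in> S))"

lemma cone_sets: "cone n S \<Longrightarrow> S \<in> sets (lborel_fun n)"
  unfolding cone_def by blast

lemma cone_fscale_iff:
  assumes "cone n S" "0 < r" "x \<in> space (lborel_fun n)"
  shows "fscale n r x \<in> S \<longleftrightarrow> x \<in> S"
proof
  assume "fscale n r x \<in> S"
  then have "fscale n (1 / r) (fscale n r x) \<in> S" using assms unfolding cone_def by simp
  then show "x \<in> S" using assms(2) fscale_1[OF assms(3)] by (simp add: fscale_fscale)
qed (use assms in \<open>simp add: cone_def\<close>)

text \<open>The quantity that determines the uniform measure of a cone on the sphere.\<close>

definition cone_vol :: "nat \<Rightarrow> (nat \<Rightarrow> real) set \<Rightarrow> ennreal" where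
  "cone_vol n S = emeasure (lborel_fun n) (S \<inter> {x. sqnorm n x \<le> 1})"

lemma ball_sets: "{x \<in> space (lborel_fun n). sqnorm n x \<le> u} \<in> sets (lborel_fun n)"
  by measurable

lemma cone_ball_sets:
  assumes "cone n S"
  shows "S \<inter> {x. sqnorm n x \<le> u} \<in> sets (lborel_fun n)"
proof -
  have "S \<inter> {x. sqnorm n x \<le> u} = S \<inter> {x \<in> space (lborel_fun n). sqnorm n x \<le> u}"
    using sets.sets_into_space[OF cone_sets[OF assms]] by auto
  then show ?thesis using sets.Int[OF cone_sets[OF assms] ball_sets] by simp
qed

lemma emeasure_cone_ball:
  assumes S: "cone n S" and u: "0 < u"
  shows "emeasure (lborel_fun n) (S \<inter> {x. sqnorm n x \<le> u}) = ennreal (sqrt u ^ n) * cone_vol n S"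
proof -
  let ?r = "sqrt u"
  have r: "?r > 0" using u by simp
  let ?T = "S \<inter> {x. sqnorm n x \<le> u}"
  have T[measurable]: "?T \<in> sets (lborel_fun n)" by (rule cone_ball_sets[OF S])
  have "fscale n ?r -` ?T \<inter> space (lborel_fun n) = S \<inter> {x. sqnorm n x \<le> 1}"
  proof -
    have "fscale n ?r x \<in> ?T \<longleftrightarrow> x \<in> S \<inter> {x. sqnorm n x \<le> 1}" if "x \<in> space (lborel_fun n)" for x
      using cone_fscale_iff[OF S r that] u by (simp add: sqnorm_fscale)
    then show ?thesis using sets.sets_into_space[OF cone_sets[OF S]] by blast
  qed
  then have "emeasure (distr (lborel_fun n) (lborel_fun n) (fscale n ?r)) ?T = cone_vol n S"
    unfolding cone_vol_def by (subst emeasure_distr) auto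
  moreover have "emeasure (lborel_fun n) ?T
      = emeasure (density (distr (lborel_fun n) (lborel_fun n) (fscale n ?r)) (\<lambda>_. ennreal (?r ^ n))) ?T"
    using lborel_fun_scale[OF r, of n] by simp
  moreover have "\<dots> = ennreal (?r ^ n) * emeasure (distr (lborel_fun n) (lborel_fun n) (fscale n ?r)) ?T"
    by (subst emeasure_density) (auto simp: nn_integral_cmult)
  ultimately show ?thesis by simp
qed

text \<open>The weight \<open>radial h (|x|\<^sup>2)\<close> is the superposition, with density \<open>h\<close>, of the indicators of the balls
  \<open>|x|\<^sup>2 \<le> u\<close>.\<close>

definition radial :: "(real \<Rightarrow> ennreal) \<Rightarrow> real \<Rightarrow> ennreal" where
  "radial h s = (\<integral>\<^sup>+u. h u * indicator {s..} u \<partial>lborel)"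

definition radial_mass :: "nat \<Rightarrow> (real \<Rightarrow> ennreal) \<Rightarrow> ennreal" where
  "radial_mass n h = (\<integral>\<^sup>+u. h u * ennreal (sqrt u ^ n) * indicator {0<..} u \<partial>lborel)"

text \<open>Exchange the integrals over \<open>x\<close> and \<open>u\<close>: the inner one is the volume of the cone inside a ball,
  and this scales with the radius in the same way for every cone.\<close>

lemma radial_integral_cone:
  assumes S: "cone n S" and h[measurable]: "h \<in> borel_measurable borel"
  shows "(\<integral>\<^sup>+x. radial h (sqnorm n x) * indicator S x \<partial>lborel_fun n) = cone_vol n S * radial_mass n h"
proof -
  interpret L: sigma_finite_measure "lborel_fun n" by (rule lborel_prod.sigma_finite) simp
  interpret P: pair_sigma_finite "lborel_fun n" lborel by standard
  have [measurable]: "S \<in> sets (lborel_fun n)" by (rule cone_sets[OF S])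
  let ?f = "\<lambda>x u. h u * indicator {sqnorm n x..} u * indicator S x"
  have ind: "(\<lambda>(x, u). indicator {sqnorm n x..} u :: ennreal) \<in> borel_measurable (lborel_fun n \<Otimes>\<^sub>M lborel)"
  proof -
    have "(\<lambda>p. if sqnorm n (fst p) \<le> snd p then 1 else 0 :: ennreal) \<in> borel_measurable (lborel_fun n \<Otimes>\<^sub>M lborel)"
      by measurable
    also have "(\<lambda>p. if sqnorm n (fst p) \<le> snd p then 1 else 0 :: ennreal) = (\<lambda>(x, u). indicator {sqnorm n x..} u)"
      by (auto simp: fun_eq_iff split: split_indicator)
    finally show ?thesis .
  qed
  have "(\<integral>\<^sup>+x. radial h (sqnorm n x) * indicator S x \<partial>lborel_fun n)
      = (\<integral>\<^sup>+x. \<integral>\<^sup>+u. ?f x u \<partial>lborel \<partial>lborel_fun n)"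
    unfolding radial_def by (subst nn_integral_multc) auto
  also have "\<dots> = (\<integral>\<^sup>+u. \<integral>\<^sup>+x. ?f x u \<partial>lborel_fun n \<partial>lborel)"
  proof (rule P.Fubini'[symmetric])
    show "(\<lambda>(x, u). ?f x u) \<in> borel_measurable (lborel_fun n \<Otimes>\<^sub>M lborel)"
      using ind by measurable
  qed
  also have "\<dots> = (\<integral>\<^sup>+u. cone_vol n S * (h u * ennreal (sqrt u ^ n) * indicator {0<..} u) \<partial>lborel)"
  proof (intro nn_integral_cong)
    fix u :: real
    have "(\<integral>\<^sup>+x. ?f x u \<partial>lborel_fun n)
        = (\<integral>\<^sup>+x. h u * indicator (S \<inter> {x. sqnorm n x \<le> u}) x \<partial>lborel_fun n)"
      by (intro nn_integral_cong) (auto split: split_indicator)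
    also have "\<dots> = h u * emeasure (lborel_fun n) (S \<inter> {x. sqnorm n x \<le> u})"
      using cone_ball_sets[OF S] by (simp add: nn_integral_cmult)
    also have "\<dots> = cone_vol n S * (h u * ennreal (sqrt u ^ n) * indicator {0<..} u)"
    proof (cases "u > 0")
      case True
      then show ?thesis by (simp add: emeasure_cone_ball[OF S] ac_simps)
    next
      case False
      have "S \<inter> {x. sqnorm n x \<le> u} = {}"
        using S False unfolding cone_def by fastforce
      then show ?thesis using False by simp
    qed
    finally show "(\<integral>\<^sup>+x. ?f x u \<partial>lborel_fun n)
      = cone_vol n S * (h u * ennreal (sqrt u ^ n) * indicator {0<..} u)" .
  qed
  also have "\<dots> = cone_vol n S * radial_mass n h"
    unfolding radial_mass_def by (rule nn_integral_cmult) measurable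
  finally show ?thesis .
qed

section \<open>Standard Gaussian vectors\<close>

abbreviation std_normal :: "real measure" where
  "std_normal \<equiv> density lborel (\<lambda>x. ennreal (std_normal_density x))"

abbreviation gauss :: "nat \<Rightarrow> (nat \<Rightarrow> real) measure" where
  "gauss n \<equiv> PiM {..<n} (\<lambda>_. std_normal)"

interpretation std_normal: prob_space std_normal
  by (rule prob_space_normal_density) simp

interpretation gauss_prod: product_sigma_finite "\<lambda>_ :: nat. std_normal"
  by standard

interpretation gauss: prob_space "gauss n" for n
  by (rule prob_space_PiM) (rule std_normal.prob_space_axioms)

lemma distr_gauss_component:
  assumes "i < n"
  shows "distr (gauss n) std_normal (\<lambda>x. x i) = std_normal"
proof -
  interpret product_prob_space "\<lambda>_ :: nat. std_normal" "{..<n}" by standard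
  show ?thesis using PiM_component[of i] assms by simp
qed

lemma sets_gauss: "sets (gauss n) = sets (lborel_fun n)"
  by (rule sets_PiM_cong) auto

lemma space_gauss: "space (gauss n) = space (lborel_fun n)"
  by (rule sets_eq_imp_space_eq[OF sets_gauss])

definition gdens :: "nat \<Rightarrow> (nat \<Rightarrow> real) \<Rightarrow> real" where
  "gdens n x = (1 / sqrt (2 * pi)) ^ n * exp (- sqnorm n x / 2)"

lemma gdens_prod: "gdens n x = (\<Prod>i<n. std_normal_density (x i))"
proof -
  have "(\<Prod>i<n. std_normal_density (x i)) = (1 / sqrt (2 * pi)) ^ n * (\<Prod>i<n. exp (- (x i)\<^sup>2 / 2))"
    unfolding std_normal_density_def prod.distrib by simp
  also have "(\<Prod>i<n. exp (- (x i)\<^sup>2 / 2)) = exp (\<Sum>i<n. - (x i)\<^sup>2 / 2)"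
    by (rule exp_sum[symmetric]) simp
  also have "(\<Sum>i<n. - (x i)\<^sup>2 / 2) = - sqnorm n x / 2"
    unfolding sqnorm_def by (simp add: sum_negf sum_divide_distrib)
  finally show ?thesis by (simp add: gdens_def)
qed

lemma gdens_measurable [measurable]: "gdens n \<in> borel_measurable (lborel_fun n)"
  unfolding gdens_def by measurable

text \<open>Both measures agree on boxes.\<close>

lemma gauss_eq_density: "gauss n = density (lborel_fun n) (\<lambda>x. ennreal (gdens n x))"
proof (rule gauss_prod.PiM_eqI[symmetric])
  fix A :: "nat \<Rightarrow> real set"
  assume A: "\<And>i. i \<in> {..<n} \<Longrightarrow> A i \<in> sets std_normal"
  let ?B = "Pi\<^sub>E {..<n} A"
  have A': "A i \<in> sets borel" if "i < n" for i using A[of i] that by simp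
  have B: "?B \<in> sets (lborel_fun n)" using A' by (intro sets_PiM_I_finite) auto
  have "emeasure (density (lborel_fun n) (\<lambda>x. ennreal (gdens n x))) ?B
      = (\<integral>\<^sup>+x. ennreal (gdens n x) * indicator ?B x \<partial>lborel_fun n)"
    using B by (subst emeasure_density) auto
  also have "\<dots> = (\<integral>\<^sup>+x. (\<Prod>i<n. ennreal (std_normal_density (x i)) * indicator (A i) (x i)) \<partial>lborel_fun n)"
  proof (intro nn_integral_cong)
    fix x :: "nat \<Rightarrow> real" assume x: "x \<in> space (lborel_fun n)"
    have "indicator ?B x = (\<Prod>i<n. indicator (A i) (x i) :: ennreal)"
    proof (cases "x \<in> ?B")
      case True
      then have "x i \<in> A i" if "i < n" for i using that by (auto simp: PiE_iff)
      then show ?thesis using True by simp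
    next
      case False
      then obtain i where "i < n" "x i \<notin> A i" using x by (auto simp: PiE_iff space_PiM)
      then have "(\<Prod>i<n. indicator (A i) (x i) :: ennreal) = 0" by (intro prod_zero) (auto intro!: bexI[of _ i])
      then show ?thesis using False by simp
    qed
    moreover have "ennreal (gdens n x) = (\<Prod>i<n. ennreal (std_normal_density (x i)))"
      unfolding gdens_prod by (rule prod_ennreal[symmetric]) simp
    ultimately show "ennreal (gdens n x) * indicator ?B x
        = (\<Prod>i<n. ennreal (std_normal_density (x i)) * indicator (A i) (x i))"
      by (simp add: prod.distrib)
  qed
  also have "\<dots> = (\<Prod>i<n. \<integral>\<^sup>+y. ennreal (std_normal_density y) * indicator (A i) y \<partial>lborel)"
    using A' by (intro lborel_prod.product_nn_integral_prod) auto
  also have "\<dots> = (\<Prod>i<n. emeasure std_normal (A i))"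
    using A' by (intro prod.cong) (auto simp: emeasure_density)
  finally show "emeasure (density (lborel_fun n) (\<lambda>x. ennreal (gdens n x))) ?B = (\<Prod>i<n. emeasure std_normal (A i))" .
qed (auto simp: sets_gauss)

text \<open>Up to a constant factor the integrand is the normal density of variance \<open>1 / (1 - 2a)\<close>.\<close>

lemma std_normal_exp_sq:
  assumes a: "a < 1 / 2"
  shows "(\<integral>\<^sup>+y. ennreal (exp (a * y\<^sup>2)) \<partial>std_normal) = ennreal (1 / sqrt (1 - 2 * a))"
proof -
  define \<sigma> where "\<sigma> = 1 / sqrt (1 - 2 * a)"
  have s: "\<sigma> > 0" and s2: "\<sigma>\<^sup>2 = 1 / (1 - 2 * a)" using a by (auto simp: \<sigma>_def power_divide)
  have eq: "std_normal_density y * exp (a * y\<^sup>2) = \<sigma> * normal_density 0 \<sigma> y" for y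
  proof -
    have "(y - 0)\<^sup>2 / (2 * \<sigma>\<^sup>2) = y\<^sup>2 * (1 - 2 * a) / 2" using a by (simp add: s2)
    then have "- y\<^sup>2 / 2 + a * y\<^sup>2 = - (y - 0)\<^sup>2 / (2 * \<sigma>\<^sup>2)" by (simp add: algebra_simps)
    then have e: "exp (- y\<^sup>2 / 2) * exp (a * y\<^sup>2) = exp (- (y - 0)\<^sup>2 / (2 * \<sigma>\<^sup>2))"
      by (simp only: exp_add[symmetric])
    have c: "\<sigma> * (1 / sqrt (2 * pi * \<sigma>\<^sup>2)) = 1 / sqrt (2 * pi)"
      using s by (simp add: real_sqrt_mult)
    have "std_normal_density y * exp (a * y\<^sup>2) = 1 / sqrt (2 * pi) * (exp (- y\<^sup>2 / 2) * exp (a * y\<^sup>2))"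
      unfolding std_normal_density_def by simp
    also have "\<dots> = \<sigma> * normal_density 0 \<sigma> y"
      unfolding e c[symmetric] normal_density_def by simp
    finally show ?thesis .
  qed
  have "(\<integral>\<^sup>+y. ennreal (exp (a * y\<^sup>2)) \<partial>std_normal)
      = (\<integral>\<^sup>+y. ennreal \<sigma> * ennreal (normal_density 0 \<sigma> y) \<partial>lborel)"
    by (subst nn_integral_density) (use s in \<open>auto simp: ennreal_mult[symmetric] eq\<close>)
  also have "\<dots> = ennreal \<sigma> * (\<integral>\<^sup>+y. ennreal (normal_density 0 \<sigma> y) \<partial>lborel)"
    by (rule nn_integral_cmult) simp
  also have "(\<integral>\<^sup>+y. ennreal (normal_density 0 \<sigma> y) \<partial>lborel) = 1"
  proof -
    interpret N: prob_space "density lborel (normal_density 0 \<sigma>)"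
      by (rule prob_space_normal_density) (use s in simp)
    show ?thesis using N.emeasure_space_1 by (simp add: emeasure_density)
  qed
  finally show ?thesis by (simp add: \<sigma>_def)
qed

lemma gauss_exp_sum_sq:
  assumes a: "a < 1 / 2" and J: "J \<subseteq> {..<n}"
  shows "(\<integral>\<^sup>+x. ennreal (exp (a * (\<Sum>i\<in>J. (x i)\<^sup>2))) \<partial>gauss n) = ennreal ((1 / sqrt (1 - 2 * a)) ^ card J)"
proof -
  have fin: "finite J" using J finite_subset by blast
  let ?f = "\<lambda>i y. ennreal (exp ((if i \<in> J then a else 0) * y\<^sup>2))"
  have "ennreal (exp (a * (\<Sum>i\<in>J. (x i)\<^sup>2))) = (\<Prod>i<n. ?f i (x i))" for x :: "nat \<Rightarrow> real"
  proof -
    have "a * (\<Sum>i\<in>J. (x i)\<^sup>2) = (\<Sum>i<n. (if i \<in> J then a else 0) * (x i)\<^sup>2)"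
      unfolding sum_distrib_left using J
      by (intro sum.mono_neutral_cong_left) auto
    then show ?thesis by (simp only: exp_sum finite_lessThan) (simp add: prod_ennreal)
  qed
  then have "(\<integral>\<^sup>+x. ennreal (exp (a * (\<Sum>i\<in>J. (x i)\<^sup>2))) \<partial>gauss n) = (\<integral>\<^sup>+x. (\<Prod>i<n. ?f i (x i)) \<partial>gauss n)"
    by simp
  also have "\<dots> = (\<Prod>i<n. \<integral>\<^sup>+y. ?f i y \<partial>std_normal)"
    by (rule gauss_prod.product_nn_integral_prod) auto
  also have "\<dots> = (\<Prod>i<n. if i \<in> J then ennreal (1 / sqrt (1 - 2 * a)) else 1)"
    by (intro prod.cong refl) (use std_normal_exp_sq[OF a] std_normal.emeasure_space_1 in auto)
  also have "\<dots> = (\<Prod>i\<in>J. ennreal (1 / sqrt (1 - 2 * a)))"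
    using J by (intro prod.mono_neutral_cong_right) auto
  also have "\<dots> = ennreal ((1 / sqrt (1 - 2 * a)) ^ card J)"
    using a by (simp add: ennreal_power)
  finally show ?thesis .
qed

lemma gauss_component_measurable [measurable]: "i < n \<Longrightarrow> (\<lambda>x. x i) \<in> borel_measurable (gauss n)"
  using measurable_component_singleton[of i "{..<n}" "\<lambda>_. std_normal"] by simp

text \<open>Markov's inequality for the exponential of \<open>a \<Sum> x\<^sub>i\<^sup>2\<close>. Positive \<open>a\<close> bounds the upper tail of the sum
  and negative \<open>a\<close> the lower tail.\<close>

lemma gauss_tail:
  assumes a: "a < 1 / 2" and J: "J \<subseteq> {..<n}"
  shows "measure (gauss n) {x \<in> space (gauss n). a * t \<le> a * (\<Sum>i\<in>J. (x i)\<^sup>2)}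
    \<le> exp (- a * t) * (1 / sqrt (1 - 2 * a)) ^ card J"
proof -
  have [measurable]: "(\<lambda>x. \<Sum>i\<in>J. (x i)\<^sup>2) \<in> borel_measurable (gauss n)"
    using J by (intro borel_measurable_sum borel_measurable_power gauss_component_measurable) auto
  let ?u = "\<lambda>x. ennreal (exp (a * (\<Sum>i\<in>J. (x i)\<^sup>2)))"
  have eq: "{x \<in> space (gauss n). a * t \<le> a * (\<Sum>i\<in>J. (x i)\<^sup>2)}
      = {x \<in> space (gauss n). 1 \<le> ennreal (exp (- a * t)) * ?u x}"
  proof -
    have "(1 \<le> ennreal (exp (- a * t)) * ?u x) = (a * t \<le> a * (\<Sum>i\<in>J. (x i)\<^sup>2))" for x :: "nat \<Rightarrow> real"
      by (simp add: ennreal_mult[symmetric] exp_add[symmetric] ennreal_1[symmetric] del: ennreal_1)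
    then show ?thesis by simp
  qed
  have "emeasure (gauss n) {x \<in> space (gauss n). a * t \<le> a * (\<Sum>i\<in>J. (x i)\<^sup>2)}
      \<le> ennreal (exp (- a * t)) * (\<integral>\<^sup>+x. ?u x * indicator (space (gauss n)) x \<partial>gauss n)"
    unfolding eq by (rule nn_integral_Markov_inequality) auto
  also have "(\<integral>\<^sup>+x. ?u x * indicator (space (gauss n)) x \<partial>gauss n) = (\<integral>\<^sup>+x. ?u x \<partial>gauss n)"
    by (intro nn_integral_cong) simp
  also have "ennreal (exp (- a * t)) * \<dots> = ennreal (exp (- a * t) * (1 / sqrt (1 - 2 * a)) ^ card J)"
    unfolding gauss_exp_sum_sq[OF assms] by (rule ennreal_mult'[symmetric]) simp
  finally show ?thesis
    unfolding gauss.emeasure_eq_measure using a by (subst (asm) ennreal_le_iff) auto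
qed

lemma indep_vars_gauss_components:
  assumes "0 < n"
  shows "gauss.indep_vars n (\<lambda>_. borel) (\<lambda>i x. x i) {..<n}"
proof -
  have d: "distr (gauss n) borel (\<lambda>x. x i) = std_normal" if "i < n" for i
  proof -
    have "distr (gauss n) std_normal (\<lambda>x. x i) = std_normal"
      by (rule distr_gauss_component[OF that])
    moreover have "distr (gauss n) std_normal (\<lambda>x. x i) = distr (gauss n) borel (\<lambda>x. x i)"
      by (rule distr_cong) auto
    ultimately show ?thesis by simp
  qed
  have "distr (gauss n) (PiM {..<n} (\<lambda>_. borel)) (\<lambda>x. \<lambda>i\<in>{..<n}. x i) = distr (gauss n) (gauss n) (\<lambda>x. x)"
  proof (rule distr_cong)
    show "sets (PiM {..<n} (\<lambda>_. borel :: real measure)) = sets (gauss n)" by (rule sets_PiM_cong) auto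
    show "(\<lambda>i\<in>{..<n}. x i) = x" if "x \<in> space (gauss n)" for x
      using that by (auto simp: space_PiM fun_eq_iff PiE_iff extensional_def)
  qed simp
  also have "\<dots> = gauss n" by (rule distr_id)
  also have "\<dots> = PiM {..<n} (\<lambda>i. distr (gauss n) borel (\<lambda>x. x i))"
    by (rule PiM_cong) (use d in auto)
  finally show ?thesis
    by (subst gauss.indep_vars_iff_distr_eq_PiM') (use assms in auto)
qed

text \<open>A sum of independent normal variables is normal. Coordinates with \<open>\<phi> i = 0\<close> are dropped first,
  since a constant has no normal density.\<close>

lemma gauss_linear_functional:
  assumes \<phi>: "(\<Sum>i<n. (\<phi> i)\<^sup>2) = 1"
  shows "distributed (gauss n) lborel (\<lambda>x. \<Sum>i<n. \<phi> i * x i) std_normal_density"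
proof -
  define I where "I = {i \<in> {..<n}. \<phi> i \<noteq> 0}"
  have I: "finite I" "I \<subseteq> {..<n}" by (auto simp: I_def)
  have sumI: "(\<Sum>i\<in>I. (\<phi> i)\<^sup>2) = 1"
    unfolding \<phi>[symmetric] by (intro sum.mono_neutral_left) (auto simp: I_def)
  then have ne: "I \<noteq> {}" by auto
  then have n: "0 < n" using I by (cases n) auto
  have ind: "gauss.indep_vars n (\<lambda>_. borel) (\<lambda>i x. \<phi> i * x i) I"
    using gauss.indep_vars_compose2[OF gauss.indep_vars_subset[OF indep_vars_gauss_components[OF n] I(2)],
        of "\<lambda>i y. \<phi> i * y" "\<lambda>_. borel"] by simp
  have nrm: "distributed (gauss n) lborel (\<lambda>x. \<phi> i * x i) (normal_density 0 \<bar>\<phi> i\<bar>)" if i: "i \<in> I" for i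
  proof -
    have "i < n" using i I by auto
    have "distr (gauss n) std_normal (\<lambda>x. x i) = std_normal"
      by (rule distr_gauss_component[OF \<open>i < n\<close>])
    moreover have "distr (gauss n) std_normal (\<lambda>x. x i) = distr (gauss n) lborel (\<lambda>x. x i)"
      by (rule distr_cong) auto
    ultimately have "distributed (gauss n) lborel (\<lambda>x. x i) std_normal_density"
      unfolding distributed_def using gauss_component_measurable[OF \<open>i < n\<close>] by simp
    from gauss.normal_density_affine[OF this, of "\<phi> i" 0] show ?thesis using i by (simp add: I_def)
  qed
  have "distributed (gauss n) lborel (\<lambda>x. \<Sum>i\<in>I. \<phi> i * x i)
      (normal_density (\<Sum>i\<in>I. 0) (sqrt (\<Sum>i\<in>I. \<bar>\<phi> i\<bar>\<^sup>2)))"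
    by (rule gauss.sum_indep_normal[OF I(1) ne ind _ nrm]) (auto simp: I_def)
  moreover have "(\<Sum>i<n. \<phi> i * x i) = (\<Sum>i\<in>I. \<phi> i * x i)" for x :: "nat \<Rightarrow> real"
    by (intro sum.mono_neutral_right) (auto simp: I_def)
  ultimately show ?thesis using sumI by simp
qed

text \<open>The standard normal density is at most \<open>1 / sqrt (2 pi) \<le> 2/5\<close>.\<close>

lemma gauss_slab:
  assumes \<phi>: "(\<Sum>i<n. (\<phi> i)\<^sup>2) = 1" and t: "0 \<le> t"
  shows "measure (gauss n) {x \<in> space (gauss n). \<bar>\<Sum>i<n. \<phi> i * x i\<bar> \<le> t} \<le> 4 / 5 * t"
proof -
  let ?Z = "\<lambda>x. \<Sum>i<n. \<phi> i * x i"
  note D = gauss_linear_functional[OF \<phi>]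
  have "{x \<in> space (gauss n). \<bar>?Z x\<bar> \<le> t} = ?Z -` {-t..t} \<inter> space (gauss n)" by auto
  then have "emeasure (gauss n) {x \<in> space (gauss n). \<bar>?Z x\<bar> \<le> t}
      = (\<integral>\<^sup>+y. ennreal (std_normal_density y) * indicator {-t..t} y \<partial>lborel)"
    using distributed_emeasure[OF D, of "{-t..t}"] by simp
  also have "\<dots> \<le> (\<integral>\<^sup>+y. ennreal (2 / 5) * indicator {-t..t} y \<partial>lborel)"
  proof (intro nn_integral_mono mult_right_mono)
    fix y :: real
    have "(5 / 2)\<^sup>2 \<le> 2 * pi" using pi_gt3 pi_approx by (simp add: power2_eq_square)
    then have "5 / 2 \<le> sqrt (2 * pi)" by (rule real_le_rsqrt)
    then have "1 / sqrt (2 * pi) \<le> 2 / 5" by (simp add: field_simps)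
    then have "1 / sqrt (2 * pi) * exp (- y\<^sup>2 / 2) \<le> 2 / 5 * 1" by (intro mult_mono) auto
    then show "ennreal (std_normal_density y) \<le> ennreal (2 / 5)"
      unfolding std_normal_density_def by (intro ennreal_leI) simp
  qed simp
  also have "\<dots> = ennreal (2 / 5) * emeasure lborel {-t..t}"
    by (rule nn_integral_cmult_indicator) simp
  also have "\<dots> = ennreal (4 / 5 * t)" using t by (simp add: ennreal_mult[symmetric])
  finally show ?thesis
    unfolding gauss.emeasure_eq_measure using t by (subst (asm) ennreal_le_iff) auto
qed

section \<open>The uniform measure on the sphere\<close>

text \<open>The density \<open>h\<close> for which the radial weight is the standard Gaussian density.\<close>

definition gauss_weight :: "nat \<Rightarrow> real \<Rightarrow> real" where
  "gauss_weight n u = (1 / sqrt (2 * pi)) ^ n * (exp (- u / 2) / 2)"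

lemma gauss_weight_nonneg: "0 \<le> gauss_weight n u"
  unfolding gauss_weight_def by simp

lemma gauss_weight_measurable [measurable]: "gauss_weight n \<in> borel_measurable borel"
  unfolding gauss_weight_def by measurable

lemma gauss_weight_DERIV:
  "DERIV (\<lambda>u. - ((1 / sqrt (2 * pi)) ^ n * exp (- u / 2))) u :> gauss_weight n u"
  unfolding gauss_weight_def by (auto intro!: derivative_eq_intros)

lemma radial_gauss_weight:
  "radial (\<lambda>u. ennreal (gauss_weight n u)) s = ennreal ((1 / sqrt (2 * pi)) ^ n * exp (- s / 2))"
proof -
  let ?F = "\<lambda>u. - ((1 / sqrt (2 * pi)) ^ n * exp (- u / 2))"
  have "((\<lambda>u :: real. exp (- u / 2)) \<longlongrightarrow> 0) at_top"
    by real_asymp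
  then have "(?F \<longlongrightarrow> - ((1 / sqrt (2 * pi)) ^ n * 0)) at_top"
    by (intro tendsto_intros)
  then have "(\<integral>\<^sup>+u. ennreal (gauss_weight n u) * indicator {s..} u \<partial>lborel) = ennreal (- ((1 / sqrt (2 * pi)) ^ n * 0) - ?F s)"
    by (intro nn_integral_FTC_atLeast gauss_weight_DERIV gauss_weight_nonneg gauss_weight_measurable)
  then show ?thesis unfolding radial_def by simp
qed

lemma gdens_radial: "ennreal (gdens n x) = radial (\<lambda>u. ennreal (gauss_weight n u)) (sqnorm n x)"
  unfolding radial_gauss_weight gdens_def ..

lemma radial_gauss_weight_cut:
  assumes "s \<le> R"
  shows "radial (\<lambda>u. ennreal (gauss_weight n u) * indicator {..R} u) s
    = ennreal ((1 / sqrt (2 * pi)) ^ n * (exp (- s / 2) - exp (- R / 2)))"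
proof -
  let ?F = "\<lambda>u. - ((1 / sqrt (2 * pi)) ^ n * exp (- u / 2))"
  have "radial (\<lambda>u. ennreal (gauss_weight n u) * indicator {..R} u) s
      = (\<integral>\<^sup>+u. ennreal (gauss_weight n u) * indicator {s..R} u \<partial>lborel)"
    unfolding radial_def by (intro nn_integral_cong) (auto split: split_indicator)
  also have "\<dots> = ennreal (?F R - ?F s)"
    by (intro nn_integral_FTC_Icc gauss_weight_DERIV gauss_weight_nonneg gauss_weight_measurable assms)
  finally show ?thesis by (simp add: algebra_simps)
qed

definition nonzero_funs :: "nat \<Rightarrow> (nat \<Rightarrow> real) set" where
  "nonzero_funs n = {x \<in> space (lborel_fun n). 0 < sqnorm n x}"

lemma cone_nonzero_funs: "cone n (nonzero_funs n)"
  unfolding cone_def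
proof (intro conjI ballI allI impI)
  show "nonzero_funs n \<in> sets (lborel_fun n)" unfolding nonzero_funs_def by measurable
  fix x assume x: "x \<in> nonzero_funs n"
  then show "0 < sqnorm n x" by (simp add: nonzero_funs_def)
  fix r :: real assume "0 < r"
  then show "fscale n r x \<in> nonzero_funs n"
    using x fscale_space by (simp add: nonzero_funs_def sqnorm_fscale)
qed

lemma AE_nonzero_funs:
  assumes "0 < n"
  shows "AE x in lborel_fun n. x \<in> nonzero_funs n"
proof -
  let ?N = "Pi\<^sub>E {..<n} (\<lambda>_. {0 :: real})"
  have "emeasure (lborel_fun n) ?N = (\<Prod>i<n. emeasure lborel {0 :: real})"
    by (rule lborel_prod.emeasure_PiM) auto
  also have "\<dots> = 0" using assms by (simp add: prod_zero_iff)
  finally have "?N \<in> null_sets (lborel_fun n)"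
    by (intro null_setsI sets_PiM_I_finite) auto
  moreover have "{x \<in> space (lborel_fun n). \<not> x \<in> nonzero_funs n} \<subseteq> ?N"
  proof
    fix x assume x: "x \<in> {x \<in> space (lborel_fun n). \<not> x \<in> nonzero_funs n}"
    then have "sqnorm n x = 0" using sqnorm_nonneg[of n x] by (auto simp: nonzero_funs_def)
    then have "\<forall>i<n. x i = 0" unfolding sqnorm_def by (subst (asm) sum_nonneg_eq_0_iff) auto
    moreover have "x \<in> extensional {..<n}" using x by (simp add: space_PiM PiE_iff)
    ultimately show "x \<in> ?N" unfolding PiE_iff by simp
  qed
  ultimately show ?thesis by (rule AE_I')
qed

text \<open>The Gaussian density has total mass \<open>1\<close>, and this mass is a multiple of the volume of the unit ball.\<close>

lemma cone_vol_nonzero_funs: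
  assumes "0 < n"
  shows "cone_vol n (nonzero_funs n) \<noteq> 0" "cone_vol n (nonzero_funs n) \<noteq> \<infinity>"
proof -
  let ?h = "\<lambda>u. ennreal (gauss_weight n u)"
  have "1 = emeasure (gauss n) (space (gauss n))" using gauss.emeasure_space_1 by simp
  also have "\<dots> = (\<integral>\<^sup>+x. ennreal (gdens n x) * indicator (space (gauss n)) x \<partial>lborel_fun n)"
    unfolding gauss_eq_density by (subst emeasure_density) auto
  also have "\<dots> = (\<integral>\<^sup>+x. radial ?h (sqnorm n x) * indicator (nonzero_funs n) x \<partial>lborel_fun n)"
  proof (rule nn_integral_cong_AE)
    show "AE x in lborel_fun n. ennreal (gdens n x) * indicator (space (gauss n)) x
        = radial ?h (sqnorm n x) * indicator (nonzero_funs n) x"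
      using AE_nonzero_funs[OF assms] AE_space
    proof eventually_elim
      case (elim x)
      then show ?case by (simp add: gdens_radial space_gauss)
    qed
  qed
  also have "\<dots> = cone_vol n (nonzero_funs n) * radial_mass n ?h"
    by (rule radial_integral_cone[OF cone_nonzero_funs]) measurable
  finally have 1: "cone_vol n (nonzero_funs n) * radial_mass n ?h = 1" by simp
  then show "cone_vol n (nonzero_funs n) \<noteq> 0" by auto
  show "cone_vol n (nonzero_funs n) \<noteq> \<infinity>"
    using 1 by (auto simp: ennreal_top_mult split: if_splits)
qed

text \<open>Every radial weight gives a cone the same share of its total mass.\<close>

lemma radial_integral_cone_ratio:
  assumes n: "0 < n" and S: "cone n S" and h: "h \<in> borel_measurable borel"
  shows "(\<integral>\<^sup>+x. radial h (sqnorm n x) * indicator S x \<partial>lborel_fun n)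
    = cone_vol n S / cone_vol n (nonzero_funs n) * (\<integral>\<^sup>+x. radial h (sqnorm n x) \<partial>lborel_fun n)"
proof -
  let ?V = "cone_vol n (nonzero_funs n)"
  have "(\<integral>\<^sup>+x. radial h (sqnorm n x) \<partial>lborel_fun n)
      = (\<integral>\<^sup>+x. radial h (sqnorm n x) * indicator (nonzero_funs n) x \<partial>lborel_fun n)"
  proof (rule nn_integral_cong_AE)
    show "AE x in lborel_fun n. radial h (sqnorm n x) = radial h (sqnorm n x) * indicator (nonzero_funs n) x"
      using AE_nonzero_funs[OF n] by eventually_elim simp
  qed
  also have "\<dots> = ?V * radial_mass n h" by (rule radial_integral_cone[OF cone_nonzero_funs h])
  finally have "cone_vol n S / ?V * (\<integral>\<^sup>+x. radial h (sqnorm n x) \<partial>lborel_fun n)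
      = cone_vol n S / ?V * ?V * radial_mass n h" by (simp add: mult.assoc)
  also have "cone_vol n S / ?V * ?V = cone_vol n S"
    using cone_vol_nonzero_funs[OF n]
    by (simp add: ennreal_divide_times less_top)
  finally show ?thesis by (simp add: radial_integral_cone[OF S h])
qed

definition fun_of :: "nat \<Rightarrow> real vec \<Rightarrow> nat \<Rightarrow> real" where
  "fun_of n b = (\<lambda>i\<in>{..<n}. b $ i)"

lemma vec_fun_of: "b \<in> carrier_vec n \<Longrightarrow> vec n (fun_of n b) = b"
  unfolding fun_of_def by auto

lemma fun_of_vec: "x \<in> space (lborel_fun n) \<Longrightarrow> fun_of n (vec n x) = x"
  unfolding fun_of_def by (auto simp: space_PiM fun_eq_iff PiE_iff extensional_def)

lemma fun_of_space: "fun_of n b \<in> space (lborel_fun n)"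
  unfolding fun_of_def space_PiM by auto

lemma inj_on_vec: "inj_on (vec n) (space (lborel_fun n))"
  by (rule inj_on_inverseI[of _ "fun_of n"]) (rule fun_of_vec)

lemma sqnorm_eq_inner: "vec n x \<bullet> vec n x = sqnorm n x"
  unfolding sqnorm_def scalar_prod_def by (simp add: power2_eq_square atLeast0LessThan)

lemma inner_eq_sqnorm: "b \<in> carrier_vec n \<Longrightarrow> b \<bullet> b = sqnorm n (fun_of n b)"
  using sqnorm_eq_inner[of n "fun_of n b"] vec_fun_of[of b n] by simp

lemma space_lborel_vec: "space (lborel_vec n) = carrier_vec n"
proof -
  have "vec n ` space (lborel_fun n) = carrier_vec n"
    using vec_fun_of fun_of_space by (auto simp: image_iff) metis
  then show ?thesis unfolding lborel_vec_def space_embed_measure .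
qed

lemma sets_lborel_vec: "X \<in> sets (lborel_fun n) \<Longrightarrow> vec n ` X \<in> sets (lborel_vec n)"
  unfolding lborel_vec_def by (rule in_sets_embed_measure)

lemma emeasure_lborel_vec: "X \<in> sets (lborel_fun n) \<Longrightarrow> emeasure (lborel_vec n) (vec n ` X) = emeasure (lborel_fun n) X"
  unfolding lborel_vec_def by (rule emeasure_embed_measure_image'[OF inj_on_vec])

lemma vec_image_eq: "X \<subseteq> space (lborel_fun n) \<Longrightarrow> vec n ` X = {b \<in> carrier_vec n. fun_of n b \<in> X}"
proof (intro equalityI subsetI)
  fix b assume X: "X \<subseteq> space (lborel_fun n)" and "b \<in> vec n ` X"
  then show "b \<in> {b \<in> carrier_vec n. fun_of n b \<in> X}" using fun_of_vec by auto
next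
  fix b assume "b \<in> {b \<in> carrier_vec n. fun_of n b \<in> X}"
  then have "b = vec n (fun_of n b)" "fun_of n b \<in> X" using vec_fun_of by auto
  then show "b \<in> vec n ` X" by blast
qed

abbreviation unit_vec_of :: "real vec \<Rightarrow> real vec" where
  "unit_vec_of x \<equiv> (1 / sqrt (x \<bullet> x)) \<cdot>\<^sub>v x"

lemma unit_vec_of_vec: "unit_vec_of (vec n x) = vec n (fscale n (1 / sqrt (sqnorm n x)) x)"
  unfolding sqnorm_eq_inner fscale_def by (rule eq_vecI) auto

lemma unit_vec_of_measurable: "unit_vec_of \<in> measurable (lborel_vec n) (lborel_vec n)"
proof -
  have "(\<lambda>x. fscale n (1 / sqrt (sqnorm n x)) x) \<in> measurable (lborel_fun n) (lborel_fun n)"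
    unfolding fscale_def by measurable
  then have "(\<lambda>x. unit_vec_of (vec n x)) \<in> measurable (lborel_fun n) (lborel_vec n)"
    unfolding unit_vec_of_vec lborel_vec_def
    by (rule measurable_compose[OF _ measurable_embed_measure2'[OF inj_on_vec]])
  then have "unit_vec_of \<in> measurable (embed_measure (lborel_fun n) (vec n)) (lborel_vec n)"
    by (rule measurable_embed_measure1)
  then show ?thesis by (simp add: lborel_vec_def)
qed

definition on_sphere :: "nat \<Rightarrow> (nat \<Rightarrow> real) set \<Rightarrow> real vec set" where
  "on_sphere n S = {b \<in> unit_sphere_vec n. fun_of n b \<in> S}"

lemma on_sphere_eq:
  "S \<subseteq> space (lborel_fun n) \<Longrightarrow> on_sphere n S = vec n ` (S \<inter> {x. sqnorm n x = 1})"
  by (subst vec_image_eq) (auto simp: on_sphere_def unit_sphere_vec_def inner_eq_sqnorm)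

lemma on_sphere_sets_lborel_vec:
  assumes S: "S \<in> sets (lborel_fun n)"
  shows "on_sphere n S \<in> sets (lborel_vec n)"
proof -
  have "S \<inter> {x. sqnorm n x = 1} = S \<inter> {x \<in> space (lborel_fun n). sqnorm n x = 1}"
    using sets.sets_into_space[OF S] by auto
  also have "\<dots> \<in> sets (lborel_fun n)" using S by measurable
  finally show ?thesis
    unfolding on_sphere_eq[OF sets.sets_into_space[OF S]] by (rule sets_lborel_vec)
qed

lemma unit_sphere_eq: "unit_sphere_vec n = on_sphere n (space (lborel_fun n))"
  unfolding on_sphere_def using fun_of_space by auto

lemma unit_sphere_sets: "unit_sphere_vec n \<in> sets (lborel_vec n)"
  unfolding unit_sphere_eq by (rule on_sphere_sets_lborel_vec) simp

lemma space_uniform_sphere: "space (uniform_sphere n) = unit_sphere_vec n"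
  unfolding uniform_sphere_def using unit_sphere_sets[of n] by (simp add: space_restrict_space2)

lemma on_sphere_sets:
  assumes "S \<in> sets (lborel_fun n)"
  shows "on_sphere n S \<in> sets (uniform_sphere n)"
proof -
  have "on_sphere n S \<subseteq> unit_sphere_vec n" by (auto simp: on_sphere_def)
  then show ?thesis
    unfolding uniform_sphere_def
    using unit_sphere_sets[of n] on_sphere_sets_lborel_vec[OF assms]
    by (subst sets_restrict_space_iff) (auto intro: sets.Int)
qed

text \<open>A nonzero vector lies in a cone if and only if its normalisation does, and the origin is
  a null set.\<close>

lemma emeasure_uniform_sphere_cone:
  assumes n: "0 < n" and S: "cone n S"
  shows "emeasure (uniform_sphere n) (on_sphere n S) = cone_vol n S / cone_vol n (nonzero_funs n)"
proof -
  have Ss: "S \<in> sets (lborel_fun n)" by (rule cone_sets[OF S])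
  have Ssp: "S \<subseteq> space (lborel_fun n)" by (rule sets.sets_into_space[OF Ss])
  have T: "on_sphere n S \<in> sets (lborel_vec n)" by (rule on_sphere_sets_lborel_vec[OF Ss])
  let ?B = "{x \<in> space (lborel_fun n). sqnorm n x \<le> 1}"
  have ball: "unit_ball_vec n = vec n ` ?B"
    by (subst vec_image_eq) (auto simp: unit_ball_vec_def inner_eq_sqnorm fun_of_space)
  have B: "unit_ball_vec n \<in> sets (lborel_vec n)" unfolding ball by (rule sets_lborel_vec[OF ball_sets])
  let ?U = "uniform_measure (lborel_vec n) (unit_ball_vec n)"
  have m: "unit_vec_of \<in> measurable ?U (lborel_vec n)"
    using unit_vec_of_measurable[of n] by simp
  have pre: "unit_vec_of -` on_sphere n S \<inter> carrier_vec n = vec n ` S"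
  proof -
    have "unit_vec_of b \<in> on_sphere n S \<longleftrightarrow> fun_of n b \<in> S" if b: "b \<in> carrier_vec n" for b
    proof -
      let ?x = "fun_of n b"
      let ?y = "fscale n (1 / sqrt (sqnorm n ?x)) ?x"
      have xs: "?x \<in> space (lborel_fun n)" by (rule fun_of_space)
      have ub: "unit_vec_of b = vec n ?y"
        using unit_vec_of_vec[of n ?x] vec_fun_of[OF b] by simp
      have y: "fun_of n (vec n ?y) = ?y" by (rule fun_of_vec[OF fscale_space])
      have "unit_vec_of b \<in> on_sphere n S \<longleftrightarrow> sqnorm n ?y = 1 \<and> ?y \<in> S"
        unfolding ub on_sphere_def unit_sphere_vec_def by (simp add: sqnorm_eq_inner y)
      also have "\<dots> \<longleftrightarrow> ?x \<in> S"
      proof (cases "sqnorm n ?x = 0")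
        case True
        then have "sqnorm n ?y = 0" by (simp add: sqnorm_fscale)
        moreover have "?x \<notin> S" using S True by (auto simp: cone_def)
        ultimately show ?thesis by simp
      next
        case False
        then have pos: "sqnorm n ?x > 0" using sqnorm_nonneg[of n ?x] by simp
        then have "sqnorm n ?y = 1" by (simp add: sqnorm_fscale power_divide)
        moreover have "?y \<in> S \<longleftrightarrow> ?x \<in> S" using pos by (intro cone_fscale_iff[OF S _ xs]) simp
        ultimately show ?thesis by simp
      qed
      finally show ?thesis .
    qed
    then show ?thesis unfolding vec_image_eq[OF Ssp] by blast
  qed
  have "emeasure (uniform_sphere n) (on_sphere n S) = emeasure (distr ?U (lborel_vec n) unit_vec_of) (on_sphere n S)"
    unfolding uniform_sphere_def
    by (rule emeasure_restrict_space) (use unit_sphere_sets[of n] in \<open>auto simp: on_sphere_def intro: sets.Int\<close>)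
  also have "\<dots> = emeasure ?U (unit_vec_of -` on_sphere n S \<inter> space ?U)"
    by (rule emeasure_distr[OF m T])
  also have "unit_vec_of -` on_sphere n S \<inter> space ?U = vec n ` S"
    using pre by (simp add: space_lborel_vec)
  also have "emeasure ?U (vec n ` S) = emeasure (lborel_vec n) (unit_ball_vec n \<inter> vec n ` S) / emeasure (lborel_vec n) (unit_ball_vec n)"
    by (rule emeasure_uniform_measure[OF B sets_lborel_vec[OF Ss]])
  also have "unit_ball_vec n \<inter> vec n ` S = vec n ` (S \<inter> {x. sqnorm n x \<le> 1})"
    unfolding vec_image_eq[OF Ssp] by (subst vec_image_eq) (use Ssp in \<open>auto simp: unit_ball_vec_def inner_eq_sqnorm\<close>)
  also have "emeasure (lborel_vec n) \<dots> = cone_vol n S"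
    unfolding cone_vol_def by (rule emeasure_lborel_vec[OF cone_ball_sets[OF S]])
  also have "emeasure (lborel_vec n) (unit_ball_vec n) = emeasure (lborel_fun n) ?B"
    unfolding ball by (rule emeasure_lborel_vec[OF ball_sets])
  also have "\<dots> = cone_vol n (nonzero_funs n)"
    unfolding cone_vol_def
  proof (rule emeasure_eq_AE)
    show "AE x in lborel_fun n. (x \<in> ?B) = (x \<in> nonzero_funs n \<inter> {x. sqnorm n x \<le> 1})"
      using AE_nonzero_funs[OF n] AE_space by eventually_elim simp
  qed (use ball_sets cone_ball_sets[OF cone_nonzero_funs] in auto)
  finally show ?thesis .
qed

text \<open>The share of a cone is the same for the Gaussian weight as for the indicator of the unit ball.\<close>

theorem uniform_sphere_eq_gauss:
  assumes n: "0 < n" and S: "cone n S"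
  shows "emeasure (uniform_sphere n) (on_sphere n S) = emeasure (gauss n) S"
proof -
  let ?h = "\<lambda>u. ennreal (gauss_weight n u)"
  have g: "(\<integral>\<^sup>+x. radial ?h (sqnorm n x) * indicator X x \<partial>lborel_fun n) = emeasure (gauss n) X"
    if "X \<in> sets (lborel_fun n)" for X
    unfolding gdens_radial[symmetric] gauss_eq_density using that by (subst emeasure_density) auto
  have "(\<integral>\<^sup>+x. radial ?h (sqnorm n x) \<partial>lborel_fun n)
      = (\<integral>\<^sup>+x. radial ?h (sqnorm n x) * indicator (space (lborel_fun n)) x \<partial>lborel_fun n)"
    by (intro nn_integral_cong) simp
  also have "\<dots> = 1" using g[OF sets.top] gauss.emeasure_space_1 by (simp add: space_gauss)
  finally have 1: "(\<integral>\<^sup>+x. radial ?h (sqnorm n x) \<partial>lborel_fun n) = 1" .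
  have "?h \<in> borel_measurable borel" by measurable
  from radial_integral_cone_ratio[OF n S this] show ?thesis
    unfolding 1 g[OF cone_sets[OF S]] emeasure_uniform_sphere_cone[OF n S] by simp
qed

lemma prob_space_uniform_sphere:
  assumes "0 < n"
  shows "prob_space (uniform_sphere n)"
proof
  have "on_sphere n (nonzero_funs n) = unit_sphere_vec n"
    using fun_of_space by (auto simp: on_sphere_def nonzero_funs_def unit_sphere_vec_def inner_eq_sqnorm)
  then have "emeasure (uniform_sphere n) (space (uniform_sphere n)) = emeasure (gauss n) (nonzero_funs n)"
    unfolding space_uniform_sphere using uniform_sphere_eq_gauss[OF assms cone_nonzero_funs] by simp
  also have "\<dots> = 1"
  proof (rule gauss.emeasure_eq_1_AE)
    show "nonzero_funs n \<in> sets (gauss n)" unfolding sets_gauss by (rule cone_sets[OF cone_nonzero_funs])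
    show "AE x in gauss n. x \<in> nonzero_funs n"
      unfolding gauss_eq_density using AE_nonzero_funs[OF assms] by (subst AE_density) auto
  qed
  finally show "emeasure (uniform_sphere n) (space (uniform_sphere n)) = 1" .
qed

section \<open>The upper bound for the moments\<close>

text \<open>The inverse hyperbolic tangent has derivative \<open>1 / (1 - r\<^sup>2) \<ge> 1\<close>.\<close>

lemma exp_2_le_artanh:
  fixes r :: real
  assumes "0 \<le> r" "r < 1"
  shows "exp (2 * r) \<le> (1 + r) / (1 - r)"
proof -
  let ?g = "\<lambda>r :: real. ln (1 + r) - ln (1 - r) - 2 * r"
  have "?g 0 \<le> ?g r"
  proof (rule DERIV_nonneg_imp_nondecreasing[OF assms(1)])
    fix x assume x: "0 \<le> x" "x \<le> r"
    have "DERIV ?g x :> 1 / (1 + x) + 1 / (1 - x) - 2"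
      using x assms by (auto intro!: derivative_eq_intros)
    moreover have "0 \<le> 1 / (1 + x) + 1 / (1 - x) - 2"
    proof -
      have pq: "0 < (1 + x) * (1 - x)" using x assms by simp
      have "(1 + x) * (1 - x) = 1 - x\<^sup>2" by (simp add: algebra_simps power2_eq_square)
      then have "(1 + x) * (1 - x) \<le> 1" by simp
      then have "2 \<le> 2 / ((1 + x) * (1 - x))" using pq by (simp add: le_divide_eq)
      also have "\<dots> = 1 / (1 + x) + 1 / (1 - x)" using x assms by (subst add_frac_eq) auto
      finally show ?thesis by simp
    qed
    ultimately show "\<exists>y. DERIV ?g x :> y \<and> 0 \<le> y" by blast
  qed
  then have "2 * r \<le> ln ((1 + r) / (1 - r))" using assms by (simp add: ln_div)
  then have "exp (2 * r) \<le> exp (ln ((1 + r) / (1 - r)))" by simp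
  also have "\<dots> = (1 + r) / (1 - r)" using assms by (intro exp_ln) auto
  finally show ?thesis .
qed

text \<open>The Joukowski parameter of the point at which the Chebyshev polynomials are evaluated below: it is
  the image of \<open>1\<close> under the affine map that takes \<open>[0, 1 - \<gamma>]\<close> to \<open>[-1, 1]\<close>.\<close>

lemma joukowski_sqrt:
  fixes \<gamma> :: real
  assumes "0 \<le> \<gamma>" "\<gamma> < 1"
  defines "z \<equiv> (1 + sqrt \<gamma>) / (1 - sqrt \<gamma>)"
  shows "(z + 1 / z) / 2 = (1 + \<gamma>) / (1 - \<gamma>)" "1 \<le> z"
proof -
  define r where "r = sqrt \<gamma>"
  have r: "0 \<le> r" "r < 1" "r\<^sup>2 = \<gamma>" using assms by (auto simp: r_def)
  have "(1 - r) * (1 + r) = 1 - \<gamma>" by (simp add: r(3)[symmetric] algebra_simps power2_eq_square)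
  then have d: "(1 + r) * (1 - r) = 1 - \<gamma>" by (simp add: mult.commute)
  have "(1 + r) / (1 - r) + (1 - r) / (1 + r) = ((1 + r)\<^sup>2 + (1 - r)\<^sup>2) / ((1 + r) * (1 - r))"
    using r by (simp add: field_simps power2_eq_square)
  also have "(1 + r)\<^sup>2 + (1 - r)\<^sup>2 = 2 * (1 + \<gamma>)" by (simp add: r(3)[symmetric] power2_eq_square algebra_simps)
  also have "2 * (1 + \<gamma>) / ((1 + r) * (1 - r)) = 2 * ((1 + \<gamma>) / (1 - \<gamma>))" unfolding d by simp
  finally have zz: "z + 1 / z = 2 * ((1 + \<gamma>) / (1 - \<gamma>))" unfolding z_def r_def[symmetric] by simp
  show "(z + 1 / z) / 2 = (1 + \<gamma>) / (1 - \<gamma>)"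
    unfolding zz by (rule nonzero_mult_div_cancel_left) simp
  show "1 \<le> z" unfolding z_def r_def[symmetric] using r by (simp add: field_simps)
qed

lemma cheb_growth:
  assumes "0 \<le> \<gamma>" "\<gamma> < 1"
  shows "exp (2 * real k * sqrt \<gamma>) / 2 \<le> poly (cheb k) ((1 + \<gamma>) / (1 - \<gamma>))"
    "poly (cheb k) ((1 + \<gamma>) / (1 - \<gamma>)) \<le> ((1 + sqrt \<gamma>) / (1 - sqrt \<gamma>)) ^ k"
proof -
  define z where "z = (1 + sqrt \<gamma>) / (1 - sqrt \<gamma>)"
  have z: "(z + 1 / z) / 2 = (1 + \<gamma>) / (1 - \<gamma>)" "1 \<le> z"
    unfolding z_def by (rule joukowski_sqrt[OF assms])+
  have T: "poly (cheb k) ((1 + \<gamma>) / (1 - \<gamma>)) = (z ^ k + 1 / z ^ k) / 2"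
    unfolding z(1)[symmetric] using z(2) by (intro poly_cheb_half_sum_inverse) simp
  have "exp (2 * real k * sqrt \<gamma>) = exp (2 * sqrt \<gamma>) ^ k"
    by (simp add: exp_of_nat_mult[symmetric] ac_simps)
  also have "\<dots> \<le> z ^ k" unfolding z_def using assms by (intro power_mono exp_2_le_artanh) auto
  finally show "exp (2 * real k * sqrt \<gamma>) / 2 \<le> poly (cheb k) ((1 + \<gamma>) / (1 - \<gamma>))"
    unfolding T using z(2) by (simp add: add_increasing2)
  have "1 \<le> z ^ k" using z(2) by (rule one_le_power)
  then have "1 / z ^ k \<le> z ^ k" by (intro order_trans[of "1 / z ^ k" 1 "z ^ k"]) (auto simp: divide_le_eq_1)
  then show "poly (cheb k) ((1 + \<gamma>) / (1 - \<gamma>)) \<le> ((1 + sqrt \<gamma>) / (1 - sqrt \<gamma>)) ^ k"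
    unfolding T z_def[symmetric] by simp
qed

text \<open>The coordinate along a unit vector is normal for the Gaussian law, but on the sphere it is divided
  by the length of the Gaussian vector, which has to be bounded. Length and direction are decoupled
  by a radial weight that vanishes for \<open>|x|\<^sup>2 > 4n\<close>: it lies below the Gaussian density, so that the
  cone of the slab has weight at most the Gaussian measure of \<open>|Z| \<le> 2 s sqrt n\<close>, where \<open>Z\<close> is the
  normal coordinate, and it keeps at least the fraction \<open>2/5\<close> of the total Gaussian mass.\<close>

lemma sphere_slab:
  assumes n: "10 \<le> n" and \<phi>: "(\<Sum>i<n. (\<phi> i)\<^sup>2) = 1" and s: "0 \<le> s"
  shows "{b \<in> unit_sphere_vec n. \<bar>\<Sum>i<n. \<phi> i * b $ i\<bar> \<le> s} \<in> sets (uniform_sphere n)"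
    "measure (uniform_sphere n) {b \<in> unit_sphere_vec n. \<bar>\<Sum>i<n. \<phi> i * b $ i\<bar> \<le> s} \<le> 4 * s * sqrt (real n)"
proof -
  have n0: "0 < n" using n by simp
  interpret US: prob_space "uniform_sphere n" by (rule prob_space_uniform_sphere[OF n0])
  define Z where "Z x = (\<Sum>i<n. \<phi> i * x i)" for x :: "nat \<Rightarrow> real"
  have Z: "(\<lambda>x. \<bar>Z x\<bar>) \<in> borel_measurable (lborel_fun n)" unfolding Z_def by measurable
  define S where "S = {x \<in> nonzero_funs n. \<bar>Z x\<bar> \<le> s * sqrt (sqnorm n x)}"
  have S_eq: "S = {x \<in> space (lborel_fun n). 0 < sqnorm n x \<and> \<bar>Z x\<bar> \<le> s * sqrt (sqnorm n x)}"
    by (auto simp: S_def nonzero_funs_def)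
  have Zs: "Z (fscale n r x) = r * Z x" for r x
    by (simp add: Z_def fscale_def sum_distrib_left ac_simps)
  have S: "cone n S"
    unfolding cone_def
  proof (intro conjI ballI allI impI)
    have "{x \<in> space (lborel_fun n). \<bar>Z x\<bar> \<le> s * sqrt (sqnorm n x)} \<in> sets (lborel_fun n)"
      by (rule borel_measurable_le[OF Z]) measurable
    moreover have "S = nonzero_funs n \<inter> {x \<in> space (lborel_fun n). \<bar>Z x\<bar> \<le> s * sqrt (sqnorm n x)}"
      by (auto simp: S_def nonzero_funs_def)
    ultimately show "S \<in> sets (lborel_fun n)" using cone_sets[OF cone_nonzero_funs] by (simp add: sets.Int)
    fix x assume x: "x \<in> S"
    then show "0 < sqnorm n x" by (simp add: S_eq)
    fix r :: real assume r: "0 < r"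
    have "r * \<bar>Z x\<bar> \<le> r * (s * sqrt (sqnorm n x))" using x r by (intro mult_left_mono) (auto simp: S_eq)
    then show "fscale n r x \<in> S"
      using x r fscale_space by (simp add: S_eq sqnorm_fscale Zs abs_mult real_sqrt_mult ac_simps)
  qed
  have T: "{b \<in> unit_sphere_vec n. \<bar>\<Sum>i<n. \<phi> i * b $ i\<bar> \<le> s} = on_sphere n S"
  proof -
    have "Z (fun_of n b) = (\<Sum>i<n. \<phi> i * b $ i)" for b
      by (simp add: Z_def fun_of_def)
    then show ?thesis
      using fun_of_space by (auto simp: on_sphere_def S_eq unit_sphere_vec_def inner_eq_sqnorm)
  qed
  show "{b \<in> unit_sphere_vec n. \<bar>\<Sum>i<n. \<phi> i * b $ i\<bar> \<le> s} \<in> sets (uniform_sphere n)"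
    unfolding T by (rule on_sphere_sets[OF cone_sets[OF S]])
  define h where "h u = ennreal (gauss_weight n u) * indicator {..4 * real n} u" for u
  have h: "h \<in> borel_measurable borel" unfolding h_def by measurable
  let ?\<mu> = "emeasure (uniform_sphere n) (on_sphere n S)"
  \<comment> \<open>The left side will be bounded from above, and the integral on the right from below.\<close>
  have ratio: "(\<integral>\<^sup>+x. radial h (sqnorm n x) * indicator S x \<partial>lborel_fun n)
      = ?\<mu> * (\<integral>\<^sup>+x. radial h (sqnorm n x) \<partial>lborel_fun n)"
    unfolding emeasure_uniform_sphere_cone[OF n0 S] by (rule radial_integral_cone_ratio[OF n0 S h])
  have dens: "(\<integral>\<^sup>+x. ennreal (gdens n x) * indicator X x \<partial>lborel_fun n) = emeasure (gauss n) X"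
    if "X \<in> sets (lborel_fun n)" for X
    unfolding gauss_eq_density using that by (subst emeasure_density) auto
  have upper: "(\<integral>\<^sup>+x. radial h (sqnorm n x) * indicator S x \<partial>lborel_fun n) \<le> ennreal (8 / 5 * s * sqrt (real n))"
  proof -
    let ?X = "{x \<in> space (lborel_fun n). \<bar>Z x\<bar> \<le> s * (2 * sqrt (real n))}"
    have "radial h (sqnorm n x) * indicator S x \<le> ennreal (gdens n x) * indicator ?X x"
      if x: "x \<in> space (lborel_fun n)" for x
    proof (cases "x \<in> S")
      case True
      show ?thesis
      proof (cases "sqnorm n x \<le> 4 * real n")
        case le: True
        have "radial h (sqnorm n x) \<le> ennreal (gdens n x)"
          unfolding gdens_radial radial_def h_def by (intro nn_integral_mono) (auto split: split_indicator)
        moreover have "x \<in> ?X"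
        proof -
          have "sqrt (sqnorm n x) \<le> sqrt (4 * real n)" using le by simp
          also have "\<dots> = 2 * sqrt (real n)" by (simp add: real_sqrt_mult)
          finally have "s * sqrt (sqnorm n x) \<le> s * (2 * sqrt (real n))" using s by (rule mult_left_mono)
          then show ?thesis using True by (simp add: S_eq)
        qed
        ultimately show ?thesis using True by simp
      next
        case False
        then have "radial h (sqnorm n x) = (\<integral>\<^sup>+u. 0 \<partial>(lborel :: real measure))"
          unfolding radial_def h_def by (intro nn_integral_cong) (auto split: split_indicator)
        then show ?thesis by simp
      qed
    qed simp
    then have "(\<integral>\<^sup>+x. radial h (sqnorm n x) * indicator S x \<partial>lborel_fun n)
        \<le> (\<integral>\<^sup>+x. ennreal (gdens n x) * indicator ?X x \<partial>lborel_fun n)"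
      by (intro nn_integral_mono) simp
    also have "\<dots> = emeasure (gauss n) ?X" by (rule dens, rule borel_measurable_le[OF Z]) simp
    also have "\<dots> = ennreal (measure (gauss n) ?X)" by (rule gauss.emeasure_eq_measure)
    also have "measure (gauss n) ?X \<le> 4 / 5 * (s * (2 * sqrt (real n)))"
      using gauss_slab[OF \<phi>, of "s * (2 * sqrt (real n))"] s by (simp add: Z_def space_gauss)
    finally show ?thesis by (simp add: ennreal_leI mult_ac)
  qed
  have lower: "ennreal (2 / 5) \<le> (\<integral>\<^sup>+x. radial h (sqnorm n x) \<partial>lborel_fun n)"
  proof -
    let ?Y = "{x \<in> space (lborel_fun n). sqnorm n x \<le> 2 * real n}"
    have Y: "?Y \<in> sets (lborel_fun n)" by (rule ball_sets)
    have e1: "(5 / 2 :: real) \<le> exp 1" using exp_lower_Taylor_quadratic[of 1] by simp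
    \<comment> \<open>The tail bound with \<open>a = 1/4\<close> is \<open>(2/e)\<^bsup>n/2\<^esup>\<close>, which is below \<open>1/2\<close> from \<open>n = 10\<close> on.\<close>
    have meas: "1 / 2 \<le> measure (gauss n) ?Y"
    proof -
      have "measure (gauss n) {x \<in> space (gauss n). 1 / 4 * (2 * real n) \<le> 1 / 4 * (\<Sum>i\<in>{..<n}. (x i)\<^sup>2)}
          \<le> exp (- (1 / 4) * (2 * real n)) * (1 / sqrt (1 - 2 * (1 / 4))) ^ card {..<n}"
        by (rule gauss_tail) auto
      also have "\<dots> = (exp (- (1 / 2)) * sqrt 2) ^ n"
        by (simp add: power_mult_distrib exp_of_nat_mult[symmetric] real_sqrt_divide)
      also have "\<dots> \<le> (exp (- (1 / 2)) * sqrt 2) ^ 10"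
      proof (rule power_decreasing[OF n])
        have "(exp (- (1 / 2)) * sqrt 2)\<^sup>2 = 2 / exp 1"
          by (simp add: power_mult_distrib exp_double[symmetric] exp_minus field_simps)
        also have "\<dots> \<le> 1\<^sup>2" using e1 by (simp add: divide_le_eq)
        finally show "exp (- (1 / 2)) * sqrt 2 \<le> (1 :: real)" by (rule power2_le_imp_le) simp
      qed simp
      also have "\<dots> = ((exp (- (1 / 2)) * sqrt 2)\<^sup>2) ^ 5" by (simp only: power_mult[symmetric]) simp
      also have "(exp (- (1 / 2)) * sqrt 2)\<^sup>2 = 2 / exp 1"
        by (simp add: power_mult_distrib exp_double[symmetric] exp_minus field_simps)
      also have "(2 / exp 1) ^ 5 \<le> (4 / 5 :: real) ^ 5"
        using e1 by (intro power_mono) (auto simp: divide_le_eq)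
      also have "\<dots> \<le> 1 / 2" by (simp add: power_divide)
      finally have "measure (gauss n) {x \<in> space (gauss n). 2 * real n \<le> sqnorm n x} \<le> 1 / 2"
        by (simp add: sqnorm_def)
      moreover have "space (gauss n) - ?Y \<subseteq> {x \<in> space (gauss n). 2 * real n \<le> sqnorm n x}"
        by (auto simp: space_gauss)
      moreover have "{x \<in> space (gauss n). 2 * real n \<le> sqnorm n x} \<in> sets (gauss n)"
        unfolding space_gauss sets_gauss by measurable
      ultimately have "measure (gauss n) (space (gauss n) - ?Y) \<le> 1 / 2"
        using gauss.finite_measure_mono by (meson order_trans)
      then show ?thesis using gauss.prob_compl[of ?Y n] Y by (simp add: sets_gauss)
    qed
    have "ennreal (2 / 5) \<le> ennreal (9 / 10) * ennreal (measure (gauss n) ?Y)"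
      using meas by (subst ennreal_mult[symmetric]) (auto intro!: ennreal_leI)
    also have "\<dots> = ennreal (9 / 10) * (\<integral>\<^sup>+x. ennreal (gdens n x) * indicator ?Y x \<partial>lborel_fun n)"
      by (simp add: dens[OF Y] gauss.emeasure_eq_measure)
    also have "\<dots> = (\<integral>\<^sup>+x. ennreal (9 / 10) * (ennreal (gdens n x) * indicator ?Y x) \<partial>lborel_fun n)"
      using Y by (intro nn_integral_cmult[symmetric]) auto
    also have "\<dots> \<le> (\<integral>\<^sup>+x. radial h (sqnorm n x) \<partial>lborel_fun n)"
    proof (intro nn_integral_mono)
      fix x assume "x \<in> space (lborel_fun n)"
      show "ennreal (9 / 10) * (ennreal (gdens n x) * indicator ?Y x) \<le> radial h (sqnorm n x)"
      proof (cases "x \<in> ?Y")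
        case True
        then have le: "sqnorm n x \<le> 2 * real n" by simp
        have "radial h (sqnorm n x) = ennreal ((1 / sqrt (2 * pi)) ^ n * (exp (- sqnorm n x / 2) - exp (- (4 * real n) / 2)))"
          unfolding h_def by (rule radial_gauss_weight_cut) (use le in simp)
        moreover have "9 / 10 * gdens n x \<le> (1 / sqrt (2 * pi)) ^ n * (exp (- sqnorm n x / 2) - exp (- (4 * real n) / 2))"
        proof -
          have "exp (- (4 * real n) / 2) = exp (- real n) * exp (- real n)"
            by (simp add: exp_add[symmetric])
          also have "\<dots> \<le> 1 / 10 * exp (- sqnorm n x / 2)"
          proof (intro mult_mono)
            have e10: "10 \<le> exp (real n)" using exp_ge_add_one_self[of "real n"] n by linarith
            have "exp (- real n) = 1 / exp (real n)" by (simp add: exp_minus inverse_eq_divide)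
            also have "\<dots> \<le> 1 / 10" using e10 by (intro divide_left_mono) auto
            finally show "exp (- real n) \<le> 1 / 10" .
          qed (use le in auto)
          finally have "9 / 10 * exp (- sqnorm n x / 2) \<le> exp (- sqnorm n x / 2) - exp (- (4 * real n) / 2)"
            by linarith
          then have "(1 / sqrt (2 * pi)) ^ n * (9 / 10 * exp (- sqnorm n x / 2))
            \<le> (1 / sqrt (2 * pi)) ^ n * (exp (- sqnorm n x / 2) - exp (- (4 * real n) / 2))"
            by (rule mult_left_mono) simp
          then show ?thesis by (simp add: gdens_def mult_ac)
        qed
        ultimately show ?thesis using True by (simp add: ennreal_mult'[symmetric] ennreal_leI)
      qed simp
    qed
    finally show ?thesis .
  qed
  have "?\<mu> * ennreal (2 / 5) \<le> ennreal (8 / 5 * s * sqrt (real n))"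
    using mult_left_mono[OF lower, of ?\<mu>] upper unfolding ratio by (meson order_trans zero_le)
  then have "measure (uniform_sphere n) (on_sphere n S) * (2 / 5) \<le> 8 / 5 * s * sqrt (real n)"
    unfolding US.emeasure_eq_measure using s
    by (simp add: ennreal_mult'[symmetric])
  then show "measure (uniform_sphere n) {b \<in> unit_sphere_vec n. \<bar>\<Sum>i<n. \<phi> i * b $ i\<bar> \<le> s} \<le> 4 * s * sqrt (real n)"
    unfolding T by simp
qed

text \<open>The integral of a function that is not integrable is \<open>0\<close> by convention.\<close>

lemma integral_le_of_le:
  fixes f g :: "'a \<Rightarrow> real"
  assumes g: "integrable M g" and le: "\<And>x. x \<in> space M \<Longrightarrow> f x \<le> g x" and nonneg: "0 \<le> (\<integral>x. g x \<partial>M)"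
  shows "(\<integral>x. f x \<partial>M) \<le> (\<integral>x. g x \<partial>M)"
proof (cases "integrable M f")
  case True
  then show ?thesis using integral_mono[OF _ g le] by blast
qed (use nonneg in \<open>simp add: not_integrable_integral_eq\<close>)

context orthogonal_diagonalization begin

text \<open>Eigenvalues within the top fraction \<open>\<gamma>\<close> of the spectrum contribute at most \<open>\<gamma>\<close> to the error of the
  Ritz vector. On the others the transported polynomial is bounded by \<open>1\<close>, so their contribution is
  at most \<open>|b|\<^sup>2 = 1\<close>, divided by the squared length of the Ritz vector, which is at least the
  contribution \<open>T\<^sub>k(y)\<^sup>2 c\<^sub>1\<^sup>2\<close> of the top eigenvector, with \<open>y = (1 + \<gamma>) / (1 - \<gamma>)\<close>.\<close>

lemma rel_err_le_cheb:
  assumes b: "b \<in> unit_sphere_vec n" and i0: "i0 < n" "eig i0 = eigval A 1"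
    and a: "coord b i0 \<noteq> 0" and \<gamma>: "0 \<le> \<gamma>" "\<gamma> < 1"
  shows "rel_err (Suc k) A b \<le> \<gamma> + 4 * exp (- 4 * real k * sqrt \<gamma>) / (coord b i0)\<^sup>2"
proof (cases "eigval A 1 = eigval A n")
  case True
  then have "rel_err (Suc k) A b = 0" using A by (simp add: rel_err_def)
  then show ?thesis using \<gamma> by (simp add: add_nonneg_nonneg)
next
  case False
  have bc: "b \<in> carrier_vec n" "b \<bullet> b = 1" using b by (auto simp: unit_sphere_vec_def)
  then have b0: "b \<noteq> 0\<^sub>v n" by auto
  define l1 where "l1 = eigval A 1"
  define ln where "ln = eigval A n"
  define d where "d = l1 - ln"
  define r where "r = ritz_max (Suc k) A b"
  have eig_bounds: "ln \<le> eig i" "eig i \<le> l1" if "i < n" for i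
    unfolding ln_def l1_def eigval_first eigval_last using that by auto
  have d: "d > 0" using False eig_bounds[OF i0(1)] by (simp add: d_def l1_def ln_def)
  \<comment> \<open>The affine map takes the smallest eigenvalue to \<open>-1\<close> and the eigenvalue at relative distance
    \<open>\<gamma>\<close> from the top to \<open>1\<close>.\<close>
  define P where "P = pcompose (cheb k) [: - 2 * ln / (d * (1 - \<gamma>)) - 1, 2 / (d * (1 - \<gamma>)) :]"
  have Px: "poly P x = poly (cheb k) (2 * (x - ln) / (d * (1 - \<gamma>)) - 1)" for x
    unfolding P_def poly_pcompose by (rule arg_cong[of _ _ "poly (cheb k)"]) (simp add: diff_divide_distrib algebra_simps)
  have degP: "degree P < Suc k"
  proof -
    have "degree P \<le> degree (cheb k) * degree [: - 2 * ln / (d * (1 - \<gamma>)) - 1, 2 / (d * (1 - \<gamma>)) :]"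
      unfolding P_def by (rule degree_pcompose_le)
    also have "\<dots> \<le> k * 1" by (intro mult_mono degree_cheb_le) auto
    finally show ?thesis by simp
  qed
  define w where "w i = poly P (eig i) * coord b i" for i
  define W where "W = (\<Sum>i<n. (w i)\<^sup>2)"
  have "0 \<le> (\<Sum>i<n. (w i)\<^sup>2 * (r - eig i))"
    unfolding w_def using ritz_max_le_iff[OF bc(1) b0, of "Suc k" r] degP by (simp add: r_def)
  also have "\<dots> = (\<Sum>i<n. (w i)\<^sup>2 * (l1 - eig i)) - (l1 - r) * W"
    unfolding W_def sum_distrib_left sum_subtractf[symmetric] by (intro sum.cong refl) (simp add: algebra_simps)
  finally have 1: "(l1 - r) * W \<le> (\<Sum>i<n. (w i)\<^sup>2 * (l1 - eig i))" by simp
  also have "\<dots> \<le> (\<Sum>i<n. \<gamma> * d * (w i)\<^sup>2 + d * (coord b i)\<^sup>2)"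
  proof (intro sum_mono)
    fix i assume "i \<in> {..<n}"
    then have i: "i < n" by simp
    show "(w i)\<^sup>2 * (l1 - eig i) \<le> \<gamma> * d * (w i)\<^sup>2 + d * (coord b i)\<^sup>2"
    proof (cases "l1 - eig i \<le> \<gamma> * d")
      case True
      then have "(w i)\<^sup>2 * (l1 - eig i) \<le> (w i)\<^sup>2 * (\<gamma> * d)" by (intro mult_left_mono) auto
      moreover have "0 \<le> d * (coord b i)\<^sup>2" using d by simp
      ultimately show ?thesis by (simp add: mult_ac)
    next
      case False
      have "\<bar>2 * (eig i - ln) / (d * (1 - \<gamma>)) - 1\<bar> \<le> 1"
      proof -
        have "eig i - ln \<le> d * (1 - \<gamma>)" using False by (simp add: d_def algebra_simps)
        then have "(eig i - ln) / (d * (1 - \<gamma>)) \<le> 1" using d \<gamma> by (simp add: divide_le_eq)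
        moreover have "0 \<le> (eig i - ln) / (d * (1 - \<gamma>))" using d \<gamma> eig_bounds[OF i] by simp
        ultimately have "\<bar>2 * ((eig i - ln) / (d * (1 - \<gamma>))) - 1\<bar> \<le> 1" by linarith
        then show ?thesis by (simp only: times_divide_eq_right)
      qed
      then have "\<bar>poly P (eig i)\<bar> \<le> 1" unfolding Px by (rule abs_poly_cheb_le_1)
      then have "(poly P (eig i))\<^sup>2 \<le> 1" by (simp add: abs_square_le_1)
      then have "(poly P (eig i))\<^sup>2 * (coord b i)\<^sup>2 \<le> 1 * (coord b i)\<^sup>2" by (rule mult_right_mono) simp
      then have "(w i)\<^sup>2 \<le> (coord b i)\<^sup>2" by (simp add: w_def power_mult_distrib)
      then have "(w i)\<^sup>2 * (l1 - eig i) \<le> (coord b i)\<^sup>2 * d"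
        using eig_bounds[OF i] by (intro mult_mono) (auto simp: d_def)
      moreover have "0 \<le> \<gamma> * d * (w i)\<^sup>2" using \<gamma> d by simp
      ultimately show ?thesis by (simp add: mult_ac)
    qed
  qed
  also have "\<dots> = \<gamma> * d * W + d"
    using coord_norm[OF bc(1)] bc(2) by (simp add: sum.distrib W_def sum_distrib_left[symmetric])
  finally have 2: "(l1 - r) * W \<le> \<gamma> * d * W + d" .
  define t where "t = exp (2 * real k * sqrt \<gamma>) / 2"
  have t: "t > 0" by (simp add: t_def)
  have "t \<le> poly P (eig i0)"
  proof -
    have "2 * (eig i0 - ln) / (d * (1 - \<gamma>)) - 1 = (1 + \<gamma>) / (1 - \<gamma>)"
    proof -
      have "eig i0 - ln = d" using i0(2) by (simp add: d_def l1_def)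
      then show ?thesis using d \<gamma> by (simp add: field_simps)
    qed
    then show ?thesis unfolding Px t_def using cheb_growth(1)[OF \<gamma>] by simp
  qed
  then have "t\<^sup>2 * (coord b i0)\<^sup>2 \<le> (w i0)\<^sup>2"
    unfolding w_def power_mult_distrib using t by (intro mult_right_mono power_mono) auto
  also have "\<dots> \<le> W" unfolding W_def using i0(1) by (intro member_le_sum) auto
  finally have Wt: "t\<^sup>2 * (coord b i0)\<^sup>2 \<le> W" .
  have ta: "0 < t\<^sup>2 * (coord b i0)\<^sup>2" using t a by simp
  then have W: "W > 0" using Wt by simp
  have "rel_err (Suc k) A b = (l1 - r) / d"
    using A by (simp add: rel_err_def l1_def ln_def d_def r_def)
  also have "\<dots> \<le> \<gamma> + 1 / W"
    using 2 d W by (simp add: field_simps)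
  also have "1 / W \<le> 1 / (t\<^sup>2 * (coord b i0)\<^sup>2)" using Wt ta by (intro divide_left_mono) auto
  also have "1 / (t\<^sup>2 * (coord b i0)\<^sup>2) = 4 * exp (- 4 * real k * sqrt \<gamma>) / (coord b i0)\<^sup>2"
  proof -
    define E where "E = exp (4 * real k * sqrt \<gamma>)"
    have t2: "t\<^sup>2 = E / 4"
      by (simp add: t_def E_def power_divide exp_double[symmetric])
    have E': "exp (- 4 * real k * sqrt \<gamma>) = 1 / E"
      by (simp add: E_def exp_minus inverse_eq_divide)
    show ?thesis unfolding t2 E' by simp
  qed
  finally show ?thesis by simp
qed

lemma coord_unit: "i < n \<Longrightarrow> (\<Sum>j<n. (U $$ (j, i))\<^sup>2) = 1"
proof -
  assume i: "i < n"
  have "(U\<^sup>T * U) $$ (i, i) = (\<Sum>j<n. (U $$ (j, i))\<^sup>2)"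
    using U i by (simp add: scalar_prod_def power2_eq_square atLeast0LessThan)
  then show ?thesis using UU i by simp
qed

lemma coord_sum: "b \<in> carrier_vec n \<Longrightarrow> i < n \<Longrightarrow> coord b i = (\<Sum>j<n. U $$ (j, i) * b $ j)"
  unfolding coord_def scalar_prod_def using U by (auto simp: atLeast0LessThan)

text \<open>Split according to whether the coordinate along a top eigenvector is at most \<open>s\<close>, where the error is
  at most \<open>1\<close>.\<close>

lemma moment_rel_err_le:
  fixes k :: nat
  assumes n: "10 \<le> n" and p: "1 \<le> p" and \<gamma>: "0 \<le> \<gamma>" "\<gamma> < 1" and s: "0 < s"
  defines "\<beta> \<equiv> \<gamma> + 4 * exp (- 4 * real k * sqrt \<gamma>) / s\<^sup>2"
  shows "(\<integral>b. (rel_err (Suc k) A b) powr p \<partial>uniform_sphere n) \<le> \<beta> powr p + 4 * s * sqrt (real n)"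
proof -
  let ?M = "uniform_sphere n"
  interpret US: prob_space ?M by (rule prob_space_uniform_sphere[OF n_pos])
  obtain i0 where i0: "i0 < n" "eig i0 = eigval A 1"
  proof -
    have "eigval A 1 \<in> eig ` {..<n}" unfolding eigval_first using n_pos by (intro Max_in) auto
    then show ?thesis using that by auto
  qed
  let ?C = "{b \<in> unit_sphere_vec n. \<bar>\<Sum>j<n. U $$ (j, i0) * b $ j\<bar> \<le> s}"
  note slab = sphere_slab[OF n coord_unit[OF i0(1)] less_imp_le[OF s]]
  have \<beta>0: "0 \<le> \<beta>" using \<gamma> by (simp add: \<beta>_def)
  have le: "(rel_err (Suc k) A b) powr p \<le> \<beta> powr p + indicator ?C b" if b: "b \<in> space ?M" for b
  proof -
    have b1: "b \<in> unit_sphere_vec n" using b by (simp add: space_uniform_sphere)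
    then have bc: "b \<in> carrier_vec n" and b0: "b \<noteq> 0\<^sub>v n" by (auto simp: unit_sphere_vec_def)
    note bounds = rel_err_bounds[OF bc b0, of "Suc k"]
    show ?thesis
    proof (cases "b \<in> ?C")
      case True
      have "(rel_err (Suc k) A b) powr p \<le> 1 powr p" using bounds p by (intro powr_mono2) auto
      then show ?thesis using True by (simp add: add_increasing)
    next
      case False
      then have c: "s < \<bar>coord b i0\<bar>" using b1 coord_sum[OF bc i0(1)] by simp
      then have "s\<^sup>2 \<le> (coord b i0)\<^sup>2" using abs_le_square_iff[of s "coord b i0"] s by simp
      have "rel_err (Suc k) A b \<le> \<gamma> + 4 * exp (- 4 * real k * sqrt \<gamma>) / (coord b i0)\<^sup>2"
        by (rule rel_err_le_cheb[OF b1 i0 _ \<gamma>]) (use c s in auto)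
      also have "\<dots> \<le> \<beta>"
        unfolding \<beta>_def using \<open>s\<^sup>2 \<le> (coord b i0)\<^sup>2\<close> s
        by (intro add_left_mono frac_le) auto
      finally have "(rel_err (Suc k) A b) powr p \<le> \<beta> powr p" using bounds p by (intro powr_mono2) auto
      then show ?thesis by (simp add: add_increasing2)
    qed
  qed
  have ind: "integrable ?M (indicator ?C :: real vec \<Rightarrow> real)"
    by (rule integrable_real_indicator[OF slab(1)]) (simp add: US.emeasure_eq_measure)
  have int: "integrable ?M (\<lambda>b. \<beta> powr p + indicator ?C b :: real)"
    by (intro Bochner_Integration.integrable_add US.integrable_const ind)
  have eq: "(\<integral>b. \<beta> powr p + indicator ?C b \<partial>?M) = \<beta> powr p + measure ?M ?C"
    using Bochner_Integration.integral_add[OF US.integrable_const ind, of "\<beta> powr p"]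
      sets.Int_space_eq2[OF slab(1)]
    by (simp add: US.prob_space)
  have "(\<integral>b. (rel_err (Suc k) A b) powr p \<partial>?M) \<le> (\<integral>b. \<beta> powr p + indicator ?C b \<partial>?M)"
    by (rule integral_le_of_le[OF int le]) (auto simp: eq)
  also have "\<dots> \<le> \<beta> powr p + 4 * s * sqrt (real n)" unfolding eq using slab(2) by simp
  finally show ?thesis .
qed

lemma moment_rel_err_le_1:
  assumes p: "1 \<le> p"
  shows "(\<integral>b. (rel_err (Suc k) A b) powr p \<partial>uniform_sphere n) \<le> 1"
proof -
  let ?M = "uniform_sphere n"
  interpret US: prob_space ?M by (rule prob_space_uniform_sphere[OF n_pos])
  have le: "(rel_err (Suc k) A b) powr p \<le> 1" if b: "b \<in> space ?M" for b
  proof -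
    have "b \<in> carrier_vec n" "b \<noteq> 0\<^sub>v n"
      using b unfolding space_uniform_sphere by (auto simp: unit_sphere_vec_def)
    note bounds = rel_err_bounds[OF this, of "Suc k"]
    have "(rel_err (Suc k) A b) powr p \<le> 1 powr p" using bounds p by (intro powr_mono2) auto
    then show ?thesis by simp
  qed
  have "(\<integral>b. (rel_err (Suc k) A b) powr p \<partial>?M) \<le> (\<integral>b. 1 \<partial>?M)"
    by (rule integral_le_of_le[OF _ le]) auto
  then show ?thesis by (simp add: US.prob_space)
qed

end

text \<open>Superadditivity of \<open>x\<^sup>p\<close> for \<open>p \<ge> 1\<close>: bound \<open>t\<^bsup>p - 1\<^esup>\<close> by \<open>(x + y)\<^bsup>p - 1\<^esup>\<close> for \<open>t = x\<close> and \<open>t = y\<close>.\<close>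

lemma powr_superadd:
  fixes x y p :: real
  assumes "0 \<le> x" "0 \<le> y" "1 \<le> p"
  shows "x powr p + y powr p \<le> (x + y) powr p"
proof (cases "x + y = 0")
  case True
  then show ?thesis using assms by (simp add: add_nonneg_eq_0_iff)
next
  case False
  have *: "t powr p \<le> t * (x + y) powr (p - 1)" if "0 \<le> t" "t \<le> x + y" for t
  proof (cases "t = 0")
    case False
    then have "t powr p = t * t powr (p - 1)" using that by (simp add: powr_mult_base)
    also have "\<dots> \<le> t * (x + y) powr (p - 1)" using that assms by (intro mult_left_mono powr_mono2) auto
    finally show ?thesis .
  qed simp
  have "x powr p + y powr p \<le> x * (x + y) powr (p - 1) + y * (x + y) powr (p - 1)"
    by (intro add_mono *) (use assms in auto)
  also have "\<dots> = (x + y) * (x + y) powr (p - 1)" by (simp add: algebra_simps)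
  also have "\<dots> = (x + y) powr p" using False assms by (simp add: powr_mult_base)
  finally show ?thesis .
qed

text \<open>The choice of \<open>\<gamma>\<close> makes the exponential equal to \<open>1 / (n k\<^bsup>8p\<^esup>)\<close>, and the choice of \<open>s\<close> turns the two
  error terms into \<open>16 k\<^bsup>-4p\<^esup>\<close> and \<open>2 k\<^bsup>-2p\<^esup>\<close>. Both are absorbed by the difference
  \<open>(0.068 - 1/16) L\<^sup>2 / k\<^sup>2\<close>, which is at least \<open>2.2 / k\<^sup>2\<close> because \<open>L \<ge> 20\<close>.\<close>

lemma upper_bound_constants:
  fixes n k :: nat and p :: real
  assumes n: "100 \<le> n" and k: "9 \<le> k" and p: "1 \<le> p"
  defines "L \<equiv> ln (real n * real k powr (8 * p))"
  defines "\<gamma> \<equiv> L\<^sup>2 / (16 * (real k)\<^sup>2)"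
  defines "s \<equiv> real k powr (- 2 * p) / (2 * sqrt (real n))"
  shows "(\<gamma> + 4 * exp (- 4 * real k * sqrt \<gamma>) / s\<^sup>2) powr p + 4 * s * sqrt (real n)
    \<le> (0.068 * L\<^sup>2 / (real k)\<^sup>2) powr p"
proof -
  have k0: "0 < real k" and n0: "0 < real n" using k n by auto
  have Leq: "L = ln (real n) + 8 * p * ln (real k)"
    unfolding L_def using k0 n0 by (simp add: ln_mult ln_powr)
  have e1: "exp 1 \<le> (3 :: real)" by (rule exp_le)
  have "exp (2 :: real) = exp 1 ^ 2" by (simp add: exp_of_nat_mult[symmetric])
  also have "\<dots> \<le> 3 ^ 2" using e1 by (intro power_mono) auto
  finally have "exp 2 \<le> real k" using k by simp
  then have lnk: "2 \<le> ln (real k)" using k0 by (simp add: ln_ge_iff)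
  have "exp (4 :: real) = exp 1 ^ 4" by (simp add: exp_of_nat_mult[symmetric])
  also have "\<dots> \<le> 3 ^ 4" using e1 by (intro power_mono) auto
  finally have "exp 4 \<le> real n" using n by simp
  then have lnn: "4 \<le> ln (real n)" using n0 by (simp add: ln_ge_iff)
  have "1 * 2 \<le> p * ln (real k)" using p lnk by (intro mult_mono) auto
  then have L20: "20 \<le> L" unfolding Leq using lnn by linarith
  then have "20\<^sup>2 \<le> L\<^sup>2" by (intro power_mono) auto
  then have L400: "400 \<le> L\<^sup>2" by simp
  have sq: "sqrt \<gamma> = L / (4 * real k)"
    unfolding \<gamma>_def using L20 k0 by (simp add: real_sqrt_divide real_sqrt_mult)
  have "4 * real k * sqrt \<gamma> = L" unfolding sq using k0 by simp
  then have e: "exp (- 4 * real k * sqrt \<gamma>) = 1 / (real n * real k powr (8 * p))"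
    unfolding L_def using k0 n0 by (simp add: exp_minus inverse_eq_divide)
  have s2: "s\<^sup>2 = real k powr (- 4 * p) / (4 * real n)"
    unfolding s_def power_divide power_mult_distrib using n0 k0
    by (simp add: powr_power)
  have "4 * exp (- 4 * real k * sqrt \<gamma>) / s\<^sup>2 = 16 * (1 / real k powr (8 * p) / real k powr (- 4 * p))"
    unfolding e s2 using n0 by simp
  also have "1 / real k powr (8 * p) / real k powr (- 4 * p) = real k powr (- 4 * p)"
    using k0 by (simp add: powr_minus_divide[symmetric] powr_diff[symmetric])
  finally have \<beta>: "4 * exp (- 4 * real k * sqrt \<gamma>) / s\<^sup>2 = 16 * real k powr (- 4 * p)" .
  have "real k powr (- 4 * p) \<le> real k powr (- 4)" using p k by (intro powr_mono) auto
  also have "\<dots> = 1 / (real k)\<^sup>2 * (1 / (real k)\<^sup>2)"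
    using k0 by (simp add: powr_minus_divide power2_eq_square power4_eq_xxxx)
  also have "\<dots> \<le> 1 / (real k)\<^sup>2 * (1 / 81)"
  proof (intro mult_left_mono divide_left_mono)
    have "9\<^sup>2 \<le> (real k)\<^sup>2" using k by (intro power_mono) auto
    then show "81 \<le> (real k)\<^sup>2" by simp
  qed (use k0 in auto)
  finally have k4: "16 * real k powr (- 4 * p) \<le> 16 / 81 * (1 / (real k)\<^sup>2)" by simp
  define \<beta> where "\<beta> = \<gamma> + 16 * real k powr (- 4 * p)"
  define \<rho> where "\<rho> = 0.068 * L\<^sup>2 / (real k)\<^sup>2"
  define q where "q = 1 / (real k)\<^sup>2"
  have q: "q > 0" using k0 by (simp add: q_def)
  have "\<rho> - \<gamma> = 11 / 2000 * L\<^sup>2 * q" unfolding \<rho>_def \<gamma>_def q_def by (simp add: field_simps)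
  moreover have "11 / 2000 * 400 * q \<le> 11 / 2000 * L\<^sup>2 * q" using L400 q by (intro mult_right_mono) auto
  moreover have "16 * real k powr (- 4 * p) \<le> 16 / 81 * q" using k4 by (simp add: q_def)
  ultimately have diff: "2 * q \<le> \<rho> - \<beta>" unfolding \<beta>_def using q by linarith
  have \<beta>0: "0 \<le> \<beta>" unfolding \<beta>_def \<gamma>_def by simp
  have "4 * s * sqrt (real n) = 2 * real k powr (- 2 * p)"
    unfolding s_def using n0 by simp
  also have "real k powr (- 2 * p) = q powr p"
  proof -
    have "q = real k powr (- 2)" unfolding q_def using k0 by (simp add: powr_minus_divide)
    then show ?thesis by (simp add: powr_powr)
  qed
  also have "2 * q powr p \<le> 2 powr p * q powr p"
  proof (rule mult_right_mono)
    show "2 \<le> 2 powr p" using powr_mono[of 1 p 2] p by simp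
  qed simp
  also have "\<dots> = (2 * q) powr p" using q by (simp add: powr_mult)
  also have "\<dots> \<le> (\<rho> - \<beta>) powr p" using diff q p by (intro powr_mono2) auto
  finally have "\<beta> powr p + 4 * s * sqrt (real n) \<le> \<beta> powr p + (\<rho> - \<beta>) powr p" by simp
  also have "\<dots> \<le> (\<beta> + (\<rho> - \<beta>)) powr p" using \<beta>0 diff q p by (intro powr_superadd) auto
  finally show ?thesis unfolding \<beta> \<beta>_def[symmetric] \<rho>_def[symmetric] by simp
qed

lemma real_symmetric_diagonalization:
  assumes "A \<in> sym_mats n" "0 < n"
  shows "\<exists>U D. orthogonal_diagonalization n A U D"
  using real_symmetric_spectral[of A n] assms
  unfolding orthogonal_diagonalization_def sym_mats_def by blast

theorem moment_bound:
  fixes n m :: nat and p :: real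
  assumes n: "100 \<le> n" and m: "10 \<le> m" and p: "1 \<le> p"
  shows "(SUP A \<in> sym_mats n. (\<integral>b. (rel_err m A b) powr p \<partial>uniform_sphere n) powr (1/p))
    \<le> 0.068 * (ln (real n * (real m - 1) powr (8 * p)))\<^sup>2 / (real m - 1)\<^sup>2"
proof (rule cSUP_least)
  have "0\<^sub>m n n \<in> sym_mats n" unfolding sym_mats_def by simp
  then show "sym_mats n \<noteq> {}" by blast
next
  fix A assume A: "A \<in> sym_mats n"
  obtain U D where "orthogonal_diagonalization n A U D"
    using real_symmetric_diagonalization[OF A] n by auto
  then interpret orthogonal_diagonalization n A U D .
  define k where "k = m - 1"
  have mk: "m = Suc k" "real m - 1 = real k" and k: "9 \<le> k" using m by (auto simp: k_def)
  define L where "L = ln (real n * real k powr (8 * p))"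
  define \<rho> where "\<rho> = 0.068 * L\<^sup>2 / (real k)\<^sup>2"
  define I where "I = (\<integral>b. (rel_err m A b) powr p \<partial>uniform_sphere n)"
  have I0: "0 \<le> I" unfolding I_def by (rule Bochner_Integration.integral_nonneg) simp
  have \<rho>0: "0 \<le> \<rho>" unfolding \<rho>_def by simp
  have "I powr (1 / p) \<le> \<rho>"
  \<comment> \<open>If \<open>\<rho> \<ge> 1\<close>, the trivial bound on the error suffices; otherwise \<open>\<gamma> < \<rho> < 1\<close> is admissible.\<close>
  proof (cases "\<rho> \<ge> 1")
    case True
    have "I powr (1 / p) \<le> 1 powr (1 / p)"
      using I0 p moment_rel_err_le_1[OF p, of k] by (intro powr_mono2) (auto simp: I_def mk)
    then show ?thesis using True by simp
  next
    case False
    define \<gamma> where "\<gamma> = L\<^sup>2 / (16 * (real k)\<^sup>2)"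
    define s where "s = real k powr (- 2 * p) / (2 * sqrt (real n))"
    have \<gamma>: "0 \<le> \<gamma>" by (simp add: \<gamma>_def)
    have "\<gamma> = 0.0625 * (L\<^sup>2 / (real k)\<^sup>2)" by (simp add: \<gamma>_def)
    also have "\<dots> \<le> 0.068 * (L\<^sup>2 / (real k)\<^sup>2)" by (intro mult_right_mono) auto
    also have "\<dots> < 1" using False by (simp add: \<rho>_def)
    finally have \<gamma>1: "\<gamma> < 1" .
    have s: "0 < s" using k n by (simp add: s_def)
    have "I \<le> (\<gamma> + 4 * exp (- 4 * real k * sqrt \<gamma>) / s\<^sup>2) powr p + 4 * s * sqrt (real n)"
      unfolding I_def mk(1) by (rule moment_rel_err_le) (use n p \<gamma> \<gamma>1 s in auto)
    also have "\<dots> \<le> \<rho> powr p"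
      unfolding \<gamma>_def s_def \<rho>_def L_def by (rule upper_bound_constants[OF n k p])
    finally have "I powr (1 / p) \<le> (\<rho> powr p) powr (1 / p)" using I0 p by (intro powr_mono2) auto
    also have "\<dots> = \<rho>" using p \<rho>0 by (simp add: powr_powr)
    finally show ?thesis .
  qed
  then show "(\<integral>b. (rel_err m A b) powr p \<partial>uniform_sphere n) powr (1/p)
      \<le> 0.068 * (ln (real n * (real m - 1) powr (8 * p)))\<^sup>2 / (real m - 1)\<^sup>2"
    unfolding I_def[symmetric] mk(2) L_def[symmetric] \<rho>_def .
qed

section \<open>The lower bound for a test matrix\<close>

text \<open>The top eigenvalue \<open>1\<close> is simple; the others cycle through the zeros of \<open>T\<^sub>m\<close>, moved from \<open>[-1, 1]\<close> to
  \<open>[0, 1 - \<delta>]\<close>.\<close>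

definition test_eig :: "nat \<Rightarrow> real \<Rightarrow> nat \<Rightarrow> real" where
  "test_eig m \<delta> i = (if i = 0 then 1 else (1 - \<delta>) * (1 + cheb_node m (i mod m)) / 2)"

definition test_mat :: "nat \<Rightarrow> nat \<Rightarrow> real \<Rightarrow> real mat" where
  "test_mat n m \<delta> = mat n n (\<lambda>(i, j). if i = j then test_eig m \<delta> i else 0)"

lemma test_mat_sym: "test_mat n m \<delta> \<in> sym_mats n"
  unfolding test_mat_def sym_mats_def by auto

lemma test_mat_diagonalization:
  "0 < n \<Longrightarrow> orthogonal_diagonalization n (test_mat n m \<delta>) (1\<^sub>m n) (test_mat n m \<delta>)"
  by unfold_locales (auto simp: test_mat_def diagonal_mat_def)

lemma test_eig_bounds:
  assumes "0 \<le> \<delta>" "\<delta> \<le> 1"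
  shows "0 \<le> test_eig m \<delta> i" "test_eig m \<delta> i \<le> 1" "0 < i \<Longrightarrow> test_eig m \<delta> i \<le> 1 - \<delta>"
proof -
  let ?c = "cheb_node m (i mod m)"
  have c: "-1 \<le> ?c" "?c \<le> 1" by (auto simp: cheb_node_def)
  have u: "(1 - \<delta>) * (1 + ?c) / 2 \<le> 1 - \<delta>"
  proof -
    have "(1 - \<delta>) * (1 + ?c) \<le> (1 - \<delta>) * 2" using assms c by (intro mult_left_mono) auto
    then show ?thesis by simp
  qed
  have l: "0 \<le> (1 - \<delta>) * (1 + ?c) / 2" using assms c by (intro divide_nonneg_pos mult_nonneg_nonneg) auto
  show "0 \<le> test_eig m \<delta> i" using l by (simp add: test_eig_def)
  show "test_eig m \<delta> i \<le> 1" using u assms by (simp add: test_eig_def)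
  show "0 < i \<Longrightarrow> test_eig m \<delta> i \<le> 1 - \<delta>" using u by (simp add: test_eig_def)
qed

definition ritz_form :: "nat \<Rightarrow> (nat \<Rightarrow> real) \<Rightarrow> real \<Rightarrow> real poly \<Rightarrow> (nat \<Rightarrow> real) \<Rightarrow> real" where
  "ritz_form n d \<tau> P x = (\<Sum>i<n. (poly P (d i) * x i)\<^sup>2 * (\<tau> - d i))"

definition ritz_le_funs :: "nat \<Rightarrow> nat \<Rightarrow> (nat \<Rightarrow> real) \<Rightarrow> real \<Rightarrow> (nat \<Rightarrow> real) set" where
  "ritz_le_funs n m d \<tau> = {x \<in> nonzero_funs n. \<forall>P. degree P < m \<longrightarrow> 0 \<le> ritz_form n d \<tau> P x}"

text \<open>Countably many polynomials suffice, which makes the event measurable. Rounding the multiples by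
  \<open>k + 1\<close> of the coefficients to integers approximates \<open>P\<close> up to the factor \<open>k + 1\<close>, and such a factor does not
  change the sign of the form.\<close>

lemma ritz_form_nonneg_iff_int:
  "(\<forall>P. degree P < m \<longrightarrow> 0 \<le> ritz_form n d \<tau> P x) \<longleftrightarrow>
   (\<forall>L :: int list. 0 < m \<longrightarrow> 0 \<le> ritz_form n d \<tau> (\<Sum>j<m. monom (real_of_int (L ! j)) j) x)"
  (is "?A \<longleftrightarrow> ?B")
proof
  assume A: ?A
  have deg: "degree (\<Sum>j<m. monom (c j) j) < m" if "0 < m" for c :: "nat \<Rightarrow> real"
  proof (rule degree_sum_less[OF _ that])
    fix j assume "j \<in> {..<m}"
    then show "degree (monom (c j) j) < m" using degree_monom_le[of "c j" j] by simp
  qed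
  show ?B
  proof (intro allI impI)
    fix L :: "int list" assume "0 < m"
    then show "0 \<le> ritz_form n d \<tau> (\<Sum>j<m. monom (real_of_int (L ! j)) j) x"
      by (intro A[rule_format] deg)
  qed
next
  assume B: ?B
  show ?A
  proof (intro allI impI)
    fix P :: "real poly" assume P: "degree P < m"
    define F where "F c = (\<Sum>i<n. ((\<Sum>j<m. c j * d i ^ j) * x i)\<^sup>2 * (\<tau> - d i))" for c :: "nat \<Rightarrow> real"
    have F: "ritz_form n d \<tau> (\<Sum>j<m. monom (c j) j) x = F c" for c
      unfolding ritz_form_def F_def by (simp add: poly_sum poly_monom)
    define r where "r k j = real_of_int \<lfloor>coeff P j * real (Suc k)\<rfloor> / real (Suc k)" for k j
    have r: "(\<lambda>k. r k j) \<longlonglongrightarrow> coeff P j" for j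
    proof (rule LIMSEQ_I)
      fix e :: real assume e: "0 < e"
      obtain K :: nat where K: "1 / e < real K" using reals_Archimedean2 by blast
      have "norm (r k j - coeff P j) < e" if "K \<le> k" for k
      proof -
        have "r k j - coeff P j = (real_of_int \<lfloor>coeff P j * real (Suc k)\<rfloor> - coeff P j * real (Suc k)) / real (Suc k)"
          unfolding r_def by (simp add: diff_divide_distrib)
        then have "norm (r k j - coeff P j) = \<bar>real_of_int \<lfloor>coeff P j * real (Suc k)\<rfloor> - coeff P j * real (Suc k)\<bar> / real (Suc k)"
          by simp
        also have "\<dots> \<le> 1 / real (Suc k)"
        proof (rule divide_right_mono)
          show "\<bar>real_of_int \<lfloor>coeff P j * real (Suc k)\<rfloor> - coeff P j * real (Suc k)\<bar> \<le> 1" by linarith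
        qed simp
        also have "\<dots> < e"
        proof -
          have "1 / e < real (Suc k)" using K that by simp
          then show ?thesis using e by (simp add: divide_less_eq mult.commute)
        qed
        finally show ?thesis .
      qed
      then show "\<exists>no. \<forall>k\<ge>no. norm (r k j - coeff P j) < e" by blast
    qed
    have lim: "(\<lambda>k. F (r k)) \<longlonglongrightarrow> F (coeff P)"
      unfolding F_def by (intro tendsto_intros r)
    have "0 \<le> F (r k)" for k
    proof -
      define L where "L = map (\<lambda>j. \<lfloor>coeff P j * real (Suc k)\<rfloor>) [0..<m]"
      have "0 \<le> F (\<lambda>j. real_of_int (L ! j))" using B[rule_format, of L] P F by simp
      also have "F (\<lambda>j. real_of_int (L ! j)) = F (\<lambda>j. real (Suc k) * r k j)"
        unfolding F_def by (intro sum.cong refl arg_cong2[of _ _ _ _ "(*)"] arg_cong[of _ _ "\<lambda>t. t\<^sup>2"])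
          (auto simp: L_def r_def)
      also have "\<dots> = (real (Suc k))\<^sup>2 * F (r k)"
        unfolding F_def sum_distrib_left
        by (intro sum.cong refl) (simp add: mult.assoc sum_distrib_left[symmetric] power_mult_distrib del: of_nat_Suc)
      finally show ?thesis by (simp add: zero_le_mult_iff del: of_nat_Suc)
    qed
    then have "0 \<le> F (coeff P)" using lim by (intro LIMSEQ_le_const[OF lim]) auto
    moreover have "(\<Sum>j<m. monom (coeff P j) j) = P"
    proof -
      have "(\<Sum>j<m. monom (coeff P j) j) = (\<Sum>j\<le>degree P. monom (coeff P j) j)"
        using P by (intro sum.mono_neutral_right) (auto simp: coeff_eq_0)
      then show ?thesis by (simp add: poly_as_sum_of_monoms)
    qed
    ultimately show "0 \<le> ritz_form n d \<tau> P x" using F[of "coeff P"] by simp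
  qed
qed

lemma cone_ritz_le_funs:
  assumes m: "0 < m"
  shows "cone n (ritz_le_funs n m d \<tau>)"
  unfolding cone_def
proof (intro conjI ballI allI impI)
  have [measurable]: "ritz_form n d \<tau> P \<in> borel_measurable (lborel_fun n)" for P
    unfolding ritz_form_def by measurable
  have "{x \<in> space (lborel_fun n). \<forall>L :: int list. 0 \<le> ritz_form n d \<tau> (\<Sum>j<m. monom (real_of_int (L ! j)) j) x}
      \<in> sets (lborel_fun n)"
    by measurable
  moreover have "ritz_le_funs n m d \<tau> = nonzero_funs n \<inter>
      {x \<in> space (lborel_fun n). \<forall>L :: int list. 0 \<le> ritz_form n d \<tau> (\<Sum>j<m. monom (real_of_int (L ! j)) j) x}"
    unfolding ritz_le_funs_def ritz_form_nonneg_iff_int using m by (auto simp: nonzero_funs_def)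
  ultimately show "ritz_le_funs n m d \<tau> \<in> sets (lborel_fun n)"
    using cone_sets[OF cone_nonzero_funs] by (simp add: sets.Int)
  fix x assume x: "x \<in> ritz_le_funs n m d \<tau>"
  then show "0 < sqnorm n x" by (simp add: ritz_le_funs_def nonzero_funs_def)
  fix r :: real assume r: "0 < r"
  have "ritz_form n d \<tau> P (fscale n r x) = r\<^sup>2 * ritz_form n d \<tau> P x" for P
    unfolding ritz_form_def sum_distrib_left fscale_def
    by (intro sum.cong refl) (simp add: power_mult_distrib)
  then show "fscale n r x \<in> ritz_le_funs n m d \<tau>"
    using x r cone_nonzero_funs[of n] by (auto simp: ritz_le_funs_def cone_def zero_le_mult_iff)
qed

lemma (in orthogonal_diagonalization) rel_err_ge_iff:
  assumes b: "b \<in> carrier_vec n" "b \<noteq> 0\<^sub>v n" and m: "0 < m" and lt: "eigval A n < eigval A 1"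
  shows "\<gamma> \<le> rel_err m A b \<longleftrightarrow>
    (\<forall>P. degree P < m \<longrightarrow> 0 \<le> ritz_form n eig (eigval A 1 - \<gamma> * (eigval A 1 - eigval A n)) P (coord b))"
proof -
  have "\<gamma> \<le> rel_err m A b \<longleftrightarrow> ritz_max m A b \<le> eigval A 1 - \<gamma> * (eigval A 1 - eigval A n)"
    unfolding rel_err_def using A lt by (simp add: le_divide_eq algebra_simps)
  then show ?thesis unfolding ritz_max_le_iff[OF b m] ritz_form_def .
qed

text \<open>The threshold \<open>\<tau>\<close> is \<open>1 - \<gamma>\<close> times the length of the spectrum above the smallest eigenvalue plus that
  eigenvalue; it is at least \<open>1 - \<gamma>\<close>, since the smallest eigenvalue is nonnegative.\<close>

lemma test_mat_rel_err_event:
  assumes m: "0 < m" and n: "1 < n" and \<gamma>: "0 \<le> \<gamma>" and \<delta>: "0 < \<delta>" "\<delta> < 1"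
  shows "\<exists>\<tau>\<ge>1 - \<gamma>. {b \<in> space (uniform_sphere n). \<gamma> \<le> rel_err m (test_mat n m \<delta>) b}
    = on_sphere n (ritz_le_funs n m (test_eig m \<delta>) \<tau>)"
proof -
  let ?A = "test_mat n m \<delta>"
  have n0: "0 < n" using n by simp
  interpret orthogonal_diagonalization n ?A "1\<^sub>m n" ?A by (rule test_mat_diagonalization[OF n0])
  have eig: "eig i = test_eig m \<delta> i" if "i < n" for i using that by (simp add: test_mat_def)
  have b: "0 \<le> test_eig m \<delta> i" "test_eig m \<delta> i \<le> 1" for i
    using test_eig_bounds[of \<delta> m i] \<delta> by auto
  have first: "eigval ?A 1 = 1"
    unfolding eigval_first
  proof (rule Max_eqI)
    show "1 \<in> eig ` {..<n}" using n0 eig[OF n0] by (auto simp: test_eig_def intro!: image_eqI[of _ _ 0])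
    show "y \<le> 1" if "y \<in> eig ` {..<n}" for y using that eig b by auto
  qed simp
  have last: "0 \<le> eigval ?A n" "eigval ?A n < 1"
  proof -
    have "eigval ?A n \<in> eig ` {..<n}" unfolding eigval_last using n0 by (intro Min_in) auto
    then show "0 \<le> eigval ?A n" using eig b by auto
    have "eigval ?A n \<le> eig 1" unfolding eigval_last using n by (intro Min_le) auto
    also have "\<dots> \<le> 1 - \<delta>" using eig[OF n] test_eig_bounds(3)[of \<delta> 1 m] \<delta> by simp
    finally show "eigval ?A n < 1" using \<delta> by simp
  qed
  define \<tau> where "\<tau> = 1 - \<gamma> * (1 - eigval ?A n)"
  have "\<gamma> * (1 - eigval ?A n) \<le> \<gamma> * 1" using \<gamma> last by (intro mult_left_mono) auto
  then have "1 - \<gamma> \<le> \<tau>" by (simp add: \<tau>_def)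
  moreover have "\<gamma> \<le> rel_err m ?A x \<longleftrightarrow> fun_of n x \<in> ritz_le_funs n m (test_eig m \<delta>) \<tau>"
    if x: "x \<in> unit_sphere_vec n" for x
  proof -
    have xc: "x \<in> carrier_vec n" and x1: "x \<bullet> x = 1" using x by (auto simp: unit_sphere_vec_def)
    then have x0: "x \<noteq> 0\<^sub>v n" by auto
    have nz: "fun_of n x \<in> nonzero_funs n"
      using x1 inner_eq_sqnorm[OF xc] fun_of_space by (simp add: nonzero_funs_def)
    have "coord x i = fun_of n x i" if "i < n" for i
      using that xc by (simp add: coord_def fun_of_def)
    then have form: "ritz_form n eig \<tau> P (coord x) = ritz_form n (test_eig m \<delta>) \<tau> P (fun_of n x)" for P
      unfolding ritz_form_def using eig by (intro sum.cong) auto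
    have "eigval ?A n < eigval ?A 1" using first last by simp
    from rel_err_ge_iff[OF xc x0 m this, of \<gamma>] show ?thesis
      unfolding first \<tau>_def[symmetric] ritz_le_funs_def form using nz by simp
  qed
  then have "{b \<in> space (uniform_sphere n). \<gamma> \<le> rel_err m ?A b}
      = on_sphere n (ritz_le_funs n m (test_eig m \<delta>) \<tau>)"
    unfolding space_uniform_sphere on_sphere_def by blast
  ultimately show ?thesis by blast
qed

text \<open>The indices of the eigenvalues that sit at the \<open>j\<close>-th node.\<close>

definition node_class :: "nat \<Rightarrow> nat \<Rightarrow> nat \<Rightarrow> nat set" where
  "node_class n m j = {i \<in> {1..<n}. i mod m = j}"

text \<open>The indices \<open>j + m (q + 1)\<close> with \<open>q < n div m - 1\<close> belong to the class.\<close>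

lemma card_node_class:
  assumes "j < m"
  shows "n div m - 1 \<le> card (node_class n m j)"
proof -
  let ?f = "\<lambda>q. j + m * (q + 1)"
  have "inj_on ?f {..<n div m - 1}" using assms by (auto simp: inj_on_def)
  then have "card (?f ` {..<n div m - 1}) = n div m - 1" by (simp add: card_image)
  moreover have "?f ` {..<n div m - 1} \<subseteq> node_class n m j"
  proof
    fix i assume "i \<in> ?f ` {..<n div m - 1}"
    then obtain q where q: "q < n div m - 1" "i = j + m * (q + 1)" by auto
    have "m * (q + 2) \<le> m * (n div m)" using q by (intro mult_left_mono) auto
    also have "\<dots> \<le> n" by simp
    finally have "i < n" using q(2) assms by (simp add: algebra_simps)
    moreover have "i mod m = j" unfolding q(2) mod_mult_self2 using assms by simp
    moreover have "1 \<le> i" using q(2) assms by simp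
    ultimately show "i \<in> node_class n m j" by (simp add: node_class_def)
  qed
  ultimately show ?thesis using card_mono[of "node_class n m j" "?f ` {..<n div m - 1}"] by (simp add: node_class_def)
qed

text \<open>Only the top eigenvalue contributes negatively, by at most \<open>\<gamma> a P(1)\<^sup>2\<close>. Interpolation and the
  Cauchy-Schwarz inequality give \<open>P(1)\<^sup>2 \<le> 4 m z\<^bsup>2m\<^esup> \<Sum> P(\<xi>\<^sub>j)\<^sup>2\<close>, while the nodes contribute at least
  \<open>(\<delta> - \<gamma>) s \<Sum> P(\<xi>\<^sub>j)\<^sup>2\<close>.\<close>

lemma ritz_form_test_nonneg:
  assumes m: "0 < m" and n: "0 < n" and \<gamma>: "0 \<le> \<gamma>" "\<gamma> < \<delta>" and \<delta>: "\<delta> < 1" and \<tau>: "1 - \<gamma> \<le> \<tau>"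
    and P: "degree P < m"
    and x0: "(x 0)\<^sup>2 \<le> a" and xs: "\<And>j. j < m \<Longrightarrow> s \<le> (\<Sum>i\<in>node_class n m j. (x i)\<^sup>2)" and s: "0 \<le> s"
    and cond: "4 * \<gamma> * a * real m * (((1 + sqrt \<delta>) / (1 - sqrt \<delta>)) ^ m)\<^sup>2 \<le> (\<delta> - \<gamma>) * s"
  shows "0 \<le> ritz_form n (test_eig m \<delta>) \<tau> P x"
proof -
  let ?d = "test_eig m \<delta>"
  define \<xi> where "\<xi> j = (1 - \<delta>) * (1 + cheb_node m j) / 2" for j
  define R where "R = (\<Sum>j<m. (poly P (\<xi> j))\<^sup>2)"
  define z where "z = (1 + sqrt \<delta>) / (1 - sqrt \<delta>)"
  have \<delta>0: "0 < \<delta>" using \<gamma> by simp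
  have R0: "0 \<le> R" unfolding R_def by (rule sum_nonneg) simp
  have P1: "(poly P 1)\<^sup>2 \<le> 4 * (z ^ m)\<^sup>2 * real m * R"
  proof -
    let ?c = "[:(1 - \<delta>) / 2, (1 - \<delta>) / 2:]"
    define Q where "Q = pcompose P ?c"
    have Q: "poly Q y = poly P ((1 - \<delta>) * (1 + y) / 2)" for y
      unfolding Q_def poly_pcompose by (rule arg_cong[of _ _ "poly P"]) (simp add: algebra_simps diff_divide_distrib add_divide_distrib)
    let ?y = "(1 + \<delta>) / (1 - \<delta>)"
    have "degree Q \<le> degree P * degree ?c" unfolding Q_def by (rule degree_pcompose_le)
    also have "\<dots> \<le> degree P * 1" by (intro mult_left_mono) auto
    finally have dQ: "degree Q < m" using P by simp
    have y1: "1 < ?y" using \<delta>0 \<delta> by simp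
    have "poly Q ?y = poly P 1"
    proof -
      have "1 + ?y = 2 / (1 - \<delta>)" using \<delta> by (simp add: add_divide_eq_iff)
      then have "(1 - \<delta>) * (1 + ?y) / 2 = 1" using \<delta> by simp
      then show ?thesis unfolding Q by simp
    qed
    then have "\<bar>poly P 1\<bar> \<le> 2 * poly (cheb m) ?y * (\<Sum>j<m. \<bar>poly P (\<xi> j)\<bar>)"
      using abs_poly_le_cheb[OF dQ y1] unfolding Q \<xi>_def by simp
    also have "\<dots> \<le> 2 * z ^ m * (\<Sum>j<m. \<bar>poly P (\<xi> j)\<bar>)"
      unfolding z_def using cheb_growth(2)[of \<delta> m] \<delta>0 \<delta>
      by (intro mult_right_mono mult_left_mono sum_nonneg) auto
    finally have "\<bar>poly P 1\<bar>\<^sup>2 \<le> (2 * z ^ m * (\<Sum>j<m. \<bar>poly P (\<xi> j)\<bar>))\<^sup>2" by (intro power_mono) auto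
    also have "\<dots> = 4 * (z ^ m)\<^sup>2 * (\<Sum>j<m. \<bar>poly P (\<xi> j)\<bar>)\<^sup>2" by (simp add: power_mult_distrib)
    also have "\<dots> \<le> 4 * (z ^ m)\<^sup>2 * (R * real m)"
    proof (rule mult_left_mono)
      show "(\<Sum>j<m. \<bar>poly P (\<xi> j)\<bar>)\<^sup>2 \<le> R * real m"
        using sum_squared_le_sum_of_squares[of "\<lambda>j. \<bar>poly P (\<xi> j)\<bar>" "{..<m}"] by (simp add: R_def)
    qed simp
    finally show ?thesis by (simp add: mult_ac)
  qed
  have others: "(\<delta> - \<gamma>) * s * R \<le> (\<Sum>i\<in>{1..<n}. (poly P (?d i) * x i)\<^sup>2 * (\<tau> - ?d i))"
  proof -
    let ?h = "\<lambda>i. (poly P (?d i) * x i)\<^sup>2 * (\<tau> - ?d i)"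
    have "(\<delta> - \<gamma>) * s * R = (\<Sum>j<m. (poly P (\<xi> j))\<^sup>2 * (\<delta> - \<gamma>) * s)"
      by (simp add: R_def sum_distrib_left mult_ac)
    also have "\<dots> \<le> (\<Sum>j<m. (poly P (\<xi> j))\<^sup>2 * (\<delta> - \<gamma>) * (\<Sum>i\<in>node_class n m j. (x i)\<^sup>2))"
      by (intro sum_mono mult_left_mono xs) (use \<gamma> in auto)
    also have "\<dots> = (\<Sum>j<m. \<Sum>i\<in>node_class n m j. (poly P (\<xi> j))\<^sup>2 * (\<delta> - \<gamma>) * (x i)\<^sup>2)"
      by (simp add: sum_distrib_left)
    also have "\<dots> \<le> (\<Sum>j<m. \<Sum>i\<in>node_class n m j. ?h i)"
    proof (intro sum_mono)
      fix j i assume "i \<in> node_class n m j"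
      then have i: "0 < i" "i mod m = j" by (auto simp: node_class_def)
      then have di: "?d i = \<xi> j" by (simp add: test_eig_def \<xi>_def)
      have "\<delta> - \<gamma> \<le> \<tau> - ?d i" using test_eig_bounds(3)[of \<delta> i m] i \<tau> \<delta>0 \<delta> by simp
      then have "(poly P (\<xi> j) * x i)\<^sup>2 * (\<delta> - \<gamma>) \<le> (poly P (\<xi> j) * x i)\<^sup>2 * (\<tau> - ?d i)"
        by (rule mult_left_mono) simp
      then show "(poly P (\<xi> j))\<^sup>2 * (\<delta> - \<gamma>) * (x i)\<^sup>2 \<le> ?h i"
        unfolding di by (simp add: power_mult_distrib mult_ac)
    qed
    also have "\<dots> = (\<Sum>i\<in>{1..<n}. ?h i)"
      unfolding node_class_def by (rule sum.group) (use m in auto)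
    finally show ?thesis .
  qed
  have first: "- \<gamma> * a * (poly P 1)\<^sup>2 \<le> (poly P (?d 0) * x 0)\<^sup>2 * (\<tau> - ?d 0)"
  proof -
    have d0: "?d 0 = 1" by (simp add: test_eig_def)
    have "\<gamma> * ((poly P 1)\<^sup>2 * (x 0)\<^sup>2) \<le> \<gamma> * ((poly P 1)\<^sup>2 * a)"
      using \<gamma> x0 by (intro mult_left_mono) auto
    moreover have "(poly P 1 * x 0)\<^sup>2 * (- \<gamma>) \<le> (poly P 1 * x 0)\<^sup>2 * (\<tau> - 1)"
      using \<tau> by (intro mult_left_mono) auto
    ultimately show ?thesis unfolding d0 by (simp add: power_mult_distrib mult_ac)
  qed
  have a0: "0 \<le> a" using x0 by (meson order_trans zero_le_power2)
  have "\<gamma> * a * (poly P 1)\<^sup>2 \<le> \<gamma> * a * (4 * (z ^ m)\<^sup>2 * real m * R)"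
    using P1 \<gamma> a0 by (intro mult_left_mono) auto
  also have "\<dots> = (4 * \<gamma> * a * real m * (z ^ m)\<^sup>2) * R" by (simp add: mult_ac)
  also have "\<dots> \<le> ((\<delta> - \<gamma>) * s) * R" using cond R0 unfolding z_def by (rule mult_right_mono)
  finally have key: "\<gamma> * a * (poly P 1)\<^sup>2 \<le> (\<delta> - \<gamma>) * s * R" .
  have "ritz_form n ?d \<tau> P x = (poly P (?d 0) * x 0)\<^sup>2 * (\<tau> - ?d 0)
      + (\<Sum>i\<in>{1..<n}. (poly P (?d i) * x i)\<^sup>2 * (\<tau> - ?d i))"
    unfolding ritz_form_def lessThan_atLeast0 using n by (subst sum.atLeast_Suc_lessThan) auto
  then show ?thesis using first others key by linarith
qed

lemma real_less_nat_div_add_1: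
  assumes "0 < m"
  shows "real n / real m < real (n div m) + 1"
proof -
  have "n < (n div m + 1) * m" using assms div_mult_mod_eq[of n m] mod_less_divisor[OF assms, of n] by (simp only: distrib_right)
  then have "real n < real ((n div m + 1) * m)" by (simp only: of_nat_less_iff)
  then have "real n < (real (n div m) + 1) * real m" by (simp add: algebra_simps)
  then show ?thesis using assms by (simp add: divide_less_eq)
qed

text \<open>The first term bounds the probability that the top coordinate is too large, the second that some
  node carries too little mass; both are \<open>o(1/n)\<close>.\<close>

definition fail_prob :: "nat \<Rightarrow> real" where
  "fail_prob n = 2 / (real n)\<^sup>2 + sqrt (real n) * exp (1 / 2 - sqrt (real n) / 4)"

text \<open>The exponent \<open>a = 1/4\<close> in the tail bound gives probability at most \<open>2 / n\<^sup>2\<close> for a large top coordinate.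
  For a node with \<open>N\<close> coordinates, \<open>a = -3/2\<close> gives \<open>exp (3N/8) 2\<^bsup>-N\<^esup> \<le> exp (-N/4)\<close>. The union over \<open>m \<le> sqrt n\<close>
  nodes costs a factor \<open>sqrt n\<close>.\<close>

lemma gauss_good_event:
  assumes m: "0 < m" and mn: "(real m)\<^sup>2 \<le> real n" and n: "1 < n"
  defines "N \<equiv> n div m - 1"
  shows "1 - fail_prob n \<le> measure (gauss n) {x \<in> space (gauss n). (x 0)\<^sup>2 \<le> 8 * ln (real n) \<and>
    (\<forall>j<m. real N / 4 \<le> (\<Sum>i\<in>node_class n m j. (x i)\<^sup>2))}"
proof -
  let ?G = "{x \<in> space (gauss n). (x 0)\<^sup>2 \<le> 8 * ln (real n) \<and>
    (\<forall>j<m. real N / 4 \<le> (\<Sum>i\<in>node_class n m j. (x i)\<^sup>2))}"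
  let ?Z = "{x \<in> space (gauss n). 1 / 4 * (8 * ln (real n)) \<le> 1 / 4 * (\<Sum>i\<in>{0}. (x i)\<^sup>2)}"
  let ?B = "\<lambda>j. {x \<in> space (gauss n). - (3 / 2) * (real N / 4) \<le> - (3 / 2) * (\<Sum>i\<in>node_class n m j. (x i)\<^sup>2)}"
  have sub: "node_class n m j \<subseteq> {..<n}" for j by (auto simp: node_class_def)
  have sm: "(\<lambda>x. \<Sum>i\<in>J. (x i)\<^sup>2) \<in> borel_measurable (gauss n)" if "J \<subseteq> {..<n}" for J
    using that by (intro borel_measurable_sum borel_measurable_power gauss_component_measurable) auto
  have sm0: "(\<lambda>x. (x 0)\<^sup>2) \<in> borel_measurable (gauss n)"
    using n by (intro borel_measurable_power gauss_component_measurable) auto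
  have B0s: "?Z \<in> sets (gauss n)"
    by (rule borel_measurable_le) (use sm[of "{0}"] n in auto)
  have Bs: "?B j \<in> sets (gauss n)" for j
    by (rule borel_measurable_le) (use sm[OF sub[of j]] in auto)
  have Gs: "?G \<in> sets (gauss n)"
  proof -
    have 1: "{x \<in> space (gauss n). (x 0)\<^sup>2 \<le> 8 * ln (real n)} \<in> sets (gauss n)"
      by (rule borel_measurable_le[OF sm0]) simp
    have 2: "{x \<in> space (gauss n). real N / 4 \<le> (\<Sum>i\<in>node_class n m j. (x i)\<^sup>2)} \<in> sets (gauss n)" for j
      by (rule borel_measurable_le[OF _ sm[OF sub]]) simp
    have "{x \<in> space (gauss n). \<forall>j\<in>{..<m}. real N / 4 \<le> (\<Sum>i\<in>node_class n m j. (x i)\<^sup>2)} \<in> sets (gauss n)"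
      by (rule sets.sets_Collect_finite_All[OF 2]) simp
    from sets.Int[OF 1 this] show ?thesis by (rule back_subst[of "\<lambda>X. X \<in> sets (gauss n)"]) auto
  qed
  have p0: "measure (gauss n) ?Z \<le> 2 / (real n)\<^sup>2"
  proof -
    have "measure (gauss n) ?Z \<le> exp (- (1 / 4) * (8 * ln (real n))) * (1 / sqrt (1 - 2 * (1 / 4))) ^ card {0 :: nat}"
      by (rule gauss_tail) (use n in auto)
    also have "exp (- (1 / 4) * (8 * ln (real n))) = 1 / (real n)\<^sup>2"
    proof -
      have "- (1 / 4) * (8 * ln (real n)) = - (2 * ln (real n))" by simp
      moreover have "exp (2 * ln (real n)) = (real n)\<^sup>2" using n by (simp add: exp_double)
      ultimately show ?thesis by (simp add: exp_minus inverse_eq_divide)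
    qed
    also have "(1 / sqrt (1 - 2 * (1 / 4))) ^ card {0 :: nat} = sqrt 2" by (simp add: real_sqrt_divide)
    also have "1 / (real n)\<^sup>2 * sqrt 2 \<le> 1 / (real n)\<^sup>2 * 2"
      by (intro mult_left_mono real_le_lsqrt) auto
    finally show ?thesis by simp
  qed
  have pj: "measure (gauss n) (?B j) \<le> exp (- real N / 4)" if j: "j < m" for j
  proof -
    have "measure (gauss n) (?B j) \<le> exp (- (- (3 / 2)) * (real N / 4)) * (1 / sqrt (1 - 2 * (- (3 / 2)))) ^ card (node_class n m j)"
      by (rule gauss_tail[OF _ sub]) simp
    also have "1 / sqrt (1 - 2 * (- (3 / 2))) = (1 / 2 :: real)" by simp
    also have "(1 / 2 :: real) ^ card (node_class n m j) \<le> (1 / 2) ^ N"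
      unfolding N_def by (rule power_decreasing[OF card_node_class[OF j]]) auto
    also have "(1 / 2 :: real) ^ N = exp (- ln 2 * real N)"
      by (simp add: exp_of_nat2_mult exp_minus inverse_eq_divide power_one_over)
    also have "exp (- (- (3 / 2)) * (real N / 4)) * exp (- ln 2 * real N) = exp ((3 / 8 - ln 2) * real N)"
      by (simp add: exp_add[symmetric] algebra_simps)
    also have "\<dots> \<le> exp (- (1 / 4) * real N)"
    proof -
      have "3 / 8 - ln 2 \<le> - (1 / 4 :: real)" using ln2_ge_two_thirds by linarith
      then have "(3 / 8 - ln 2) * real N \<le> - (1 / 4) * real N" by (rule mult_right_mono) simp
      then show ?thesis by simp
    qed
    finally show ?thesis by (simp add: mult_left_mono)
  qed
  have "space (gauss n) - ?G \<subseteq> ?Z \<union> (\<Union>j\<in>{..<m}. ?B j)"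
  proof
    fix x assume x: "x \<in> space (gauss n) - ?G"
    then have xs: "x \<in> space (gauss n)" by simp
    show "x \<in> ?Z \<union> (\<Union>j\<in>{..<m}. ?B j)"
    proof (cases "(x 0)\<^sup>2 \<le> 8 * ln (real n)")
      case True
      then obtain j where "j < m" "(\<Sum>i\<in>node_class n m j. (x i)\<^sup>2) < real N / 4" using x by force
      then have "x \<in> ?B j" "j \<in> {..<m}" using xs by auto
      then show ?thesis by blast
    next
      case False
      then have "x \<in> ?Z" using xs by simp
      then show ?thesis by blast
    qed
  qed
  then have "measure (gauss n) (space (gauss n) - ?G) \<le> measure (gauss n) (?Z \<union> (\<Union>j\<in>{..<m}. ?B j))"
    by (intro gauss.finite_measure_mono) (use B0s Bs in auto)
  also have "\<dots> \<le> measure (gauss n) ?Z + measure (gauss n) (\<Union>j\<in>{..<m}. ?B j)"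
    by (rule measure_Un_le) (use B0s Bs in auto)
  also have "measure (gauss n) (\<Union>j\<in>{..<m}. ?B j) \<le> (\<Sum>j<m. measure (gauss n) (?B j))"
    by (rule measure_UNION_le) (use Bs in auto)
  also have "\<dots> \<le> (\<Sum>j<m. exp (- real N / 4))" by (intro sum_mono pj) simp
  also have "\<dots> = real m * exp (- real N / 4)" by simp
  also have "measure (gauss n) ?Z + real m * exp (- real N / 4) \<le> fail_prob n"
    unfolding fail_prob_def
  proof (intro add_mono p0 mult_mono)
    show ms: "real m \<le> sqrt (real n)" using mn by (rule real_le_rsqrt)
    have "sqrt (real n) * real m \<le> sqrt (real n) * sqrt (real n)" using ms by (intro mult_left_mono) auto
    then have "sqrt (real n) \<le> real n / real m" using m by (simp add: le_divide_eq)
    also have "real n / real m \<le> real N + 2"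
    proof -
      have "real n / real m < real (n div m) + 1"
        by (rule real_less_nat_div_add_1[OF m])
      then show ?thesis unfolding N_def by simp
    qed
    finally show "exp (- real N / 4) \<le> exp (1 / 2 - sqrt (real n) / 4)" by simp
  qed auto
  finally have "measure (gauss n) (space (gauss n) - ?G) \<le> fail_prob n" by simp
  then show ?thesis using gauss.prob_compl[OF Gs] by simp
qed

text \<open>With \<open>N \<ge> n / (2m)\<close> the hypothesis is the nonnegativity condition for the top coordinate bound
  \<open>8 ln n\<close> and the node mass \<open>N/4\<close>.\<close>

theorem lower_bound:
  assumes m: "0 < m" and mn: "(real m)\<^sup>2 \<le> real n" "4 * m \<le> n"
    and \<gamma>: "0 \<le> \<gamma>" "\<gamma> < \<delta>" and \<delta>: "\<delta> < 1"
    and cond: "256 * \<gamma> * (real m)\<^sup>2 * ln (real n) * (((1 + sqrt \<delta>) / (1 - sqrt \<delta>)) ^ m)\<^sup>2 \<le> (\<delta> - \<gamma>) * real n"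
  shows "1 - fail_prob n \<le> (SUP A \<in> sym_mats n. \<P>(b in uniform_sphere n. \<gamma> \<le> rel_err m A b))"
proof -
  let ?M = "uniform_sphere n"
  have n: "1 < n" "0 < n" using m mn by auto
  have \<delta>0: "0 < \<delta>" using \<gamma> by simp
  interpret US: prob_space ?M by (rule prob_space_uniform_sphere[OF n(2)])
  obtain \<tau> where \<tau>: "1 - \<gamma> \<le> \<tau>" and ev: "{b \<in> space ?M. \<gamma> \<le> rel_err m (test_mat n m \<delta>) b}
    = on_sphere n (ritz_le_funs n m (test_eig m \<delta>) \<tau>)"
    using test_mat_rel_err_event[OF m n(1) \<gamma>(1) \<delta>0 \<delta>] by blast
  let ?S = "ritz_le_funs n m (test_eig m \<delta>) \<tau>"
  have S: "cone n ?S" by (rule cone_ritz_le_funs[OF m])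
  define N where "N = n div m - 1"
  have N2: "real n / (2 * real m) \<le> real N" "1 \<le> N"
  proof -
    have "4 \<le> n div m" using mn(2) m by (simp add: less_eq_div_iff_mult_less_eq)
    then show "1 \<le> N" by (simp add: N_def)
    have "real n / real m < real (n div m) + 1"
      by (rule real_less_nat_div_add_1[OF m])
    moreover have "real (n div m) = real N + 1" using \<open>4 \<le> n div m\<close> by (simp add: N_def)
    ultimately have "real n / real m \<le> real N + 2" by simp
    moreover have "4 \<le> real n / real m" using mn(2) m by (simp add: le_divide_eq)
    moreover have "real n / (2 * real m) = real n / real m / 2" by simp
    ultimately show "real n / (2 * real m) \<le> real N" by linarith
  qed
  let ?G = "{x \<in> space (gauss n). (x 0)\<^sup>2 \<le> 8 * ln (real n) \<and>
    (\<forall>j<m. real N / 4 \<le> (\<Sum>i\<in>node_class n m j. (x i)\<^sup>2))}"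
  let ?z = "(1 + sqrt \<delta>) / (1 - sqrt \<delta>)"
  have c: "4 * \<gamma> * (8 * ln (real n)) * real m * (?z ^ m)\<^sup>2 \<le> (\<delta> - \<gamma>) * (real N / 4)"
  proof -
    define w where "w = (?z ^ m)\<^sup>2"
    have "256 * \<gamma> * (real m)\<^sup>2 * ln (real n) * w = (4 * \<gamma> * (8 * ln (real n)) * real m * w) * (8 * real m)"
      unfolding power2_eq_square[of "real m"] by (simp only: mult_ac)
    then have "(4 * \<gamma> * (8 * ln (real n)) * real m * w) * (8 * real m) \<le> (\<delta> - \<gamma>) * real n"
      using cond unfolding w_def by linarith
    then have "4 * \<gamma> * (8 * ln (real n)) * real m * w \<le> (\<delta> - \<gamma>) * real n / (8 * real m)"
      using m by (subst pos_le_divide_eq) auto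
    also have "\<dots> = (\<delta> - \<gamma>) * (real n / (2 * real m) / 4)" by simp
    also have "\<dots> \<le> (\<delta> - \<gamma>) * (real N / 4)"
      using N2 \<gamma> by (intro mult_left_mono divide_right_mono) auto
    finally show ?thesis unfolding w_def .
  qed
  have "?G \<subseteq> ?S"
  proof
    fix x assume x: "x \<in> ?G"
    have "0 < sqnorm n x"
    proof -
      have "0 < real N / 4" using N2 by simp
      also have "\<dots> \<le> (\<Sum>i\<in>node_class n m 0. (x i)\<^sup>2)" using x m by simp
      also have "\<dots> \<le> sqnorm n x" unfolding sqnorm_def by (rule sum_mono2) (auto simp: node_class_def)
      finally show ?thesis .
    qed
    moreover have "0 \<le> ritz_form n (test_eig m \<delta>) \<tau> P x" if "degree P < m" for P
      by (rule ritz_form_test_nonneg[OF m n(2) \<gamma> \<delta> \<tau> that, of x "8 * ln (real n)" "real N / 4"])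
        (use x c in auto)
    ultimately show "x \<in> ?S" using x by (simp add: ritz_le_funs_def nonzero_funs_def space_gauss)
  qed
  then have "measure (gauss n) ?G \<le> measure (gauss n) ?S"
    using cone_sets[OF S] by (intro gauss.finite_measure_mono) (auto simp: sets_gauss)
  moreover have "measure ?M {b \<in> space ?M. \<gamma> \<le> rel_err m (test_mat n m \<delta>) b} = measure (gauss n) ?S"
    unfolding ev measure_def uniform_sphere_eq_gauss[OF n(2) S] ..
  moreover have "1 - fail_prob n \<le> measure (gauss n) ?G"
    unfolding N_def by (rule gauss_good_event[OF m mn(1) n(1)])
  ultimately have "1 - fail_prob n \<le> measure ?M {b \<in> space ?M. \<gamma> \<le> rel_err m (test_mat n m \<delta>) b}" by simp
  also have "\<dots> \<le> (SUP A \<in> sym_mats n. \<P>(b in ?M. \<gamma> \<le> rel_err m A b))"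
    by (rule cSUP_upper[OF test_mat_sym]) (auto intro!: bdd_aboveI2[of _ _ 1] US.prob_le_1)
  finally show ?thesis .
qed

section \<open>The asymptotic regimes\<close>

lemma fail_prob_tendsto: "(\<lambda>n. real n * fail_prob n) \<longlonglongrightarrow> 0"
  unfolding fail_prob_def by real_asymp

text \<open>For \<open>r = sqrt \<delta> \<le> 1/2\<close> one has \<open>(1 + r) / (1 - r) \<le> 1 + 4r \<le> exp (4r)\<close>.\<close>

lemma joukowski_sqrt_le_exp:
  assumes "0 \<le> \<delta>" "\<delta> \<le> 1 / 4"
  shows "(((1 + sqrt \<delta>) / (1 - sqrt \<delta>)) ^ m)\<^sup>2 \<le> exp (8 * real m * sqrt \<delta>)"
proof -
  define r where "r = sqrt \<delta>"
  have r: "0 \<le> r" "r \<le> 1 / 2"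
  proof -
    show "0 \<le> r" using assms by (simp add: r_def)
    have "r \<le> sqrt (1 / 4)" unfolding r_def using assms(2) by (rule real_sqrt_le_mono)
    then show "r \<le> 1 / 2" by (simp add: real_sqrt_divide)
  qed
  have "r * r \<le> 1 / 2 * r" using r by (intro mult_right_mono) auto
  then have "1 + r \<le> (1 + 4 * r) * (1 - r)" by (simp add: algebra_simps)
  then have "(1 + r) / (1 - r) \<le> 1 + 4 * r" using r by (simp add: divide_le_eq)
  also have "\<dots> \<le> exp (4 * r)" by (rule exp_ge_add_one_self)
  finally have "((1 + r) / (1 - r)) ^ m \<le> exp (4 * r) ^ m" using r by (intro power_mono) auto
  then have "(((1 + r) / (1 - r)) ^ m)\<^sup>2 \<le> (exp (4 * r) ^ m)\<^sup>2" by (rule power_mono) (use r in simp)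
  also have "(exp (4 * r) ^ m)\<^sup>2 = exp (8 * real m * r)"
    by (simp add: exp_of_nat_mult[symmetric] exp_double[symmetric] mult_ac)
  finally show ?thesis by (simp add: r_def)
qed

text \<open>The case \<open>\<delta> = 2 \<gamma>\<close>, where the factor \<open>\<gamma>\<close> cancels from the condition.\<close>

lemma lower_bound_small:
  assumes m: "1 \<le> m" and \<gamma>: "0 < \<gamma>" "\<gamma> \<le> 1 / 8" and ln: "1 \<le> ln (real n)"
    and cond: "256 * (real m)\<^sup>2 * ln (real n) * exp (8 * real m * sqrt (2 * \<gamma>)) \<le> real n"
  shows "1 - fail_prob n \<le> (SUP A \<in> sym_mats n. \<P>(b in uniform_sphere n. \<gamma> \<le> rel_err m A b))"
proof (rule lower_bound[where \<delta> = "2 * \<gamma>"])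
  define e where "e = exp (8 * real m * sqrt (2 * \<gamma>))"
  have "1 \<le> e" using \<gamma> by (simp add: e_def)
  then have "256 * (real m)\<^sup>2 * 1 * 1 \<le> 256 * (real m)\<^sup>2 * ln (real n) * e"
    using ln by (intro mult_mono) auto
  then have m2: "256 * (real m)\<^sup>2 \<le> real n" using cond by (simp add: e_def)
  then show "(real m)\<^sup>2 \<le> real n" using zero_le_power2[of "real m"] by linarith
  have "real m * 1 \<le> real m * real m" using m by (intro mult_left_mono) auto
  then have "real m \<le> (real m)\<^sup>2" by (simp add: power2_eq_square)
  then have "4 * real m \<le> real n" using m2 by linarith
  then show "4 * m \<le> n" by linarith
  let ?w = "(((1 + sqrt (2 * \<gamma>)) / (1 - sqrt (2 * \<gamma>))) ^ m)\<^sup>2"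
  have "256 * (real m)\<^sup>2 * ln (real n) * ?w \<le> 256 * (real m)\<^sup>2 * ln (real n) * e"
    unfolding e_def using \<gamma> ln by (intro mult_left_mono joukowski_sqrt_le_exp) auto
  also have "\<dots> \<le> real n" using cond by (simp add: e_def)
  finally have "\<gamma> * (256 * (real m)\<^sup>2 * ln (real n) * ?w) \<le> \<gamma> * real n"
    using \<gamma> by (intro mult_left_mono) auto
  then show "256 * \<gamma> * (real m)\<^sup>2 * ln (real n) * ?w \<le> (2 * \<gamma> - \<gamma>) * real n"
    by (simp add: mult_ac)
qed (use m \<gamma> in auto)

text \<open>The case \<open>\<delta> = 1 - \<epsilon>/2\<close>, where \<open>z = (1 + r)\<^sup>2 / (1 - r\<^sup>2) \<le> 8/\<epsilon>\<close> for \<open>r = sqrt \<delta>\<close>.\<close>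

lemma lower_bound_near_one:
  assumes m: "1 \<le> m" and \<epsilon>: "0 < \<epsilon>" "\<epsilon> \<le> 1" and mn: "(real m)\<^sup>2 \<le> real n" "4 * m \<le> n"
    and cond: "512 * (real m)\<^sup>2 * ln (real n) * ((8 / \<epsilon>) ^ m)\<^sup>2 * (1 / \<epsilon>) \<le> real n"
  shows "1 - fail_prob n \<le> (SUP A \<in> sym_mats n. \<P>(b in uniform_sphere n. 1 - \<epsilon> \<le> rel_err m A b))"
proof (rule lower_bound[where \<delta> = "1 - \<epsilon> / 2", OF _ mn])
  let ?r = "sqrt (1 - \<epsilon> / 2)"
  have n: "0 < n" using mn m by auto
  have r: "0 \<le> ?r" "?r < 1" using \<epsilon> by auto
  have "(1 - ?r) * (1 + ?r) = 1 - ?r\<^sup>2" by (simp add: algebra_simps power2_eq_square)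
  then have d: "(1 - ?r) * (1 + ?r) = \<epsilon> / 2" using \<epsilon> by simp
  have "(1 - ?r) * (1 + ?r) \<le> (1 - ?r) * 2" using r by (intro mult_left_mono) auto
  then have r1: "\<epsilon> / 4 \<le> 1 - ?r" using d by simp
  have "(1 + ?r) / (1 - ?r) \<le> 2 / (\<epsilon> / 4)" using r r1 \<epsilon> by (intro frac_le) auto
  then have "((1 + ?r) / (1 - ?r)) ^ m \<le> (8 / \<epsilon>) ^ m" using r by (intro power_mono) auto
  then have "(((1 + ?r) / (1 - ?r)) ^ m)\<^sup>2 \<le> ((8 / \<epsilon>) ^ m)\<^sup>2" by (rule power_mono) (use r in simp)
  moreover define w where "w = (((1 + ?r) / (1 - ?r)) ^ m)\<^sup>2"
  ultimately have w: "w \<le> ((8 / \<epsilon>) ^ m)\<^sup>2" by simp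
  have w0: "0 \<le> w" by (simp add: w_def)
  have ln0: "0 \<le> ln (real n)" using n by simp
  have "256 * (1 - \<epsilon>) * (real m)\<^sup>2 * ln (real n) * w \<le> 256 * 1 * (real m)\<^sup>2 * ln (real n) * ((8 / \<epsilon>) ^ m)\<^sup>2"
    using \<epsilon> w w0 ln0 by (intro mult_mono) auto
  also have "\<dots> \<le> \<epsilon> / 2 * real n"
  proof -
    have "\<epsilon> / 2 * (512 * (real m)\<^sup>2 * ln (real n) * ((8 / \<epsilon>) ^ m)\<^sup>2 * (1 / \<epsilon>)) \<le> \<epsilon> / 2 * real n"
      using cond \<epsilon> by (intro mult_left_mono) auto
    then show ?thesis using \<epsilon> by (simp add: mult_ac)
  qed
  finally show "256 * (1 - \<epsilon>) * (real m)\<^sup>2 * ln (real n) * (((1 + ?r) / (1 - ?r)) ^ m)\<^sup>2 \<le> (1 - \<epsilon> / 2 - (1 - \<epsilon>)) * real n"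
    by (simp add: w_def)
qed (use m \<epsilon> in auto)

text \<open>With \<open>l = ln n\<close>, the factor \<open>(8/\<epsilon>)\<^bsup>2m\<^esup>\<close> has logarithm \<open>O(m) + 2 sqrt (m l)\<close>, which is \<open>o(l)\<close>, and
  \<open>1/\<epsilon> \<le> exp (sqrt l)\<close>. So the condition compares a power of \<open>n\<close> below \<open>1\<close> with \<open>n\<close>.\<close>

lemma lower_bound_sublogarithmic:
  fixes m :: "nat \<Rightarrow> nat"
  assumes m1: "\<And>n. 1 \<le> n \<Longrightarrow> 1 \<le> m n" and mo: "(\<lambda>n. real (m n)) \<in> o(\<lambda>n. ln (real n))"
  defines "\<epsilon> \<equiv> \<lambda>n. exp (- sqrt (ln (real n) / real (m n)))"
  shows "\<epsilon> \<longlonglongrightarrow> 0"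
    "\<forall>\<^sub>F n in sequentially. 1 - fail_prob n \<le>
      (SUP A \<in> sym_mats n. \<P>(b in uniform_sphere n. 1 - \<epsilon> n \<le> rel_err (m n) A b))"
proof -
  have ev1: "\<forall>\<^sub>F n in sequentially. (1 :: nat) \<le> n" by (rule eventually_ge_at_top)
  have evln: "\<forall>\<^sub>F n in sequentially. 16 \<le> ln (real n)" by real_asymp
  have "filterlim (\<lambda>n. inverse (real (m n) / ln (real n))) at_top sequentially"
  proof (rule filterlim_inverse_at_top)
    show "(\<lambda>n. real (m n) / ln (real n)) \<longlonglongrightarrow> 0" by (rule smalloD_tendsto[OF mo])
    show "\<forall>\<^sub>F n in sequentially. 0 < real (m n) / ln (real n)"
      using ev1 evln
    proof eventually_elim
      case (elim n)
      then have "0 < real (m n)" "0 < ln (real n)" using m1[of n] by linarith+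
      then show ?case by (rule divide_pos_pos)
    qed
  qed
  then have "filterlim (\<lambda>n. ln (real n) / real (m n)) at_top sequentially" by simp
  then have "filterlim (\<lambda>n. sqrt (ln (real n) / real (m n))) at_top sequentially"
    by (rule filterlim_compose[OF sqrt_at_top])
  then have "filterlim (\<lambda>n. - sqrt (ln (real n) / real (m n))) at_bot sequentially"
    by (simp add: filterlim_uminus_at_top)
  then show "\<epsilon> \<longlonglongrightarrow> 0" unfolding \<epsilon>_def by (rule filterlim_compose[OF exp_at_bot])
  have ev: "\<forall>\<^sub>F n in sequentially. norm (real (m n)) \<le> 1 / 100 * norm (ln (real n))"
    by (rule landau_o.smallD[OF mo]) simp
  have evA: "\<forall>\<^sub>F n in sequentially. (ln (real n))\<^sup>2 \<le> real n" by real_asymp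
  have evB: "\<forall>\<^sub>F n in sequentially. 4 * ln (real n) \<le> real n" by real_asymp
  have evC: "\<forall>\<^sub>F n in sequentially. 512 * (ln (real n))\<^sup>2 * ln (real n) * exp (1 / 2 * ln (real n)) * exp (1 / 4 * ln (real n)) \<le> real n"
    by real_asymp
  show "\<forall>\<^sub>F n in sequentially. 1 - fail_prob n \<le>
      (SUP A \<in> sym_mats n. \<P>(b in uniform_sphere n. 1 - \<epsilon> n \<le> rel_err (m n) A b))"
    using ev1 evln ev evA evB evC
  proof eventually_elim
    case (elim n)
    define l where "l = ln (real n)"
    define k where "k = real (m n)"
    have l: "16 \<le> l" using elim by (simp add: l_def)
    have k: "1 \<le> k" "k \<le> l / 100" using m1[of n] elim by (auto simp: k_def l_def)
    have kl: "k \<le> l" using k l by linarith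
    have k2: "k\<^sup>2 \<le> l\<^sup>2" using k kl by (intro power_mono) auto
    have eps: "0 < \<epsilon> n" "\<epsilon> n \<le> 1" using l k by (auto simp: \<epsilon>_def l_def k_def)
    have inv: "1 / \<epsilon> n = exp (sqrt (l / k))" by (simp add: \<epsilon>_def l_def k_def exp_minus inverse_eq_divide)
    have "l / k \<le> l" using l k by (simp add: divide_le_eq)
    also have "l \<le> (l / 4)\<^sup>2" using mult_right_mono[of 16 l l] l by (simp add: power2_eq_square)
    finally have "sqrt (l / k) \<le> l / 4" using l by (intro real_le_lsqrt) auto
    then have inv_le: "1 / \<epsilon> n \<le> exp (1 / 4 * l)" unfolding inv by simp
    have w_le: "((8 / \<epsilon> n) ^ m n)\<^sup>2 \<le> exp (1 / 2 * l)"
    proof -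
      have e8: "8 \<le> exp (7 :: real)" using exp_ge_add_one_self[of "7 :: real"] by simp
      have "8 / \<epsilon> n = 8 * (1 / \<epsilon> n)" by simp
      also have "\<dots> \<le> exp (7 + sqrt (l / k))"
        unfolding inv exp_add by (rule mult_right_mono[OF e8]) simp
      finally have "8 / \<epsilon> n \<le> exp (7 + sqrt (l / k))" .
      then have "(8 / \<epsilon> n) ^ m n \<le> exp (7 + sqrt (l / k)) ^ m n" using eps by (intro power_mono) auto
      then have "((8 / \<epsilon> n) ^ m n)\<^sup>2 \<le> (exp (7 + sqrt (l / k)) ^ m n)\<^sup>2" by (rule power_mono) (use eps in simp)
      also have "\<dots> = exp (2 * (k * (7 + sqrt (l / k))))"
        by (simp add: k_def exp_of_nat_mult[symmetric] exp_double[symmetric])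
      also have "\<dots> \<le> exp (1 / 2 * l)"
      proof -
        have "k * sqrt (l / k) = sqrt (k * l)"
        proof -
          have "k * sqrt (l / k) = sqrt (k\<^sup>2) * sqrt (l / k)" using k by simp
          also have "\<dots> = sqrt (k\<^sup>2 * (l / k))" by (rule real_sqrt_mult[symmetric])
          also have "k\<^sup>2 * (l / k) = k * l" using k by (simp add: power2_eq_square)
          finally show ?thesis .
        qed
        also have "\<dots> \<le> l / 10"
        proof (rule real_le_lsqrt)
          have "k * l \<le> l / 100 * l" using k l by (intro mult_right_mono) auto
          then show "k * l \<le> (l / 10)\<^sup>2" by (simp add: power2_eq_square)
        qed (use l k in auto)
        finally have "2 * (k * (7 + sqrt (l / k))) \<le> 1 / 2 * l" using k l by (simp add: algebra_simps)
        then show ?thesis by simp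
      qed
      finally show ?thesis .
    qed
    show ?case
    proof (rule lower_bound_near_one)
      show "1 \<le> m n" using m1 elim by simp
      have "l\<^sup>2 \<le> real n" using elim by (simp only: l_def)
      from order_trans[OF k2 this] show "(real (m n))\<^sup>2 \<le> real n" by (simp only: k_def)
      have "4 * k \<le> real n" using kl elim by (simp add: l_def)
      then show "4 * m n \<le> n" unfolding k_def by linarith
      have "512 * k\<^sup>2 * l * ((8 / \<epsilon> n) ^ m n)\<^sup>2 * (1 / \<epsilon> n) \<le> 512 * l\<^sup>2 * l * exp (1 / 2 * l) * exp (1 / 4 * l)"
        using k2 l w_le inv_le eps by (intro mult_mono) auto
      also have "\<dots> \<le> real n" using elim by (simp add: l_def)
      finally show "512 * (real (m n))\<^sup>2 * ln (real n) * ((8 / \<epsilon> n) ^ m n)\<^sup>2 * (1 / \<epsilon> n) \<le> real n"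
        by (simp add: k_def l_def)
    qed (use eps in auto)
  qed
qed

text \<open>Here \<open>8 m sqrt (2 \<gamma>)\<close> is at most \<open>2 ln n / ln ln n\<close>, so that the exponential is \<open>n\<^bsup>o(1)\<^esup>\<close>, while \<open>m\<close> is of
  the order of \<open>ln n\<close>.\<close>

lemma lower_bound_logarithmic:
  fixes m :: "nat \<Rightarrow> nat"
  assumes m1: "\<And>n. 1 \<le> n \<Longrightarrow> 1 \<le> m n" and mt: "(\<lambda>n. real (m n)) \<in> \<Theta>(\<lambda>n. ln (real n))"
  shows "\<forall>\<^sub>F n in sequentially. 1 - fail_prob n \<le>
      (SUP A \<in> sym_mats n. \<P>(b in uniform_sphere n.
        0.015 * (ln (real n))\<^sup>2 / ((real (m n))\<^sup>2 * (ln (ln (real n)))\<^sup>2) \<le> rel_err (m n) A b))"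
proof -
  obtain c2 where c2: "0 < c2" "\<forall>\<^sub>F n in sequentially. norm (real (m n)) \<le> c2 * norm (ln (real n))"
    using mt by (auto simp: bigtheta_def elim: landau_o.bigE)
  obtain c1 where c1: "0 < c1" "\<forall>\<^sub>F n in sequentially. norm (real (m n)) \<ge> c1 * norm (ln (real n))"
    using mt by (auto simp: bigtheta_def elim: landau_omega.bigE)
  have ev1: "\<forall>\<^sub>F n in sequentially. (1 :: nat) \<le> n" by (rule eventually_ge_at_top)
  have evln: "\<forall>\<^sub>F n in sequentially. 1 \<le> ln (real n)" by real_asymp
  have "filterlim (\<lambda>n. ln (ln (real n))) at_top sequentially" by real_asymp
  then have evll: "\<forall>\<^sub>F n in sequentially. max 4 (1 / c1) \<le> ln (ln (real n))"
    by (simp only: filterlim_at_top)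
  have "(\<lambda>n. (ln (real n))\<^sup>2 * ln (real n) * exp (1 / 2 * ln (real n))) \<in> o(\<lambda>n. real n)"
    by real_asymp
  from landau_o.smallD[OF this, of "1 / (256 * c2\<^sup>2)"]
  have evC: "\<forall>\<^sub>F n in sequentially. norm ((ln (real n))\<^sup>2 * ln (real n) * exp (1 / 2 * ln (real n))) \<le> 1 / (256 * c2\<^sup>2) * norm (real n)"
    using c2(1) by simp
  show ?thesis
    using ev1 evln evll evC c1(2) c2(2)
  proof eventually_elim
    case (elim n)
    define l where "l = ln (real n)"
    define u where "u = ln (ln (real n))"
    define k where "k = real (m n)"
    have l: "1 \<le> l" using elim by (simp add: l_def)
    have u: "4 \<le> u" "1 / c1 \<le> u" using elim by (auto simp: u_def)
    have k: "1 \<le> k" "c1 * l \<le> k" "k \<le> c2 * l" using m1[of n] elim l by (auto simp: k_def l_def)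
    define \<gamma> where "\<gamma> = 0.015 * l\<^sup>2 / (k\<^sup>2 * u\<^sup>2)"
    have g0: "0 < \<gamma>" using l k u by (simp add: \<gamma>_def)
    have "l \<le> k * u"
    proof -
      have "l = c1 * l * (1 / c1)" using c1 by simp
      also have "\<dots> \<le> k * u" using k u c1 l by (intro mult_mono) auto
      finally show ?thesis .
    qed
    then have "l\<^sup>2 \<le> (k * u)\<^sup>2" using l by (intro power_mono) auto
    then have lku: "l\<^sup>2 \<le> k\<^sup>2 * u\<^sup>2" by (simp add: power_mult_distrib)
    have ku0: "0 < k\<^sup>2 * u\<^sup>2" using k u by simp
    have "\<gamma> = 3 / 200 * (l\<^sup>2 / (k\<^sup>2 * u\<^sup>2))" by (simp add: \<gamma>_def)
    moreover have "l\<^sup>2 / (k\<^sup>2 * u\<^sup>2) \<le> 1" using lku ku0 by (simp add: divide_le_eq)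
    ultimately have g1: "\<gamma> \<le> 1 / 8" by linarith
    have "sqrt (2 * \<gamma>) \<le> l / (4 * k * u)"
    proof (rule real_le_lsqrt)
      have "2 * \<gamma> = 0.03 * (l\<^sup>2 / (k\<^sup>2 * u\<^sup>2))" by (simp add: \<gamma>_def)
      also have "\<dots> \<le> 1 / 16 * (l\<^sup>2 / (k\<^sup>2 * u\<^sup>2))" by (intro mult_right_mono) auto
      also have "\<dots> = (l / (4 * k * u))\<^sup>2" by (simp add: power_divide power_mult_distrib)
      finally show "2 * \<gamma> \<le> (l / (4 * k * u))\<^sup>2" .
    qed (use g0 l k u in auto)
    then have "8 * k * sqrt (2 * \<gamma>) \<le> 8 * k * (l / (4 * k * u))" using k by (intro mult_left_mono) auto
    also have "\<dots> = 2 * l / u" using k by simp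
    also have "\<dots> \<le> 1 / 2 * l"
    proof -
      have "2 * l / u \<le> 2 * l / 4" using u l by (intro divide_left_mono) auto
      then show ?thesis by simp
    qed
    finally have e: "exp (8 * k * sqrt (2 * \<gamma>)) \<le> exp (1 / 2 * l)" by simp
    have k2: "k\<^sup>2 \<le> c2\<^sup>2 * l\<^sup>2" using k power_mono[of k "c2 * l" 2] by (simp add: power_mult_distrib)
    have "256 * k\<^sup>2 * l * exp (8 * k * sqrt (2 * \<gamma>)) \<le> 256 * (c2\<^sup>2 * l\<^sup>2) * l * exp (1 / 2 * l)"
      using k2 e l by (intro mult_mono) auto
    also have "\<dots> = 256 * c2\<^sup>2 * (l\<^sup>2 * l * exp (1 / 2 * l))" by simp
    also have "\<dots> \<le> 256 * c2\<^sup>2 * (1 / (256 * c2\<^sup>2) * real n)"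
      using elim l by (intro mult_left_mono) (auto simp: l_def)
    also have "\<dots> = real n" using c2 by simp
    finally have cond: "256 * k\<^sup>2 * l * exp (8 * k * sqrt (2 * \<gamma>)) \<le> real n" .
    have "1 \<le> m n" using m1 elim by simp
    from lower_bound_small[OF this g0 g1 l[unfolded l_def] cond[unfolded k_def l_def]] show ?case
      unfolding \<gamma>_def k_def l_def u_def .
  qed
qed

text \<open>Here \<open>8 m sqrt (2 \<gamma>) \<le> 12\<close>, so the condition reads \<open>m\<^sup>2 ln n \<le> c\<^sup>2 n\<close> for a constant \<open>c\<close>, which is the growth
  hypothesis on \<open>m\<close>. The divergence of \<open>m\<close> makes \<open>\<gamma>\<close> small.\<close>

lemma lower_bound_growing:
  fixes m :: "nat \<Rightarrow> nat"
  assumes mo: "(\<lambda>n. real (m n)) \<in> o(\<lambda>n. real n powr (1/2) * ln (real n) powr (-1/2))"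
    and mw: "(\<lambda>n. real (m n)) \<in> \<omega>(\<lambda>_. 1)"
  shows "\<forall>\<^sub>F n in sequentially. 1 - fail_prob n \<le>
      (SUP A \<in> sym_mats n. \<P>(b in uniform_sphere n. 1.08 / (real (m n))\<^sup>2 \<le> rel_err (m n) A b))"
proof -
  \<comment> \<open>This constant satisfies \<open>256 exp 12 c\<^sup>2 = 1\<close>.\<close>
  define c where "c = 1 / (16 * exp (6 :: real))"
  have c: "0 < c" "256 * exp 12 * c\<^sup>2 = 1"
  proof -
    show "0 < c" by (simp add: c_def)
    have "(exp (6 :: real))\<^sup>2 = exp 12" by (simp add: exp_double[symmetric])
    then show "256 * exp 12 * c\<^sup>2 = 1" by (simp add: c_def power_divide power_mult_distrib)
  qed
  have evln: "\<forall>\<^sub>F n in sequentially. 1 \<le> ln (real n)" by real_asymp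
  have ev1: "\<forall>\<^sub>F n in sequentially. (1 :: nat) \<le> n" by (rule eventually_ge_at_top)
  have evm: "\<forall>\<^sub>F n in sequentially. norm (real (m n)) \<ge> 3 * norm (1 :: real)"
    by (rule landau_omega.smallD[OF mw]) simp
  have evo: "\<forall>\<^sub>F n in sequentially. norm (real (m n)) \<le> c * norm (real n powr (1/2) * ln (real n) powr (-1/2))"
    by (rule landau_o.smallD[OF mo c(1)])
  show ?thesis
    using evln evm evo ev1
  proof eventually_elim
    case (elim n)
    define l where "l = ln (real n)"
    define k where "k = real (m n)"
    have l: "1 \<le> l" using elim by (simp add: l_def)
    have k: "3 \<le> k" using elim by (simp add: k_def)
    have "k \<le> c * (real n powr (1/2) * l powr (-1/2))" using elim by (simp add: k_def l_def)
    then have "k\<^sup>2 \<le> (c * (real n powr (1/2) * l powr (-1/2)))\<^sup>2" using k by (intro power_mono) auto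
    also have "\<dots> = c\<^sup>2 * (real n / l)"
    proof -
      have "(real n powr (1/2))\<^sup>2 = real n" using elim by (simp add: powr_power)
      moreover have "(l powr (-1/2))\<^sup>2 = 1 / l" using l
        by (simp add: power2_eq_square powr_add[symmetric])
      ultimately show ?thesis by (simp add: power_mult_distrib)
    qed
    finally have "k\<^sup>2 * l \<le> c\<^sup>2 * real n" using l by (simp add: pos_le_divide_eq)
    then have "256 * exp 12 * (k\<^sup>2 * l) \<le> 256 * exp 12 * (c\<^sup>2 * real n)" by (intro mult_left_mono) auto
    also have "\<dots> = (256 * exp 12 * c\<^sup>2) * real n" by simp
    finally have kl: "256 * k\<^sup>2 * l * exp 12 \<le> real n" unfolding c(2) by (simp add: mult_ac)
    define \<gamma> where "\<gamma> = 1.08 / k\<^sup>2"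
    have k9: "9 \<le> k\<^sup>2" using power_mono[OF k, of 2] by simp
    have g0: "0 < \<gamma>" using k by (simp add: \<gamma>_def)
    have g1: "\<gamma> \<le> 1 / 8" using k9 k by (simp add: \<gamma>_def divide_le_eq)
    have "sqrt (2 * \<gamma>) \<le> 3 / 2 / k"
    proof (rule real_le_lsqrt)
      have "2 * \<gamma> = 54 / 25 * (1 / k\<^sup>2)" by (simp add: \<gamma>_def)
      also have "\<dots> \<le> 9 / 4 * (1 / k\<^sup>2)" by (intro mult_right_mono) auto
      also have "\<dots> = (3 / 2 / k)\<^sup>2" by (simp add: power_divide)
      finally show "2 * \<gamma> \<le> (3 / 2 / k)\<^sup>2" .
    qed (use g0 k in auto)
    then have "8 * k * sqrt (2 * \<gamma>) \<le> 8 * k * (3 / 2 / k)" using k by (intro mult_left_mono) auto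
    also have "\<dots> = 12" using k by simp
    finally have "exp (8 * k * sqrt (2 * \<gamma>)) \<le> exp 12" by simp
    then have "256 * k\<^sup>2 * l * exp (8 * k * sqrt (2 * \<gamma>)) \<le> 256 * k\<^sup>2 * l * exp 12"
      using l by (intro mult_left_mono) auto
    then have cond: "256 * k\<^sup>2 * l * exp (8 * k * sqrt (2 * \<gamma>)) \<le> real n" using kl by linarith
    have "1 \<le> m n" using k unfolding k_def by linarith
    from lower_bound_small[OF this g0 g1 l[unfolded l_def] cond[unfolded k_def l_def]] show ?case
      unfolding \<gamma>_def k_def .
  qed
qed

theorem theorem3p1:
  shows
    "(\<forall>m :: nat \<Rightarrow> nat.
        (\<forall>n\<ge>1. 1 \<le> m n) \<and> (\<lambda>n. real (m n)) \<in> o(\<lambda>n. ln (real n)) \<longrightarrow>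
        (\<exists>\<epsilon> \<eta> :: nat \<Rightarrow> real.
           \<epsilon> \<longlonglongrightarrow> 0 \<and> (\<lambda>n. real n * \<eta> n) \<longlonglongrightarrow> 0 \<and>
           (\<forall>\<^sub>F n in sequentially.
              (SUP A \<in> sym_mats n. \<P>(b in uniform_sphere n. rel_err (m n) A b \<ge> 1 - \<epsilon> n))
                \<ge> 1 - \<eta> n)))
     \<and>
     (\<forall>m :: nat \<Rightarrow> nat.
        (\<forall>n\<ge>1. 1 \<le> m n) \<and> (\<lambda>n. real (m n)) \<in> \<Theta>(\<lambda>n. ln (real n)) \<longrightarrow>
        (\<exists>\<eta> :: nat \<Rightarrow> real.
           (\<lambda>n. real n * \<eta> n) \<longlonglongrightarrow> 0 \<and>
           (\<forall>\<^sub>F n in sequentially.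
              (SUP A \<in> sym_mats n. \<P>(b in uniform_sphere n.
                  rel_err (m n) A b \<ge>
                    0.015 * (ln (real n))\<^sup>2 / ((real (m n))\<^sup>2 * (ln (ln (real n)))\<^sup>2)))
                \<ge> 1 - \<eta> n)))
     \<and>
     (\<forall>m :: nat \<Rightarrow> nat.
        (\<forall>n\<ge>1. 1 \<le> m n) \<and>
        (\<lambda>n. real (m n)) \<in> o(\<lambda>n. real n powr (1/2) * ln (real n) powr (-1/2)) \<and>
        (\<lambda>n. real (m n)) \<in> \<omega>(\<lambda>_. 1) \<longrightarrow>
        (\<exists>\<eta> :: nat \<Rightarrow> real.
           (\<lambda>n. real n * \<eta> n) \<longlonglongrightarrow> 0 \<and>
           (\<forall>\<^sub>F n in sequentially.
              (SUP A \<in> sym_mats n. \<P>(b in uniform_sphere n.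
                  rel_err (m n) A b \<ge> 1.08 / (real (m n))\<^sup>2))
                \<ge> 1 - \<eta> n)))
     \<and>
     (\<forall>n m :: nat. \<forall>p :: real. n \<ge> 100 \<and> m \<ge> 10 \<and> p \<ge> 1 \<longrightarrow>
        (SUP A \<in> sym_mats n.
           (\<integral>b. (rel_err m A b) powr p \<partial>uniform_sphere n) powr (1/p))
          \<le> 0.068 * (ln (real n * (real m - 1) powr (8 * p)))\<^sup>2 / (real m - 1)\<^sup>2)"
proof (intro conjI allI impI, goal_cases)
  case (1 m)
  then have m: "\<And>n. 1 \<le> n \<Longrightarrow> 1 \<le> m n" "(\<lambda>n. real (m n)) \<in> o(\<lambda>n. ln (real n))" by auto
  show ?case
    using lower_bound_sublogarithmic[OF m] fail_prob_tendsto
    by (intro exI[of _ "\<lambda>n. exp (- sqrt (ln (real n) / real (m n)))"] exI[of _ fail_prob] conjI)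
next
  case (2 m)
  then have m: "\<And>n. 1 \<le> n \<Longrightarrow> 1 \<le> m n" "(\<lambda>n. real (m n)) \<in> \<Theta>(\<lambda>n. ln (real n))" by auto
  show ?case
    using lower_bound_logarithmic[OF m] fail_prob_tendsto by (intro exI[of _ fail_prob] conjI)
next
  case (3 m)
  then have m: "(\<lambda>n. real (m n)) \<in> o(\<lambda>n. real n powr (1/2) * ln (real n) powr (-1/2))"
    "(\<lambda>n. real (m n)) \<in> \<omega>(\<lambda>_. 1)" by auto
  show ?case
    using lower_bound_growing[OF m] fail_prob_tendsto by (intro exI[of _ fail_prob] conjI)
next
  case (4 n m p)
  then show ?case by (intro moment_bound) auto
qed

end
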